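(* Let $p/q$ be a rational number and let $f\colon\mathbb{T}\to\mathbb{T}$ be continuous. Let $R\colon\mathbb{T}^2\to\mathbb{T}^2$ be the homeomorphism $R(x,y)=(x+\tfrac pq,\;f(x)+y)$. Then for every $z\in\mathbb{T}^2$ and every $g\in C(\mathbb{T}^2)$, $$\sum_{n\le N} g(R^n z)\,\mu(n)=o(N)\quad\text{as }N\to\infty.$$
   Context: $\mathbb{T}=\mathbb{R}/\mathbb{Z}$ is the additive circle. $\mu\colon\mathbb{N}\to\{-1,0,1\}$ is the Möbius function: $\mu(1)=1$, $\mu(p_1\cdots p_k)=(-1)^k$ for distinct primes $p_1,\dots,p_k$, and $\mu(n)=0$ otherwise. *)

theory Defs
  imports
    "HOL-Analysis.Analysis"
    "HOL-Computational_Algebra.Squarefree"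
    "HOL-Library.Landau_Symbols"
begin

section \<open>The additive circle\<close>

quotient_type circle = real / "\<lambda>x y :: real. x - y \<in> \<int>"
  morphisms rep_circle to_circle
proof (rule equivpI)
  show "reflp (\<lambda>x y :: real. x - y \<in> \<int>)"
    by (auto simp: reflp_def)
  show "symp (\<lambda>x y :: real. x - y \<in> \<int>)"
    by (metis (mono_tags, lifting) Ints_minus minus_diff_eq sympI)
  show "transp (\<lambda>x y :: real. x - y \<in> \<int>)"
  proof (rule transpI)
    fix x y z :: real
    assume "x - y \<in> \<int>" "y - z \<in> \<int>"
    then have "(x - y) + (y - z) \<in> \<int>" by (rule Ints_add)
    then show "x - z \<in> \<int>" by simp
  qed
qed

lemma to_circle_eq_iff: "to_circle x = to_circle y \<longleftrightarrow> x - y \<in> \<int>"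
  by (rule circle.abs_eq_iff)

lemma to_circle_rep [simp]: "to_circle (rep_circle x) = x"
  using Quotient_circle by (simp add: Quotient_def)

lemma surj_to_circle: "surj to_circle"
  by (metis surjI to_circle_rep)

instantiation circle :: ab_group_add
begin

lift_definition zero_circle :: circle is "0 :: real" .

lift_definition plus_circle :: "circle \<Rightarrow> circle \<Rightarrow> circle" is "(+) :: real \<Rightarrow> real \<Rightarrow> real"
  by (metis Ints_add add_diff_add)

lift_definition uminus_circle :: "circle \<Rightarrow> circle" is "uminus :: real \<Rightarrow> real"
  by (metis Ints_minus minus_diff_minus)

lift_definition minus_circle :: "circle \<Rightarrow> circle \<Rightarrow> circle" is "(-) :: real \<Rightarrow> real \<Rightarrow> real"
proof -
  fix a b c d :: real
  assume "a - b \<in> \<int>" "c - d \<in> \<int>"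
  then have "(a - b) - (c - d) \<in> \<int>" by (rule Ints_diff)
  then show "(a - c) - (b - d) \<in> \<int>" by (simp add: algebra_simps)
qed

instance
  by standard (transfer; simp)+

end

text \<open>Open sets are those of the quotient topology.\<close>

instantiation circle :: topological_space
begin

definition open_circle :: "circle set \<Rightarrow> bool"
  where "open_circle U \<longleftrightarrow> open (to_circle -` U)"

instance
  by standard (auto simp: open_circle_def vimage_Union intro!: open_Int open_UN)

end

lemma open_to_circle_image:
  assumes "open V"
  shows "open (to_circle ` V)"
proof -
  have "to_circle -` (to_circle ` V) = (\<Union>k\<in>\<int>. (+) k ` V)"
  proof (intro equalityI subsetI)
    fix x assume "x \<in> to_circle -` (to_circle ` V)"
    then obtain v where v: "v \<in> V" "x - v \<in> \<int>"
      by (auto simp: to_circle_eq_iff)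
    then have "x = (x - v) + v" by simp
    with v show "x \<in> (\<Union>k\<in>\<int>. (+) k ` V)" by blast
  qed (auto simp: to_circle_eq_iff image_iff intro!: bexI)
  moreover have "open (\<Union>k\<in>\<int>. (+) k ` V)"
    using assms by (intro open_UN ballI open_translation)
  ultimately show ?thesis by (simp add: open_circle_def)
qed

lemma continuous_to_circle: "continuous_on UNIV to_circle"
  by (simp add: continuous_on_open_vimage open_circle_def)

instance circle :: topological_ab_group_add
proof
  fix a b :: circle
  show "((\<lambda>x. fst x + snd x) \<longlongrightarrow> a + b) (nhds a \<times>\<^sub>F nhds b)"
  proof (rule topological_tendstoI)
    fix U :: "circle set" assume U: "open U" "a + b \<in> U"
    define s t where "s = rep_circle a" and "t = rep_circle b"
    have ab: "a = to_circle s" "b = to_circle t" by (simp_all add: s_def t_def)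
    have "open (to_circle -` U)" using U by (simp add: open_circle_def)
    then have "open ((\<lambda>z :: real \<times> real. fst z + snd z) -` (to_circle -` U))"
      by (rule open_vimage) (intro continuous_intros)
    moreover have "(s, t) \<in> (\<lambda>z. fst z + snd z) -` (to_circle -` U)"
      using U by (simp add: ab plus_circle.abs_eq)
    ultimately obtain A B where AB: "open A" "open B" "s \<in> A" "t \<in> B"
        "A \<times> B \<subseteq> (\<lambda>z. fst z + snd z) -` (to_circle -` U)"
      by (auto elim!: open_prod_elim)
    have "\<forall>\<^sub>F x in nhds a. x \<in> to_circle ` A" "\<forall>\<^sub>F y in nhds b. y \<in> to_circle ` B"
      using AB ab by (auto intro!: eventually_nhds_in_open open_to_circle_image)
    then have "\<forall>\<^sub>F z in nhds a \<times>\<^sub>F nhds b. fst z \<in> to_circle ` A \<and> snd z \<in> to_circle ` B"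
      unfolding eventually_prod_filter by force
    then show "\<forall>\<^sub>F z in nhds a \<times>\<^sub>F nhds b. fst z + snd z \<in> U"
    proof eventually_elim
      case (elim z)
      with AB(5) show ?case by (auto simp: plus_circle.abs_eq)
    qed
  qed
  show "(uminus \<longlongrightarrow> - a) (nhds a)"
  proof (rule topological_tendstoI)
    fix U :: "circle set" assume U: "open U" "- a \<in> U"
    have "open (to_circle -` U)" using U by (simp add: open_circle_def)
    then have "open (uminus -` (to_circle -` U))"
      by (rule open_vimage) (intro continuous_intros)
    moreover have "uminus -` (to_circle -` U) = to_circle -` (uminus -` U)"
      by (auto simp: uminus_circle.abs_eq)
    ultimately have "open (uminus -` U)" by (simp add: open_circle_def)
    with U show "\<forall>\<^sub>F x in nhds a. - x \<in> U"
      using eventually_nhds_in_open[of "uminus -` U" a] by simp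
  qed
qed

lemma homeomorphism_skew_translation:
  fixes f :: "circle \<Rightarrow> circle"
  assumes "continuous_on UNIV f"
  shows "homeomorphism UNIV UNIV
    (\<lambda>(x, y). (x + a, f x + y)) (\<lambda>(x, y). (x - a, y - f (x - a)))"
proof -
  have *: "continuous_on UNIV (\<lambda>x. f (h x))" if "continuous_on UNIV h"
    for h :: "circle \<times> circle \<Rightarrow> circle"
    using continuous_on_compose2[OF assms that] by simp
  show ?thesis
    by (rule homeomorphismI)
       (auto simp: case_prod_unfold algebra_simps intro!: continuous_intros *)
qed


section \<open>The Moebius function\<close>

definition moebius_mu :: "nat \<Rightarrow> int"
  where "moebius_mu n = (if squarefree n then (-1) ^ card (prime_factors n) else 0)"

lemma moebius_mu_prod_primes:
  assumes "finite S" "\<And>p. p \<in> S \<Longrightarrow> prime p"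
  shows "moebius_mu (\<Prod>S) = (-1) ^ card S"
proof -
  have nz: "\<Prod>S \<noteq> 0" using assms by (metis not_prime_0 prod_zero_iff)
  have pf: "prime_factorization (\<Prod>S) = mset_set S"
  proof -
    have "prime_factorization (prod_mset (mset_set S)) = mset_set S"
      using assms by (intro prime_factorization_prod_mset_primes) auto
    then show ?thesis by (simp add: prod_unfold_prod_mset)
  qed
  then have "squarefree (\<Prod>S)"
    using nz assms
    by (auto simp: squarefree_factorial_semiring'' count_prime_factorization_prime[symmetric] count_mset_set')
  with pf assms show ?thesis by (simp add: moebius_mu_def)
qed

lemma moebius_mu_eq_0:
  assumes "\<nexists>S. finite S \<and> (\<forall>p\<in>S. prime p) \<and> n = \<Prod>S"
  shows "moebius_mu n = 0"
proof -
  have "n = \<Prod>(prime_factors n)" if sf: "squarefree n"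
  proof -
    have n: "n > 0" using sf by (cases "n = 0") auto
    have mult: "multiplicity p n = 1" if p: "p \<in> prime_factors n" for p
    proof -
      have "multiplicity p n \<le> 1"
        using sf n p by (auto simp: squarefree_factorial_semiring'')
      moreover have "multiplicity p n > 0"
        using p by (simp add: prime_factors_multiplicity)
      ultimately show ?thesis by linarith
    qed
    have "n = (\<Prod>p\<in>prime_factors n. p ^ multiplicity p n)"
      using n by (rule prime_factorization_nat)
    also have "\<dots> = \<Prod>(prime_factors n)"
      by (rule prod.cong) (simp_all add: mult)
    finally show ?thesis .
  qed
  moreover have "finite (prime_factors n)" "\<forall>p\<in>prime_factors n. prime p" by auto
  ultimately have "\<not> squarefree n" using assms by blast
  then show ?thesis by (simp add: moebius_mu_def)
qed

end

theory Submission
  imports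
    Defs
    "HOL-Complex_Analysis.Complex_Analysis"
    "HOL-Number_Theory.Number_Theory"
    "HOL-Real_Asymp.Real_Asymp"
begin

text \<open>Along an orbit the first coordinate runs through a cycle whose length divides q, so the orbit is a
finite union of orbits of rotations of a circle: on each residue class n = r modulo q the point
R^n z stays on one fibre and moves there by equal steps. A continuous function on a fibre is
uniformly close to a trigonometric polynomial, and a residue class is detected by additive
characters. Everything therefore follows from Davenport's theorem: the sums of \<mu>(n) e(n\<alpha>) over
n \<le> N are o(N) for every real \<alpha>, where e(x) = exp(2\<pi>ix) (lemma \<open>davenport\<close>).

For irrational \<alpha> the only input is multiplicativity, through the criterion of Katai
(\<open>katai_criterion_moebius\<close>): if F(pm) and F(rm) are asymptotically orthogonal for distinct primes
p and r, then \<mu> is orthogonal to F. For F(n) = e(n\<alpha>) that orthogonality is a geometric sum.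

For rational \<alpha> the function e(n\<alpha>) is periodic and the statement is as deep as the prime number
theorem in arithmetic progressions. A periodic weight is first reduced to weights supported on the
units modulo q, and those are decomposed into common eigenvectors of all the maps
v \<mapsto> v(a \<cdot>), which are multiples of Dirichlet characters \<chi>. For a character,
\<Sum> \<mu>(n) \<chi>(n) n^(-s) = 1 / L(s, \<chi>), and Newman's Tauberian theorem (\<open>newman_tauberian\<close>) turns
analyticity of this function on a neighbourhood of Re s \<ge> 1 into convergence of
\<Sum> \<mu>(n) \<chi>(n) / n, which is more than enough. Analyticity means that L has no zeros on the line
Re s = 1. This is the inequality 3 + 4 cos \<theta> + cos 2\<theta> \<ge> 0 (\<open>L_nonvanishing\<close>), except at s = 1 for
real \<chi>, where Monsky's argument with Lambert series applies (\<open>L_one_nonzero_if_real\<close>).\<close>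

section \<open>Newman's Tauberian theorem\<close>

lemma norm_of_nat_powr: "norm (of_nat n powr s :: complex) = real n powr Re s"
  by (subst norm_powr_real_powr) auto

lemma powr_diff_mvt:
  fixes a b u :: real
  assumes "0 < a" "a < b"
  obtains c where "a < c" "c < b" "b powr u - a powr u = (b - a) * (u * c powr (u - 1))"
proof -
  have "\<exists>z>a. z < b \<and> b powr u - a powr u = (b - a) * (u * z powr (u - 1))"
    by (rule MVT2) (use assms in \<open>auto intro!: derivative_eq_intros\<close>)
  then show ?thesis using that by blast
qed

text \<open>Compares the sum with the integral of t^(-1-x): one application of the mean value theorem per term,
then telescoping.\<close>

lemma sum_powr_tail_le:
  fixes x :: real
  assumes "x > 0" "N > 0"
  shows "(\<Sum>n=Suc N..M. real n powr (-1 - x)) \<le> real N powr -x / x"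
proof -
  have step: "real (Suc n) powr (-1-x) \<le> (real n powr -x - real (Suc n) powr -x) / x" if n: "n > 0" for n
  proof -
    obtain c where c: "real n < c" "c < real (Suc n)"
      "real (Suc n) powr (-x) - real n powr (-x) = (real (Suc n) - real n) * (-x * c powr (-x - 1))"
      by (rule powr_diff_mvt[of "real n" "real (Suc n)" "-x"]) (use n in auto)
    have "real (Suc n) powr (-1-x) \<le> c powr (-x-1)"
      using c assms n powr_mono2'[of "-x-1" c "real (Suc n)"]
      by (simp add: minus_diff_commute)
    then have "x * real (Suc n) powr (-1-x) \<le> x * c powr (-x-1)"
      using assms by (intro mult_left_mono) auto
    moreover have "real n powr -x - real (Suc n) powr -x = x * c powr (-x-1)" using c(3) by simp
    ultimately have "x * real (Suc n) powr (-1-x) \<le> real n powr -x - real (Suc n) powr -x" by linarith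
    then show ?thesis using assms(1) by (simp only: le_divide_eq mult.commute split: if_splits) simp
  qed
  have "(\<Sum>n=Suc N..M. real n powr (-1 - x)) \<le> (real N powr -x - real (max N M) powr -x) / x"
  proof (induction M)
    case (Suc M)
    show ?case
    proof (cases "Suc M \<le> N")
      case False
      then have "(\<Sum>n=Suc N..Suc M. real n powr (-1 - x)) = (\<Sum>n=Suc N..M. real n powr (-1 - x)) + real (Suc M) powr (-1-x)"
        by simp
      also have "\<dots> \<le> (real N powr -x - real (max N M) powr -x) / x + (real M powr -x - real (Suc M) powr -x) / x"
        using False assms by (intro add_mono Suc step) auto
      also have "\<dots> = (real N powr -x - real (max N (Suc M)) powr -x) / x"
        using False by (simp add: max_def flip: add_divide_distrib)
      finally show ?thesis .
    qed (auto simp: max_def)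
  qed (use assms in auto)
  also have "\<dots> \<le> real N powr -x / x" using assms by (simp add: divide_right_mono)
  finally show ?thesis .
qed

text \<open>The term N^(u-1) on the right makes one bound serve both for u \<ge> 1, where the summand increases and
is compared with the integral to its right, and for u < 1, where it decreases.\<close>

lemma sum_powr_le:
  fixes u :: real
  assumes "u > 0"
  shows "(\<Sum>n=1..N. real n powr (u - 1)) \<le> real N powr (u - 1) + real N powr u / u"
proof (cases "u \<ge> 1")
  case True
  have step: "real n powr (u-1) \<le> (real (Suc n) powr u - real n powr u) / u" if n: "n > 0" for n
  proof -
    obtain c where c: "real n < c" "c < real (Suc n)"
      "real (Suc n) powr u - real n powr u = (real (Suc n) - real n) * (u * c powr (u - 1))"
      by (rule powr_diff_mvt[of "real n" "real (Suc n)" u]) (use n in auto)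
    have "real n powr (u-1) \<le> c powr (u-1)"
      using c True by (intro powr_mono2) auto
    with c(3) assms show ?thesis by (simp add: field_simps)
  qed
  have "(\<Sum>n=1..N. real n powr (u - 1)) \<le> real N powr (u - 1) + (real N powr u) / u"
  proof (induction N)
    case (Suc N)
    show ?case
    proof (cases "N = 0")
      case False
      have "(\<Sum>n=1..Suc N. real n powr (u - 1)) \<le> real N powr (u-1) + real N powr u / u + real (Suc N) powr (u-1)"
        using Suc by simp
      also have "\<dots> \<le> (real (Suc N) powr u - real N powr u) / u + real N powr u / u + real (Suc N) powr (u-1)"
        using step[of N] False by simp
      finally show ?thesis using assms by (simp add: field_simps)
    qed (use assms in auto)
  qed auto
  then show ?thesis .
next
  case False
  have step: "real (Suc n) powr (u-1) \<le> (real (Suc n) powr u - real n powr u) / u" for n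
  proof (cases "n = 0")
    case n: False
    obtain c where c: "real n < c" "c < real (Suc n)"
      "real (Suc n) powr u - real n powr u = (real (Suc n) - real n) * (u * c powr (u - 1))"
      by (rule powr_diff_mvt[of "real n" "real (Suc n)" u]) (use n in auto)
    have "real (Suc n) powr (u-1) \<le> c powr (u-1)"
      using c False n by (intro powr_mono2') auto
    with c(3) assms show ?thesis by (simp add: field_simps)
  qed (use False assms in auto)
  have "(\<Sum>n=1..N. real n powr (u - 1)) \<le> real N powr u / u"
  proof (induction N)
    case (Suc N)
    then show ?case using step[of N] by (simp add: diff_divide_distrib del: of_nat_Suc)
  qed auto
  then show ?thesis by (smt (verit) powr_ge_zero)
qed

text \<open>The principal logarithm is a primitive on the whole of a path that stays in the closed right
half-plane without the origin, so that the integral does not depend on the path.\<close>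

lemma contour_integral_inverse_right:
  assumes "valid_path g" "path_image g \<subseteq> {z. Re z \<ge> 0} - {0}" "R > 0"
    and "pathstart g = - \<i> * of_real R" "pathfinish g = \<i> * of_real R"
  shows "((\<lambda>z. 1 / z) has_contour_integral \<i> * pi) g"
proof -
  have "((\<lambda>z. 1 / z) has_contour_integral Ln (pathfinish g) - Ln (pathstart g)) g"
  proof (rule contour_integral_primitive)
    show "path_image g \<subseteq> - \<real>\<^sub>\<le>\<^sub>0"
      using assms(2) by (fastforce simp: complex_nonpos_Reals_iff complex_eq_iff)
    show "(Ln has_field_derivative 1 / x) (at x within - \<real>\<^sub>\<le>\<^sub>0)" if "x \<in> - \<real>\<^sub>\<le>\<^sub>0" for x
      using that by (auto intro!: derivative_eq_intros simp: field_simps)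
  qed fact
  moreover have "Ln (\<i> * of_real R) = ln R + \<i> * pi / 2" "Ln (- \<i> * of_real R) = ln R - \<i> * pi / 2"
    using assms(3) Ln_times_of_real[of R \<i>] Ln_times_of_real[of R "-\<i>"]
    by (simp_all add: mult.commute Ln_of_real)
  ultimately show ?thesis using assms by simp
qed

text \<open>Here the primitive is Ln (-z), whose cut is the positive real axis.\<close>

lemma contour_integral_inverse_left:
  assumes "valid_path g" "path_image g \<subseteq> {z. Re z \<le> 0} - {0}" "R > 0"
    and "pathstart g = \<i> * of_real R" "pathfinish g = - \<i> * of_real R"
  shows "((\<lambda>z. 1 / z) has_contour_integral \<i> * pi) g"
proof -
  have "((\<lambda>z. 1 / z) has_contour_integral Ln (- pathfinish g) - Ln (- pathstart g)) g"
  proof (rule contour_integral_primitive)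
    show "path_image g \<subseteq> {z. - z \<notin> \<real>\<^sub>\<le>\<^sub>0}"
      using assms(2) by (fastforce simp: complex_nonpos_Reals_iff complex_eq_iff)
    show "((\<lambda>z. Ln (- z)) has_field_derivative 1 / x) (at x within {z. - z \<notin> \<real>\<^sub>\<le>\<^sub>0})" 
      if "x \<in> {z. - z \<notin> \<real>\<^sub>\<le>\<^sub>0}" for x
      using that by (auto intro!: derivative_eq_intros simp: field_simps)
  qed fact
  moreover have "Ln (\<i> * of_real R) = ln R + \<i> * pi / 2" "Ln (- \<i> * of_real R) = ln R - \<i> * pi / 2"
    using assms(3) Ln_times_of_real[of R \<i>] Ln_times_of_real[of R "-\<i>"]
    by (simp_all add: mult.commute Ln_of_real)
  ultimately show ?thesis using assms by simp
qed

text \<open>Cauchy's formula for a closed curve composed of an arc from -iR to iR in the right half-plane and an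
arc back in the left half-plane: by the two preceding lemmas its winding number around 0 is 1. The left arc may be replaced
by any other one without recomputing winding numbers, which is how Newman's proof uses a semicircle
for the partial sums and a rectangle for the limit function.\<close>

lemma cauchy_two_arcs:
  assumes V: "open V" "convex V" "0 \<in> V" "f holomorphic_on V"
    and gr: "valid_path gr" "path_image gr \<subseteq> V \<inter> {z. Re z \<ge> 0} - {0}"
      "pathstart gr = - \<i> * of_real R" "pathfinish gr = \<i> * of_real R"
    and gl: "valid_path gl" "path_image gl \<subseteq> V \<inter> {z. Re z \<le> 0} - {0}"
      "pathstart gl = \<i> * of_real R" "pathfinish gl = - \<i> * of_real R"
    and R: "R > 0"
  shows "contour_integral gr (\<lambda>z. f z / z) + contour_integral gl (\<lambda>z. f z / z) = 2 * pi * \<i> * f 0"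
proof -
  let ?g = "gr +++ gl"
  have vp: "valid_path ?g" using gr gl by (intro valid_path_join) auto
  have im: "path_image ?g \<subseteq> V - {0}" using gr gl by (subst path_image_join) auto
  have "((\<lambda>z. 1 / z) has_contour_integral \<i> * pi + \<i> * pi) ?g"
    using gr gl R by (intro has_contour_integral_join contour_integral_inverse_left[of _ R] contour_integral_inverse_right[of _ R]) auto
  then have "contour_integral ?g (\<lambda>z. 1 / z) = 2 * pi * \<i>"
    by (simp add: contour_integral_unique)
  then have wn: "winding_number ?g 0 = 1"
    using vp im by (subst winding_number_valid_path) auto
  have "((\<lambda>w. f w / (w - 0)) has_contour_integral (2*pi * \<i> * winding_number ?g 0 * f 0)) ?g"
    by (rule Cauchy_integral_formula_convex_simple[of V]) (use V vp im gr gl in \<open>auto simp: interior_open\<close>)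
  then have 1: "contour_integral ?g (\<lambda>z. f z / z) = 2 * pi * \<i> * f 0"
    by (simp add: wn contour_integral_unique)
  have hol: "(\<lambda>z. f z / z) holomorphic_on V - {0}"
    using V by (auto intro!: holomorphic_intros intro: holomorphic_on_subset)
  have "(\<lambda>z. f z / z) contour_integrable_on gr" "(\<lambda>z. f z / z) contour_integrable_on gl"
    using gr gl V by (auto intro!: contour_integrable_holomorphic_simple[OF hol])
  then show ?thesis using 1 gr gl by (simp add: contour_integral_join)
qed

text \<open>On |z| = R one has 1/z = cnj z / R^2, so Newman's kernel 1/z + z/R^2 equals 2 Re z / R^2. The factor
Re z compensates the singularity of the tail estimates at the imaginary axis.\<close>

lemma norm_kernel_on_circle:
  assumes "norm z = R" "R > 0"
  shows "norm ((1 + z\<^sup>2 / of_real (R\<^sup>2)) / z) = 2 * \<bar>Re z\<bar> / R\<^sup>2"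
proof -
  have z: "z \<noteq> 0" using assms by auto
  have R2: "of_real (R\<^sup>2) = z * cnj z" using assms by (metis complex_norm_square of_real_power)
  have "(1 + z\<^sup>2 / of_real (R\<^sup>2)) / z = (cnj z + z) / of_real (R\<^sup>2)"
    using z unfolding R2 by (simp add: field_simps power2_eq_square)
  also have "cnj z + z = of_real (2 * Re z)" by (simp add: complex_eq_iff)
  finally show ?thesis by (simp only: norm_divide norm_of_real) (simp add: abs_mult)
qed

text \<open>For the horizontal sides of the contour: the integrand is not uniformly small there, because it does
not decay at the endpoint on the imaginary axis, but its integral is O(1/c).\<close>

lemma norm_linepath_integral_exp_le:
  assumes int: "f contour_integrable_on (linepath a b)" and c: "c > 0" and "M \<ge> 0"
    and bd: "\<And>t. t \<in> {0..1} \<Longrightarrow> norm (f (linepath a b t)) \<le> M * exp (- c * t)"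
  shows "norm (contour_integral (linepath a b) f) \<le> M * norm (b - a) / c"
proof -
  let ?I = "contour_integral (linepath a b) f"
  have 1: "((\<lambda>x. f (linepath a b x) * (b - a)) has_integral ?I) {0..1}"
    using int has_contour_integral_integral has_contour_integral_linepath by blast
  have 2: "((\<lambda>x. M * norm (b - a) * exp (-c * x)) has_integral
      (- M * norm (b - a) * exp (-c * 1) / c) - (- M * norm (b - a) * exp (-c * 0) / c)) {0..1}"
    by (rule fundamental_theorem_of_calculus)
       (use c in \<open>auto intro!: derivative_eq_intros simp flip: has_real_derivative_iff_has_vector_derivative\<close>)
  have "norm (integral {0..1} (\<lambda>x. f (linepath a b x) * (b - a))) \<le> integral {0..1} (\<lambda>x. M * norm (b - a) * exp (-c * x))"
  proof (rule integral_norm_bound_integral)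
    fix x :: real assume "x \<in> {0..1}"
    then have "norm (f (linepath a b x)) * norm (b - a) \<le> M * exp (- c * x) * norm (b - a)"
      by (intro mult_right_mono bd) auto
    then show "norm (f (linepath a b x) * (b - a)) \<le> M * norm (b - a) * exp (-c * x)"
      by (simp add: norm_mult mult_ac)
  qed (use 1 2 in blast)+
  then have "norm ?I \<le> (- M * norm (b - a) * exp (-c * 1) / c) - (- M * norm (b - a) * exp (-c * 0) / c)"
    using 1 2 by (metis integral_unique)
  also have "\<dots> \<le> M * norm (b - a) / c" using assms by (simp add: field_simps)
  finally show ?thesis .
qed

text \<open>Newman's contour argument. With S the partial sum, F(0) - S(0) is by Cauchy's formula an integral
with the kernel N^z (1/z + z/R^2). On the right semicircle F - S is the tail of the series, of size
N^(-x)/x; on the left the entire function S, of size N^u (1/N + 1/u) with u = -x, can be integrated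
over the reflected semicircle; in both cases the kernel leaves O(1/R^2), hence O(1/R) after
integration. The function F itself on the left is integrated over three sides of a rectangle inside
the domain of analyticity, where the factor N^z tends to 0.\<close>

lemma newman_estimate:
  fixes a :: "nat \<Rightarrow> complex" and F :: "complex \<Rightarrow> complex"
  assumes a: "\<And>n. norm (a n) \<le> 1"
    and U: "open U" "{z. Re z \<ge> 0} \<subseteq> U" "F holomorphic_on U"
    and sums: "\<And>s. Re s > 0 \<Longrightarrow> (\<lambda>n. a n * of_nat n powr (-1 - s)) sums F s"
    and R: "R \<ge> 1"
  shows "\<forall>\<^sub>F N in sequentially. norm (F 0 - (\<Sum>n=1..N. a n / of_nat n)) \<le> 4 / R"
proof -
  define S where "S = (\<lambda>N s::complex. \<Sum>n=1..N. a n * of_nat n powr (-1 - s))"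
  define E where "E = (\<lambda>N z::complex. exp (z * of_real (ln (real N))))"
  define K where "K = (\<lambda>z::complex. 1 + z\<^sup>2 / of_real (R\<^sup>2))"
  have R0: "R > 0" using R by simp
  have K0: "K 0 = 1" and E0: "E N 0 = 1" for N by (simp_all add: K_def E_def)
  have normE: "norm (E N z) = real N powr Re z" if "N > 0" for N z
    using that by (simp add: E_def powr_def)
  have S_hol: "(\<lambda>z. S N z * E N z * K z) holomorphic_on X" for N X
    unfolding S_def E_def K_def by (intro holomorphic_intros) (use R0 in auto)

  \<comment> \<open>Compactness of a segment of the imaginary axis gives analyticity on a strip to its left.\<close>
  have "\<exists>e>0. {z::complex. Re z > -e \<and> \<bar>Im z\<bar> < 2 * R} \<subseteq> U"
  proof -
    let ?C = "cball (0::complex) (2 * R) \<inter> {z. Re z = 0}"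
    have "compact ?C" by (intro compact_Int_closed compact_cball closed_Collect_eq continuous_intros)
    moreover have "?C \<subseteq> U" using U by auto
    ultimately obtain e where e: "e > 0" "(\<Union>x\<in>?C. ball x e) \<subseteq> U"
      using U(1) compact_subset_open_imp_ball_epsilon_subset by metis
    have "z \<in> U" if z: "Re z > -e" "\<bar>Im z\<bar> < 2 * R" for z :: complex
    proof (cases "Re z \<ge> 0")
      case False
      have "\<i> * of_real (Im z) \<in> ?C" using z by (simp add: norm_mult)
      moreover have "\<i> * of_real (Im z) - z = - of_real (Re z)" by (simp add: complex_eq_iff)
      then have "z \<in> ball (\<i> * of_real (Im z)) e" using False z by (simp add: dist_norm)
      ultimately show ?thesis using e by blast
    qed (use U in auto)
    then show ?thesis using e(1) by auto
  qed
  then obtain e where e: "e > 0" and eU: "{z. Re z > -e \<and> \<bar>Im z\<bar> < 2 * R} \<subseteq> U" by blast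
  define V where "V = {z::complex. Re z > -e \<and> \<bar>Im z\<bar> < 2 * R}"
  have V_eq: "V = {z::complex. Re z > -e} \<inter> {z. Im z < 2 * R} \<inter> {z. Im z > - (2 * R)}"
    by (auto simp: V_def)
  have V: "open V" "convex V" "0 \<in> V" "V \<subseteq> U"
    unfolding V_eq using e R0 eU
    by (auto intro!: open_Int convex_Int open_halfspace_Re_gt open_halfspace_Im_lt open_halfspace_Im_gt
        convex_halfspace_Re_gt convex_halfspace_Im_lt convex_halfspace_Im_gt simp: V_def)
  have F_hol: "(\<lambda>z. F z * E N z * K z) holomorphic_on V" for N
    unfolding E_def K_def using R0 V(4) U(3)
    by (intro holomorphic_intros) (auto intro: holomorphic_on_subset)

  define d where "d = e / 2"
  have d: "d > 0" "d < e" using e by (auto simp: d_def)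
  define P Q where "P = \<i> * of_real R" and "Q = \<i> * of_real R - of_real d"
  define P' Q' where "P' = - \<i> * of_real R" and "Q' = - \<i> * of_real R - of_real d"
  \<comment> \<open>A and A' are the right and left semicircle; B joins the endpoints of A by three sides of a rectangle.\<close>
  define A where "A = part_circlepath 0 R (-pi/2) (pi/2)"
  define A' where "A' = part_circlepath 0 R (pi/2) (3*pi/2)"
  define B where "B = linepath P Q +++ linepath Q Q' +++ linepath Q' P'"
  have A: "valid_path A" "pathstart A = P'" "pathfinish A = P"
    by (auto simp: A_def P_def P'_def exp_eq_polar cis_conv_exp[symmetric] simp flip: exp_eq_polar)
       (simp_all add: complex_eq_iff Re_exp Im_exp)
  have A_im: "norm z = R" "Re z \<ge> 0" if "z \<in> path_image A" for z
  proof -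
    from that obtain t where t: "t \<in> {-pi/2..pi/2}" "z = of_real R * exp (\<i> * of_real t)"
      using R0 by (auto simp: A_def path_image_part_circlepath)
    then show "norm z = R" using R0 by (simp add: norm_mult)
    show "Re z \<ge> 0" using t R0 by (simp add: Re_exp cos_ge_zero)
  qed
  have three_halves: "cos (3 * pi / 2) = 0" "sin (3 * pi / 2) = -1"
    using cos_3over2_pi sin_3over2_pi by (simp_all add: mult.commute)
  have A': "valid_path A'" "pathstart A' = P" "pathfinish A' = P'"
    by (auto simp: A'_def P_def P'_def exp_eq_polar cis_conv_exp[symmetric] simp flip: exp_eq_polar)
       (simp_all add: complex_eq_iff Re_exp Im_exp three_halves)
  have A'_im: "norm z = R" "Re z \<le> 0" if "z \<in> path_image A'" for z
  proof -
    from that obtain t where t: "t \<in> {pi/2..3*pi/2}" "z = of_real R * exp (\<i> * of_real t)"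
      using R0 by (auto simp: A'_def path_image_part_circlepath)
    then show "norm z = R" using R0 by (simp add: norm_mult)
    have "cos t = - cos (t - pi)" by (simp add: cos_diff)
    also have "\<dots> \<le> 0" using t cos_ge_zero[of "t - pi"] by (auto simp del: cos_minus_pi)
    finally show "Re z \<le> 0" using t R0 by (simp add: Re_exp mult_nonneg_nonpos)
  qed
  have seg1: "closed_segment P Q \<subseteq> {z. Im z = R \<and> -d \<le> Re z \<and> Re z \<le> 0}"
    and seg2: "closed_segment Q Q' \<subseteq> {z. Re z = -d \<and> \<bar>Im z\<bar> \<le> R}"
    and seg3: "closed_segment Q' P' \<subseteq> {z. Im z = -R \<and> -d \<le> Re z \<and> Re z \<le> 0}"
    using d R0 unfolding P_def Q_def P'_def Q'_def
    by (auto simp: closed_segment_same_Im closed_segment_same_Re closed_segment_eq_real_ivl)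
  have segV: "closed_segment P Q \<union> closed_segment Q Q' \<union> closed_segment Q' P' \<subseteq> V \<inter> {z. Re z \<le> 0} - {0}"
    using seg1 seg2 seg3 d R0 by (fastforce simp: V_def)
  have B: "valid_path B" "pathstart B = P" "pathfinish B = P'" "path_image B \<subseteq> V \<inter> {z. Re z \<le> 0} - {0}"
    using segV by (auto simp: B_def path_image_join intro!: valid_path_join)

  define f where "f = (\<lambda>N z. F z * E N z * K z / z)"
  define h where "h = (\<lambda>N z. S N z * E N z * K z / z)"
  have AV: "path_image A \<subseteq> V \<inter> {z. Re z \<ge> 0} - {0}"
  proof
    fix z assume "z \<in> path_image A"
    then have "norm z = R" "Re z \<ge> 0" by (rule A_im)+
    then show "z \<in> V \<inter> {z. Re z \<ge> 0} - {0}"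
      using R0 e abs_Im_le_cmod[of z] by (auto simp: V_def)
  qed
  have F_formula: "contour_integral A (f N) + contour_integral B (f N) = 2 * pi * \<i> * F 0" for N
    unfolding f_def
    using cauchy_two_arcs[OF V(1-3) F_hol A(1) AV _ _ B(1,4), of R N] A B R0
    by (simp add: P_def P'_def K0 E0)
  have S_formula: "contour_integral A (h N) + contour_integral A' (h N) = 2 * pi * \<i> * S N 0" for N
  proof -
    have "path_image A \<subseteq> UNIV \<inter> {z. Re z \<ge> 0} - {0}" using AV by auto
    moreover have "path_image A' \<subseteq> UNIV \<inter> {z. Re z \<le> 0} - {0}" using A'_im R0 by fastforce
    ultimately show ?thesis
      using cauchy_two_arcs[OF _ _ _ S_hol A(1) _ _ _ A'(1), of UNIV R N] A A' R0
      by (simp add: P_def P'_def K0 E0 h_def)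
  qed
  have f_hol: "f N holomorphic_on V - {0}" for N
    unfolding f_def by (rule holomorphic_on_divide[OF holomorphic_on_subset[OF F_hol] holomorphic_on_ident]) auto
  have h_hol: "h N holomorphic_on - {0}" for N
    unfolding h_def by (rule holomorphic_on_divide[OF S_hol holomorphic_on_ident]) auto
  have f_int: "f N contour_integrable_on g" if "valid_path g" "path_image g \<subseteq> V - {0}" for N g
    by (rule contour_integrable_holomorphic_simple[OF f_hol]) (use that V in auto)
  have h_int: "h N contour_integrable_on g" if "valid_path g" "0 \<notin> path_image g" for N g
    by (rule contour_integrable_holomorphic_simple[OF h_hol]) (use that V in auto)

  have tail: "norm (F z - S N z) \<le> real N powr - Re z / Re z" if z: "Re z > 0" and N: "N > 0" for N z
  proof (rule LIMSEQ_le_const2)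
    have "(\<lambda>M. \<Sum>n<Suc M. a n * of_nat n powr (-1 - z)) \<longlonglongrightarrow> F z"
      using sums[OF z] unfolding sums_def by (rule LIMSEQ_Suc)
    moreover have "(\<Sum>n<Suc M. a n * of_nat n powr (-1 - z)) = S M z" for M
      unfolding S_def by (rule sum.mono_neutral_right) (auto simp: not_le Suc_le_eq)
    ultimately show "(\<lambda>M. norm (S M z - S N z)) \<longlonglongrightarrow> norm (F z - S N z)"
      by (intro tendsto_intros) simp
    have "norm (S M z - S N z) \<le> real N powr - Re z / Re z" if "M \<ge> N" for M
    proof -
      have "S M z - S N z = (\<Sum>n=Suc N..M. a n * of_nat n powr (-1 - z))"
      proof -
        have "{1..M} = {1..N} \<union> {Suc N..M}" using that by auto
        then have "S M z = S N z + (\<Sum>n=Suc N..M. a n * of_nat n powr (-1 - z))"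
          unfolding S_def by (subst sum.union_disjoint[symmetric]) auto
        then show ?thesis by simp
      qed
      also have "norm \<dots> \<le> (\<Sum>n=Suc N..M. real n powr (-1 - Re z))"
        by (intro sum_norm_le) (use a in \<open>auto simp: norm_mult norm_of_nat_powr mult_le_cancel_right1\<close>)
      also have "\<dots> \<le> real N powr - Re z / Re z" by (rule sum_powr_tail_le[OF z N])
      finally show ?thesis .
    qed
    then show "\<exists>M0. \<forall>M\<ge>M0. norm (S M z - S N z) \<le> real N powr - Re z / Re z" by blast
  qed

  have bound_A: "norm (contour_integral A (\<lambda>z. f N z - h N z)) \<le> 2 * pi / R" if N: "N > 0" for N
  proof -
    have "norm (contour_integral A (\<lambda>z. f N z - h N z)) \<le> 2 / R\<^sup>2 * R * (pi/2 - (-pi/2))"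
      unfolding A_def
    \<comment> \<open>The series diverges at the endpoints, where Re z = 0; two points do not affect the integral.\<close>
    proof (rule has_contour_integral_bound_part_circlepath_strong[where k = "{P, P'}"])
      show "((\<lambda>z. f N z - h N z) has_contour_integral
         contour_integral (part_circlepath 0 R (- pi / 2) (pi / 2)) (\<lambda>z. f N z - h N z)) (part_circlepath 0 R (- pi / 2) (pi / 2))"
        using AV A unfolding A_def
        by (intro has_contour_integral_integral contour_integrable_diff f_int h_int) auto
      fix z assume "z \<in> path_image (part_circlepath 0 R (- pi / 2) (pi / 2)) - {P, P'}"
      then have z: "norm z = R" "Re z \<ge> 0" "z \<noteq> P" "z \<noteq> P'" using A_im unfolding A_def by auto
      have "Re z \<noteq> 0"
      proof
        assume "Re z = 0"
        then have "\<bar>Im z\<bar> = R" using z(1) by (simp add: norm_complex_def)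
        then show False using \<open>Re z = 0\<close> z R0 by (auto simp: P_def P'_def complex_eq_iff abs_if split: if_splits)
      qed
      then have x: "Re z > 0" using z by simp
      have "f N z - h N z = (F z - S N z) * E N z * (K z / z)"
        by (simp add: f_def h_def left_diff_distrib diff_divide_distrib)
      also have "norm \<dots> = norm (F z - S N z) * real N powr Re z * (2 * Re z / R\<^sup>2)"
        using norm_kernel_on_circle[OF z(1) R0] x by (simp only: norm_mult normE[OF N] K_def abs_of_pos)
      also have "\<dots> \<le> (real N powr - Re z / Re z) * real N powr Re z * (2 * Re z / R\<^sup>2)"
        using x by (intro mult_right_mono tail N) auto
      also have "\<dots> = 2 / R\<^sup>2" using x N by (simp add: powr_minus field_simps)
      finally show "norm (f N z - h N z) \<le> 2 / R\<^sup>2" .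
    qed (use R0 in auto)
    also have "\<dots> = 2 * pi / R" using R0 by (simp add: field_simps power2_eq_square)
    finally show ?thesis .
  qed

  have bound_A': "norm (contour_integral A' (h N)) \<le> 4 * pi / R" if N: "real N \<ge> R" for N
  proof -
    have N0: "N > 0" using N R0 by (cases N) auto
    have "norm (contour_integral A' (h N)) \<le> 4 / R\<^sup>2 * R * (3*pi/2 - pi/2)"
      unfolding A'_def
    proof (rule has_contour_integral_bound_part_circlepath_strong[where k = "{P, P'}"])
      show "(h N has_contour_integral
         contour_integral (part_circlepath 0 R (pi / 2) (3*pi / 2)) (h N)) (part_circlepath 0 R (pi / 2) (3*pi / 2))"
        using A'_im A' R0 unfolding A'_def
        by (intro has_contour_integral_integral h_int) force+
      fix z assume "z \<in> path_image (part_circlepath 0 R (pi / 2) (3*pi / 2)) - {P, P'}"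
      then have z: "norm z = R" "Re z \<le> 0" "z \<noteq> P" "z \<noteq> P'" using A'_im unfolding A'_def by auto
      have "Re z \<noteq> 0"
      proof
        assume "Re z = 0"
        then have "\<bar>Im z\<bar> = R" using z(1) by (simp add: norm_complex_def)
        then show False using \<open>Re z = 0\<close> z R0 by (auto simp: P_def P'_def complex_eq_iff abs_if split: if_splits)
      qed
      define u where "u = - Re z"
      have u: "u > 0" "u \<le> R" using z \<open>Re z \<noteq> 0\<close> abs_Re_le_cmod[of z] by (auto simp: u_def)
      have "norm (S N z) \<le> (\<Sum>n=1..N. real n powr (u - 1))"
      proof -
        have u1: "u - 1 = -1 - Re z" by (simp add: u_def)
        show ?thesis unfolding S_def u1
          by (intro sum_norm_le) (use a in \<open>auto simp: norm_mult norm_of_nat_powr mult_le_cancel_right1\<close>)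
      qed
      also have "\<dots> \<le> real N powr (u - 1) + real N powr u / u" by (rule sum_powr_le[OF u(1)])
      also have "\<dots> = real N powr u * (1 / real N + 1 / u)"
        using N0 by (simp add: powr_diff field_simps)
      finally have S: "norm (S N z) \<le> real N powr u * (1 / real N + 1 / u)" .
      have "h N z = S N z * E N z * (K z / z)" by (simp add: h_def)
      also have "norm \<dots> = norm (S N z) * real N powr - u * (2 * u / R\<^sup>2)"
        using norm_kernel_on_circle[OF z(1) R0] z(2)
        by (simp only: norm_mult normE[OF N0] K_def u_def abs_of_nonpos minus_minus)
      also have "\<dots> \<le> real N powr u * (1 / real N + 1 / u) * real N powr - u * (2 * u / R\<^sup>2)"
        using u by (intro mult_right_mono S) auto
      also have "\<dots> = 2 / R\<^sup>2 * (u / real N + 1)" using u N0 by (simp add: powr_minus field_simps)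
      also have "\<dots> \<le> 2 / R\<^sup>2 * (1 + 1)" using u N N0 by (intro mult_left_mono add_mono) auto
      finally show "norm (h N z) \<le> 4 / R\<^sup>2" by simp
    qed (use R0 in auto)
    also have "\<dots> = 4 * pi / R" using R0 by (simp add: field_simps power2_eq_square)
    finally show ?thesis .
  qed

  have "compact ((\<lambda>z. F z * K z / z) ` path_image B)"
  proof (intro compact_continuous_image compact_path_image valid_path_imp_path B)
    have "(\<lambda>z. F z * K z / z) holomorphic_on V - {0}"
      unfolding K_def using V U(3) R0 by (intro holomorphic_intros) (auto intro: holomorphic_on_subset)
    then show "continuous_on (path_image B) (\<lambda>z. F z * K z / z)"
      using B(4) by (auto intro!: holomorphic_on_imp_continuous_on intro: holomorphic_on_subset)
  qed
  then obtain M where M: "M > 0" "\<And>z. z \<in> path_image B \<Longrightarrow> norm (F z * K z / z) \<le> M"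
    unfolding bounded_pos[of "_ ` _"] using compact_imp_bounded by (metis (no_types, lifting) bounded_pos imageI)
  have f_le: "norm (f N z) \<le> M * real N powr Re z" if "z \<in> path_image B" "N > 0" for N z
  proof -
    have "f N z = (F z * K z / z) * E N z" by (simp add: f_def)
    then show ?thesis using M(2)[OF that(1)] that by (simp add: norm_mult normE mult_right_mono del: times_divide_eq_left)
  qed
  have B_split: "path_image B = closed_segment P Q \<union> closed_segment Q Q' \<union> closed_segment Q' P'"
    by (auto simp: B_def path_image_join)
  have bound_B: "norm (contour_integral B (f N)) \<le> M * d / (d * ln N) + M * real N powr (-d) * (2 * R) + M * d / (d * ln N)"
    if N: "N > 1" for N
  proof -
    have int: "f N contour_integrable_on linepath P Q" "f N contour_integrable_on linepath Q Q'"
      "f N contour_integrable_on linepath Q' P'" "f N contour_integrable_on linepath P' Q'"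
      using segV by (auto intro!: f_int simp: closed_segment_commute)
    have "contour_integral B (f N) = contour_integral (linepath P Q) (f N) + (contour_integral (linepath Q Q') (f N)
        + contour_integral (linepath Q' P') (f N))"
      using int unfolding B_def by (simp add: contour_integral_join valid_path_join contour_integrable_join)
    then have 0: "norm (contour_integral B (f N)) \<le> norm (contour_integral (linepath P Q) (f N)) + (norm (contour_integral (linepath Q Q') (f N))
        + norm (contour_integral (linepath Q' P') (f N)))"
      by (simp only:) (intro norm_triangle_le add_left_mono norm_triangle_ineq)
    have "norm (contour_integral (linepath P Q) (f N)) \<le> M * norm (Q - P) / (d * ln N)"
    proof (rule norm_linepath_integral_exp_le)
      fix t :: real assume t: "t \<in> {0..1}"
      have "linepath P Q t \<in> closed_segment P Q" using t by (rule linepath_in_path)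
      then have "linepath P Q t \<in> path_image B" unfolding B_split by blast
      then have "norm (f N (linepath P Q t)) \<le> M * real N powr Re (linepath P Q t)" using N by (intro f_le) auto
      also have "Re (linepath P Q t) = - (d * t)" by (simp add: linepath_def P_def Q_def)
      finally show "norm (f N (linepath P Q t)) \<le> M * exp (- (d * ln N) * t)"
        using N by (simp add: powr_def mult_ac)
    qed (use int M d N in auto)
    moreover have "norm (Q - P) = d" using d by (simp add: P_def Q_def)
    moreover have "norm (contour_integral (linepath P' Q') (f N)) \<le> M * norm (Q' - P') / (d * ln N)"
    proof (rule norm_linepath_integral_exp_le)
      fix t :: real assume t: "t \<in> {0..1}"
      have "linepath P' Q' t \<in> closed_segment P' Q'" using t by (rule linepath_in_path)
      then have "linepath P' Q' t \<in> path_image B" unfolding B_split by (metis UnCI closed_segment_commute)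
      then have "norm (f N (linepath P' Q' t)) \<le> M * real N powr Re (linepath P' Q' t)" using N by (intro f_le) auto
      also have "Re (linepath P' Q' t) = - (d * t)" by (simp add: linepath_def P'_def Q'_def)
      finally show "norm (f N (linepath P' Q' t)) \<le> M * exp (- (d * ln N) * t)"
        using N by (simp add: powr_def mult_ac)
    qed (use int M d N in auto)
    moreover have "norm (Q' - P') = d" using d by (simp add: P'_def Q'_def)
    moreover have "contour_integral (linepath Q' P') (f N) = - contour_integral (linepath P' Q') (f N)"
      using contour_integral_reversepath[of "linepath P' Q'" "f N"] by simp
    moreover have "norm (contour_integral (linepath Q Q') (f N)) \<le> (M * real N powr (-d)) * norm (Q' - Q)"
    proof (rule contour_integral_bound_linepath)
      fix z assume z: "z \<in> closed_segment Q Q'"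
      then have "Re z = -d" using seg2 by auto
      then show "norm (f N z) \<le> M * real N powr (-d)" using f_le[of z N] z N unfolding B_split by auto
    qed (use int M in auto)
    moreover have "norm (Q' - Q) = 2 * R"
    proof -
      have "Q' - Q = - (of_real (2 * R) * \<i>)" by (simp add: Q_def Q'_def)
      then show ?thesis using R0 by (simp only: norm_minus_cancel norm_mult norm_of_real) simp
    qed
    ultimately show ?thesis using 0 by simp
  qed
  have lim: "(\<lambda>N. M * d / (d * ln (real N)) + M * real N powr (-d) * (2 * R) + M * d / (d * ln (real N))) \<longlonglongrightarrow> 0"
    using d by real_asymp
  have "\<forall>\<^sub>F N in sequentially. M * d / (d * ln (real N)) + M * real N powr (-d) * (2 * R) + M * d / (d * ln (real N)) < pi / R"
    using order_tendstoD(2)[OF lim, of "pi / R"] R0 by simp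
  moreover have "\<forall>\<^sub>F N in sequentially. N > 1" by (rule eventually_gt_at_top)
  moreover have "\<forall>\<^sub>F N in sequentially. real N \<ge> R" by real_asymp
  ultimately show ?thesis
  proof eventually_elim
    case (elim N)
    have S0: "S N 0 = (\<Sum>n=1..N. a n / of_nat n)"
      unfolding S_def by (intro sum.cong) (auto simp: powr_minus_divide)
    have "contour_integral A (\<lambda>z. f N z - h N z) = contour_integral A (f N) - contour_integral A (h N)"
      using AV A by (intro contour_integral_diff f_int h_int) auto
    then have "2 * pi * \<i> * (F 0 - S N 0)
        = contour_integral A (\<lambda>z. f N z - h N z) + contour_integral B (f N) - contour_integral A' (h N)"
      unfolding right_diff_distrib F_formula[of N, symmetric] S_formula[of N, symmetric] by simp
    moreover have "norm (contour_integral A (\<lambda>z. f N z - h N z) + contour_integral B (f N) - contour_integral A' (h N))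
      \<le> 2 * pi / R + pi / R + 4 * pi / R"
      using bound_A[of N] bound_A'[of N] bound_B[of N] elim
      by (intro norm_triangle_le_diff norm_triangle_le add_mono) auto
    ultimately have "norm (2 * pi * \<i> * (F 0 - S N 0)) \<le> 2 * pi / R + pi / R + 4 * pi / R" by simp
    then have "2 * pi * norm (F 0 - S N 0) \<le> 2 * pi / R + pi / R + 4 * pi / R"
      by (simp add: norm_mult)
    also have "\<dots> \<le> 2 * pi * (4 / R)" using R0 by (simp add: field_simps)
    finally have "norm (F 0 - S N 0) \<le> 4 / R" by (rule mult_left_le_imp_le) simp
    then show ?case by (simp only: S0)
  qed
qed

theorem newman_tauberian:
  fixes a :: "nat \<Rightarrow> complex" and F :: "complex \<Rightarrow> complex"
  assumes a: "\<And>n. norm (a n) \<le> 1"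
    and U: "open U" "{z. Re z \<ge> 0} \<subseteq> U" "F holomorphic_on U"
    and sums: "\<And>s. Re s > 0 \<Longrightarrow> (\<lambda>n. a n * of_nat n powr (-1 - s)) sums F s"
  shows "(\<lambda>N. \<Sum>n=1..N. a n / of_nat n) \<longlonglongrightarrow> F 0"
proof (rule LIMSEQ_I)
  fix r :: real assume r: "r > 0"
  \<comment> \<open>Any R with 4 / R < r works.\<close>
  define R where "R = max 1 (8 / r)"
  have R: "R \<ge> 1" "4 / R < r" using r by (auto simp: R_def max_def field_simps)
  have "\<forall>\<^sub>F N in sequentially. norm (F 0 - (\<Sum>n=1..N. a n / of_nat n)) \<le> 4 / R"
    by (rule newman_estimate[OF assms R(1)])
  then have "\<forall>\<^sub>F N in sequentially. norm ((\<Sum>n=1..N. a n / of_nat n) - F 0) < r"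
    by eventually_elim (use R in \<open>simp add: norm_minus_commute\<close>)
  then show "\<exists>N0. \<forall>N\<ge>N0. norm ((\<Sum>n=1..N. a n / of_nat n) - F 0) < r"
    by (simp add: eventually_sequentially)
qed

section \<open>Sums of order o(N)\<close>

text \<open>This is s(N) = o(N) in a form without limits. It is convenient because it passes at once through
finite sums and through the substitution of N div d for N.\<close>

definition sublinear :: "(nat \<Rightarrow> complex) \<Rightarrow> bool"
  where "sublinear s \<longleftrightarrow> (\<forall>e>0. \<exists>C. \<forall>N. norm (s N) \<le> C + e * real N)"

lemma sublinearI: "(\<And>e. e > 0 \<Longrightarrow> \<exists>C. \<forall>N. norm (s N) \<le> C + e * real N) \<Longrightarrow> sublinear s"
  by (simp add: sublinear_def)

lemma tendsto_imp_sublinear: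
  assumes "(\<lambda>N. s N / of_nat N) \<longlonglongrightarrow> 0"
  shows "sublinear s"
proof (rule sublinearI)
  fix e :: real assume e: "e > 0"
  obtain N0 where N0: "\<And>N. N \<ge> N0 \<Longrightarrow> norm (s N / of_nat N) < e"
    using LIMSEQ_D[OF assms e] by auto
  have "norm (s N) \<le> (\<Sum>n\<le>N0. norm (s n)) + e * real N" for N
  proof (cases "N \<le> N0")
    case True
    then have "norm (s N) \<le> (\<Sum>n\<le>N0. norm (s n))" by (intro member_le_sum) auto
    then show ?thesis using e by (simp add: add_increasing2)
  next
    case False
    then have "norm (s N) \<le> e * real N" using N0[of N] by (simp add: norm_divide field_simps)
    then show ?thesis by (smt (verit) norm_ge_zero sum_nonneg)
  qed
  then show "\<exists>C. \<forall>N. norm (s N) \<le> C + e * real N" by blast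
qed

lemma sublinear_imp_tendsto:
  assumes "sublinear s"
  shows "(\<lambda>N. s N / of_nat N) \<longlonglongrightarrow> 0"
proof (rule LIMSEQ_I)
  fix r :: real assume r: "r > 0"
  then obtain C where C: "\<And>N. norm (s N) \<le> C + r/2 * real N"
    using assms unfolding sublinear_def by (meson half_gt_zero)
  obtain N0 :: nat where N0: "real N0 > 2 * \<bar>C\<bar> / r" using reals_Archimedean2 by blast
  have "norm (s N / of_nat N - 0) < r" if "N \<ge> Suc N0" for N
  proof -
    have N: "real N > 0" "real N > 2 * \<bar>C\<bar> / r" using that N0 by linarith+
    then have "C < r / 2 * real N" using r by (simp add: field_simps)
    then have "norm (s N) < r * real N" using C[of N] by linarith
    then show ?thesis using N by (simp add: norm_divide field_simps)
  qed
  then show "\<exists>N0. \<forall>N\<ge>N0. norm (s N / of_nat N - 0) < r" by blast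
qed

lemma sublinear_bounded:
  assumes "\<And>N. norm (s N) \<le> C"
  shows "sublinear s"
  using assms by (intro sublinearI exI[of _ C]) (smt (verit) mult_nonneg_nonneg of_nat_0_le_iff)

lemma sublinear_add:
  assumes "sublinear s" "sublinear t"
  shows "sublinear (\<lambda>N. s N + t N)"
proof (rule sublinearI)
  fix e :: real assume "e > 0"
  then obtain C D where "\<And>N. norm (s N) \<le> C + e/2 * real N" "\<And>N. norm (t N) \<le> D + e/2 * real N"
    using assms unfolding sublinear_def by (meson half_gt_zero)
  then have "norm (s N + t N) \<le> (C + D) + e * real N" for N
    by (rule order.trans[OF norm_triangle_mono]) (simp add: field_simps)
  then show "\<exists>C. \<forall>N. norm (s N + t N) \<le> C + e * real N" by blast
qed

lemma sublinear_cmult: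
  assumes "sublinear s"
  shows "sublinear (\<lambda>N. c * s N)"
proof (cases "c = 0")
  case False
  show ?thesis
  proof (rule sublinearI)
    fix e :: real assume "e > 0"
    then obtain C where C: "\<And>N. norm (s N) \<le> C + e / norm c * real N"
      using assms False unfolding sublinear_def by (metis divide_pos_pos zero_less_norm_iff)
    have "norm (c * s N) \<le> norm c * C + e * real N" for N
    proof -
      have "norm c * norm (s N) \<le> norm c * (C + e / norm c * real N)" by (intro mult_left_mono C) auto
      also have "\<dots> = norm c * C + e * real N" using False by (simp add: distrib_left)
      finally show ?thesis by (simp add: norm_mult)
    qed
    then show "\<exists>C. \<forall>N. norm (c * s N) \<le> C + e * real N" by blast
  qed
qed (auto intro: sublinear_bounded[of _ 0])

lemma sublinear_sum:
  "(\<And>i. i \<in> A \<Longrightarrow> sublinear (s i)) \<Longrightarrow> sublinear (\<lambda>N. \<Sum>i\<in>A. s i N)"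
  by (induction A rule: infinite_finite_induct)
     (auto intro: sublinear_bounded[of _ 0] sublinear_add)

lemma sublinear_div:
  assumes "sublinear s"
  shows "sublinear (\<lambda>N. s (N div d))"
proof (rule sublinearI)
  fix e :: real assume e: "e > 0"
  then obtain C where C: "\<And>N. norm (s N) \<le> C + e * real N" using assms unfolding sublinear_def by blast
  have "norm (s (N div d)) \<le> C + e * real N" for N
  proof -
    have "e * real (N div d) \<le> e * real N" using e by (intro mult_left_mono) auto
    then show ?thesis using C[of "N div d"] by linarith
  qed
  then show "\<exists>C. \<forall>N. norm (s (N div d)) \<le> C + e * real N" by blast
qed

text \<open>The arithmetic means of a null sequence tend to 0.\<close>

lemma cesaro_sublinear:
  assumes "X \<longlonglongrightarrow> 0"
  shows "sublinear (\<lambda>N. \<Sum>n<N. X n)"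
proof (rule sublinearI)
  fix e :: real assume e: "e > 0"
  obtain N0 where N0: "\<And>n. n \<ge> N0 \<Longrightarrow> norm (X n) < e"
    using LIMSEQ_D[OF assms e] by auto
  have "norm (\<Sum>n<N. X n) \<le> (\<Sum>n<N0. norm (X n)) + e * real N" for N
  proof -
    have "norm (\<Sum>n<N. X n) \<le> (\<Sum>n<N. (if n < N0 then norm (X n) else 0) + e)"
      using N0 e by (intro sum_norm_le) (auto simp: less_imp_le not_less)
    also have "\<dots> = (\<Sum>n\<in>{..<N} \<inter> {..<N0}. norm (X n)) + e * real N"
      by (simp add: sum.distrib sum.If_cases Int_def lessThan_def mult.commute)
    also have "(\<Sum>n\<in>{..<N} \<inter> {..<N0}. norm (X n)) \<le> (\<Sum>n<N0. norm (X n))"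
      by (intro sum_mono2) auto
    finally show ?thesis by simp
  qed
  then show "\<exists>C. \<forall>N. norm (\<Sum>n<N. X n) \<le> C + e * real N" by blast
qed

text \<open>Kronecker's lemma: with S(N) the partial sums of a(n)/n minus their limit, summation by parts gives
\<Sum> a(n) = N S(N) - \<Sum> S(n), and both terms are o(N).\<close>

lemma sublinear_if_convergent_harmonic_sum:
  fixes a :: "nat \<Rightarrow> complex"
  assumes "(\<lambda>N. \<Sum>n=1..N. a n / of_nat n) \<longlonglongrightarrow> L"
  shows "sublinear (\<lambda>N. \<Sum>n=1..N. a n)"
proof -
  define S where "S = (\<lambda>N. (\<Sum>n=1..N. a n / of_nat n) - L)"
  have S: "S \<longlonglongrightarrow> 0" using assms unfolding S_def by (simp add: LIM_zero)
  have *: "(\<Sum>n=1..N. a n) = of_nat N * S N + -1 * (\<Sum>n<N. S n)" for N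
  proof (induction N)
    case (Suc N)
    have "of_nat (Suc N) * S (Suc N) = of_nat (Suc N) * S N + a (Suc N)"
      by (simp add: S_def distrib_left right_diff_distrib del: of_nat_Suc)
    then show ?case using Suc by (simp add: algebra_simps)
  qed auto
  have "(\<lambda>N. of_nat N * S N / of_nat N) \<longlonglongrightarrow> 0"
    by (rule Lim_transform_eventually[OF S eventually_mono[OF eventually_gt_at_top[of 0]]]) auto
  then have "sublinear (\<lambda>N. of_nat N * S N + -1 * (\<Sum>n<N. S n))"
    by (intro sublinear_add sublinear_cmult cesaro_sublinear S tendsto_imp_sublinear)
  then show ?thesis by (simp only: *)
qed

section \<open>The Moebius function and divisor sums\<close>

lemma moebius_mu_1: "moebius_mu (Suc 0) = 1"
  by (simp add: moebius_mu_def)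

lemma moebius_mu_0: "moebius_mu 0 = 0"
  by (simp add: moebius_mu_def)

lemma abs_moebius_mu_le: "\<bar>moebius_mu n\<bar> \<le> 1"
  by (simp add: moebius_mu_def)

lemma norm_moebius_mu_le: "norm (of_int (moebius_mu n) :: complex) \<le> 1"
proof -
  have "real_of_int \<bar>moebius_mu n\<bar> \<le> 1" using abs_moebius_mu_le[of n] by linarith
  then show ?thesis by simp
qed

lemma moebius_mu_mult:
  "moebius_mu (a * b) = (if coprime a b then moebius_mu a * moebius_mu b else 0)"
proof (cases "coprime a b")
  case True
  show ?thesis
  proof (cases "a = 0 \<or> b = 0")
    case False
    have "prime_factors a \<inter> prime_factors b = {}"
      using True by (auto simp: in_prime_factors_iff) (metis coprime_common_divisor not_prime_unit)
    then have "card (prime_factors (a * b)) = card (prime_factors a) + card (prime_factors b)"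
      using False by (simp add: prime_factors_product card_Un_disjoint)
    then show ?thesis using True squarefree_mult_coprime[OF True]
      by (auto simp: moebius_mu_def power_add dest: squarefree_multD)
  qed (auto simp: moebius_mu_0)
next
  case False
  then have "gcd a b \<noteq> 1" using coprime_iff_gcd_eq_1 by blast
  moreover have "gcd a b ^ 2 dvd a * b" by (simp add: power2_eq_square mult_dvd_mono)
  ultimately have "\<not> squarefree (a * b)" by (intro not_squarefreeI) auto
  then show ?thesis using False by (simp add: moebius_mu_def)
qed

text \<open>A divisor of p^k m with p not dividing m is uniquely p^j e with j \<le> k and e dividing m. Divisor sums
of arithmetic functions can thus be evaluated one prime at a time.\<close>

lemma sum_divisors_prime_power_mult:
  fixes f :: "nat \<Rightarrow> 'a::comm_monoid_add"
  assumes p: "prime p" "\<not> p dvd m" "m > 0"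
  shows "(\<Sum>d | d dvd p ^ k * m. f d) = (\<Sum>j\<le>k. \<Sum>e | e dvd m. f (p ^ j * e))"
proof -
  have mult: "multiplicity p (p ^ j * e) = j" if "e dvd m" for j e
  proof -
    have "\<not> p dvd e" "e \<noteq> 0" using that p by (auto dest: dvd_trans)
    then show ?thesis using p by (simp add: prime_elem_multiplicity_mult_distrib not_dvd_imp_multiplicity_0)
  qed
  have "bij_betw (\<lambda>(j,e). p ^ j * e) ({..k} \<times> {e. e dvd m}) {d. d dvd p ^ k * m}"
  proof (rule bij_betw_imageI)
    show "inj_on (\<lambda>(j,e). p ^ j * e) ({..k} \<times> {e. e dvd m})"
    proof (rule inj_onI, clarify)
      fix i d j e assume *: "d dvd m" "e dvd m" "p ^ i * d = p ^ j * e"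
      then have "i = j" using mult by metis
      then show "i = j \<and> d = e" using *(3) p by (auto simp: prime_gt_0_nat)
    qed
    show "(\<lambda>(j,e). p ^ j * e) ` ({..k} \<times> {e. e dvd m}) = {d. d dvd p ^ k * m}"
    proof (intro equalityI subsetI)
      fix d assume "d \<in> {d. d dvd p ^ k * m}"
      then obtain b c where "d = b * c" "b dvd p ^ k" "c dvd m" using division_decomp by blast
      then show "d \<in> (\<lambda>(j,e). p ^ j * e) ` ({..k} \<times> {e. e dvd m})"
        using divides_primepow_nat[OF p(1)] by auto
    qed (auto intro: mult_dvd_mono le_imp_power_dvd)
  qed
  from sum.reindex_bij_betw[OF this, of f]
  have "(\<Sum>d | d dvd p ^ k * m. f d) = (\<Sum>(j,e)\<in>{..k} \<times> {e. e dvd m}. f (p ^ j * e))"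
    by (simp add: case_prod_unfold)
  then show ?thesis by (simp add: sum.cartesian_product)
qed

lemma sum_moebius_mu_divisors:
  assumes "n > 0"
  shows "(\<Sum>d | d dvd n. moebius_mu d) = (if n = 1 then 1 else 0)"
proof (cases "n = 1")
  case True
  have "{d. d dvd Suc 0} = {1}" by auto
  with True show ?thesis by (simp add: moebius_mu_1)
next
  case False
  then obtain p where p: "prime p" "p dvd n" using prime_factor_nat by blast
  define k where "k = multiplicity p n"
  obtain m where m: "n = p ^ k * m" "\<not> p dvd m"
    unfolding k_def using multiplicity_decompose'[of n p] assms p by (metis not_prime_unit less_not_refl)
  have "k > 0" using p m by (cases k) auto
  have "m > 0" using m assms by (cases m) auto
  have term0: "(\<Sum>e | e dvd m. moebius_mu (p ^ j * e)) = (if j = 0 then 1 else if j = 1 then -1 else 0) * (\<Sum>e | e dvd m. moebius_mu e)" for j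
    unfolding sum_distrib_left
  proof (rule sum.cong[OF refl])
    fix e assume "e \<in> {e. e dvd m}"
    then have pe: "\<not> p dvd e" using m(2) dvd_trans by blast
    then have "coprime p e" using p by (simp add: prime_imp_coprime)
    then have cop: "coprime (p ^ j) e" by simp
    have "moebius_mu (p ^ j) = (if j = 0 then 1 else if j = 1 then -1 else 0)"
      using p by (auto simp: moebius_mu_def squarefree_power_iff squarefree_prime prime_prime_factors)
    then show "moebius_mu (p ^ j * e) = (if j = 0 then 1 else if j = 1 then -1 else 0) * moebius_mu e"
      by (simp only: moebius_mu_mult[of "p ^ j"] cop if_True)
  qed
  have "(\<Sum>d | d dvd n. moebius_mu d)
    = (\<Sum>j\<le>k. (if j = 0 then 1 else if j = 1 then -1 else 0) * (\<Sum>e | e dvd m. moebius_mu e))"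
    unfolding m(1) by (subst sum_divisors_prime_power_mult[OF p(1) m(2) \<open>m > 0\<close>]) (simp only: term0)
  also have "\<dots> = (\<Sum>j\<in>{0,1::nat}. (if j = 0 then 1 else if j = 1 then -1 else 0) * (\<Sum>e | e dvd m. moebius_mu e))"
    by (rule sum.mono_neutral_right) (use \<open>k > 0\<close> in auto)
  finally show ?thesis using False by simp
qed

text \<open>Rearranges an absolutely convergent double sum over all pairs (d, m) according to the product k = dm.
Products of Dirichlet series and Lambert series are both instances.\<close>

lemma has_sum_divisors:
  fixes F :: "nat \<Rightarrow> nat \<Rightarrow> complex"
  assumes "((\<lambda>(d,m). F d m) has_sum S) ({1..} \<times> {1..})"
  shows "((\<lambda>k. \<Sum>d | d dvd k. F d (k div d)) has_sum S) {1..}"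
proof (rule has_sum_SigmaD[where B = "\<lambda>k. {d. d dvd k}"])
  show "((\<lambda>(k,d). F d (k div d)) has_sum S) (SIGMA k:{1..}. {d. d dvd k})"
  proof -
    have "bij_betw (\<lambda>(k,d). (d, k div d)) (SIGMA k:{1::nat..}. {d. d dvd k}) ({1..} \<times> {1..})"
      by (rule bij_betw_byWitness[where f' = "\<lambda>(d,m). (d * m, d)"]) (auto simp: Suc_le_eq dvd_div_eq_0_iff intro!: Nat.gr0I)
    from has_sum_reindex_bij_betw[OF this, of "\<lambda>(d,m). F d m" S] assms
    show ?thesis by (simp add: case_prod_unfold)
  qed
  show "((\<lambda>y. case (x, y) of (k, d) \<Rightarrow> F d (k div d)) has_sum (\<Sum>d | d dvd x. F d (x div d))) {d. d dvd x}"
    if "x \<in> {1..}" for x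
    using that by (auto intro!: has_sum_finiteI)
qed

lemma has_sum_divisors_prod:
  fixes f g :: "nat \<Rightarrow> complex"
  assumes "(\<lambda>n. norm (f n)) summable_on {1..}" "(\<lambda>n. norm (g n)) summable_on {1..}"
  shows "((\<lambda>k. \<Sum>d | d dvd k. f d * g (k div d)) has_sum (infsum f {1..} * infsum g {1..})) {1..}"
proof (rule has_sum_divisors)
  have "(\<lambda>x. norm (case x of (d,m) \<Rightarrow> f d * g m)) summable_on {1..} \<times> {1..}"
  proof (rule Infinite_Sum.abs_summable_on_Sigma_iff[THEN iffD2], intro conjI ballI)
    show "(\<lambda>m. norm (case (d, m) of (d, m) \<Rightarrow> f d * g m)) summable_on {1..}" for d
      using summable_on_cmult_right[OF assms(2), of "norm (f d)"] by (simp add: norm_mult)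
    show "(\<lambda>d. norm (\<Sum>\<^sub>\<infinity>m\<in>{1..}. norm (case (d, m) of (d, m) \<Rightarrow> f d * g m))) summable_on {1..}"
    proof -
      have "(\<Sum>\<^sub>\<infinity>m\<in>{1..}. norm (case (d, m) of (d, m) \<Rightarrow> f d * g m)) = norm (f d) * (\<Sum>\<^sub>\<infinity>m\<in>{1..}. norm (g m))" for d
        by (simp only: prod.case norm_mult infsum_cmult_right')
      then show ?thesis
        using summable_on_cmult_left[OF assms(1), of "norm (\<Sum>\<^sub>\<infinity>m\<in>{1..}. norm (g m))"]
        by (simp only: norm_mult real_norm_def abs_mult abs_norm_cancel)
    qed
  qed
  then obtain T where T: "((\<lambda>(d,m). f d * g m) has_sum T) ({1..} \<times> {1..})"
    using abs_summable_summable summable_on_def by blast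
  have "((\<lambda>d. f d * infsum g {1..}) has_sum T) {1..}"
    by (rule has_sum_SigmaD[OF T])
       (use assms(2) abs_summable_summable in \<open>auto intro!: has_sum_cmult_right has_sum_infsum\<close>)
  moreover have "((\<lambda>d. f d * infsum g {1..}) has_sum infsum f {1..} * infsum g {1..}) {1..}"
    using assms(1) abs_summable_summable by (auto intro!: has_sum_cmult_left has_sum_infsum)
  ultimately show "((\<lambda>(d,m). f d * g m) has_sum infsum f {1..} * infsum g {1..}) ({1..} \<times> {1..})"
    using T has_sum_unique by blast
qed

section \<open>Dirichlet series\<close>

text \<open>The terms of the Dirichlet series of a at s. The summation index starts at 0, which is harmless:
0 powr (-s) = 0, so that the term with index 0 vanishes.\<close>

definition dirichlet_term :: "(nat \<Rightarrow> complex) \<Rightarrow> complex \<Rightarrow> nat \<Rightarrow> complex"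
  where "dirichlet_term a s n = a n * of_nat n powr (-s)"

lemma dirichlet_term_0 [simp]: "dirichlet_term a s 0 = 0"
  by (simp add: dirichlet_term_def)

lemma dirichlet_term_mult:
  "d dvd k \<Longrightarrow> dirichlet_term a s d * dirichlet_term b s (k div d) = a d * b (k div d) * of_nat k powr (-s)"
proof (elim dvdE)
  fix m assume "k = d * m"
  then show ?thesis
    by (cases "d = 0") (auto simp: dirichlet_term_def powr_times_real[symmetric])
qed

lemma has_sum_atLeast1_iff:
  fixes f :: "nat \<Rightarrow> complex"
  assumes "f 0 = 0"
  shows "(f has_sum S) {1..} \<longleftrightarrow> (f has_sum S) UNIV"
  by (rule has_sum_cong_neutral) (use assms in \<open>auto simp: not_le Suc_le_eq\<close>)

text \<open>The logarithm in the hypothesis accommodates the von Mangoldt function; it is absorbed by a small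
power of n.\<close>

lemma summable_norm_dirichlet:
  assumes "\<And>n. norm (a n) \<le> C * (1 + ln (real n))" "Re s > 1"
  shows "summable (\<lambda>n. norm (dirichlet_term a s n))"
proof -
  define e where "e = (Re s - 1) / 2"
  have e: "e > 0" using assms by (simp add: e_def)
  have "\<forall>\<^sub>F n in sequentially. 1 + ln (real n) \<le> real n powr e"
    using e by real_asymp
  then have ev: "\<forall>\<^sub>F n in sequentially. norm (norm (dirichlet_term a s n)) \<le> \<bar>C\<bar> * real n powr - (1 + e)"
    using eventually_gt_at_top[of 1]
  proof eventually_elim
    case (elim n)
    have "norm (dirichlet_term a s n) = norm (a n) * real n powr - Re s"
      by (simp add: dirichlet_term_def norm_mult norm_of_nat_powr)
    also have "norm (a n) \<le> \<bar>C\<bar> * (1 + ln (real n))"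
      using assms(1)[of n] elim by (smt (verit) mult_right_mono ln_ge_zero of_nat_less_iff of_nat_1)
    also have "\<dots> \<le> \<bar>C\<bar> * real n powr e" using elim by (intro mult_left_mono) auto
    also have "\<bar>C\<bar> * real n powr e * real n powr - Re s = \<bar>C\<bar> * real n powr - (1 + e)"
    proof -
      have "e + - Re s = - (1 + e)" by (simp add: e_def field_simps)
      then show ?thesis by (simp only: mult.assoc powr_add[symmetric])
    qed
    finally show ?case by (simp add: mult_right_mono)
  qed
  have "summable (\<lambda>n. \<bar>C\<bar> * real n powr - (1 + e))"
    using e by (intro summable_mult) (simp add: summable_real_powr_iff)
  then show ?thesis by (rule summable_comparison_test_ev[OF ev])
qed

lemma dirichlet_product:
  assumes "summable (\<lambda>n. norm (dirichlet_term a s n))" "summable (\<lambda>n. norm (dirichlet_term b s n))"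
    and "dirichlet_term a s sums A" "dirichlet_term b s sums B"
    and c: "\<And>n. n > 0 \<Longrightarrow> c n = (\<Sum>d | d dvd n. a d * b (n div d))"
  shows "dirichlet_term c s sums (A * B)"
proof -
  have *: "(\<lambda>n. norm (f n)) summable_on {1..}" "infsum f {1..} = S"
    if "summable (\<lambda>n. norm (f n))" "f sums S" "f 0 = 0" for f :: "nat \<Rightarrow> complex" and S
  proof -
    have "(f has_sum S) UNIV" using that(1,2) by (rule norm_summable_imp_has_sum)
    then show "infsum f {1..} = S" using that has_sum_atLeast1_iff infsumI by blast
    have "(\<lambda>n. norm (f n)) summable_on UNIV" using that(1) by (simp add: norm_summable_imp_summable_on)
    then show "(\<lambda>n. norm (f n)) summable_on {1..}" by (rule summable_on_subset_banach) auto
  qed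
  have "((\<lambda>k. \<Sum>d | d dvd k. dirichlet_term a s d * dirichlet_term b s (k div d)) has_sum (A * B)) {1..}"
    using has_sum_divisors_prod[of "dirichlet_term a s" "dirichlet_term b s"] *[OF assms(1,3)] *[OF assms(2,4)] by simp
  also have "?this \<longleftrightarrow> (dirichlet_term c s has_sum (A * B)) {1..}"
  proof (rule has_sum_cong)
    fix k :: nat assume "k \<in> {1..}"
    then show "(\<Sum>d | d dvd k. dirichlet_term a s d * dirichlet_term b s (k div d)) = dirichlet_term c s k"
      by (simp add: c dirichlet_term_mult sum_distrib_right dirichlet_term_def[of c])
  qed
  finally show ?thesis using has_sum_atLeast1_iff[of "dirichlet_term c s"] has_sum_imp_sums dirichlet_term_0 by blast
qed

lemma has_field_derivative_dirichlet:
  "((\<lambda>s. dirichlet_term a s n) has_field_derivative dirichlet_term (\<lambda>n. - of_real (ln (real n)) * a n) s n) (at s)"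
proof (cases "n = 0")
  case False
  then have eq: "dirichlet_term b s n = b n * exp (- s * of_real (ln (real n)))" for b s
    by (simp add: dirichlet_term_def powr_def Ln_of_nat)
  show ?thesis unfolding eq
    by (auto intro!: derivative_eq_intros)
qed simp

lemma norm_dirichlet_le:
  assumes "norm (a n) \<le> C" "x \<le> Re s"
  shows "norm (dirichlet_term a s n) \<le> C * real n powr -x"
proof (cases "n = 0")
  case False
  then show ?thesis unfolding dirichlet_term_def norm_mult norm_of_nat_powr
    using assms by (intro mult_mono powr_mono) (auto intro: order.trans[OF norm_ge_zero])
qed simp

text \<open>Termwise differentiation in the half-plane of absolute convergence.\<close>

lemma dirichlet_derivative:
  assumes a: "\<And>n. norm (a n) \<le> C"
  obtains A A' where "\<And>s. Re s > 1 \<Longrightarrow> dirichlet_term a s sums A s"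
    "\<And>s. Re s > 1 \<Longrightarrow> dirichlet_term (\<lambda>n. - of_real (ln (real n)) * a n) s sums A' s"
    "\<And>s. Re s > 1 \<Longrightarrow> (A has_field_derivative A' s) (at s)"
proof -
  have "\<exists>g g'. \<forall>s\<in>{s. Re s > 1}. ((\<lambda>n. dirichlet_term a s n) sums g s) \<and>
      ((\<lambda>n. dirichlet_term (\<lambda>n. - of_real (ln (real n)) * a n) s n) sums g' s) \<and> (g has_field_derivative g' s) (at s)"
  proof (rule series_and_derivative_comparison_complex)
    fix x assume x: "x \<in> {s. Re s > 1}"
    \<comment> \<open>On the ball of radius d around x the real part exceeds 1 + d.\<close>
    define d where "d = (Re x - 1) / 2"
    have d: "d > 0" using x by (simp add: d_def)
    define h where "h = (\<lambda>n. complex_of_real (C * real n powr - (1 + d)))"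
    have "summable h"
      unfolding h_def summable_complex_of_real using d by (intro summable_mult) (simp add: summable_real_powr_iff)
    moreover have C: "C \<ge> 0" using a[of 0] norm_ge_zero order.trans by blast
    then have h: "norm (h n) = C * real n powr - (1 + d)" "h n \<in> \<real>\<^sub>\<ge>\<^sub>0" for n
      unfolding h_def norm_of_real by auto
    moreover have "norm (dirichlet_term a y n) \<le> norm (h n)" if "y \<in> ball x d" for y n
      unfolding h(1)
    proof (rule norm_dirichlet_le[where x = "1 + d", OF a])
      have "\<bar>Re (x - y)\<bar> < d" using that abs_Re_le_cmod[of "x - y"] by (simp add: dist_norm)
      then show "1 + d \<le> Re y" unfolding d_def by (simp add: abs_if field_simps split: if_splits)
    qed
    moreover have "range h \<subseteq> \<real>\<^sub>\<ge>\<^sub>0" using h(2) by auto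
    ultimately show "\<exists>d h. 0 < d \<and> summable h \<and> range h \<subseteq> \<real>\<^sub>\<ge>\<^sub>0 \<and>
          (\<forall>\<^sub>F n in sequentially. \<forall>y\<in>ball x d \<inter> {s. 1 < Re s}. cmod (dirichlet_term a y n) \<le> cmod (h n))"
      using d by (intro exI[of _ d] exI[of _ h] conjI always_eventually) auto
  qed (intro has_field_derivative_dirichlet open_halfspace_Re_gt)+
  then show ?thesis using that by auto
qed

section \<open>Analytic continuation to the right half-plane\<close>

text \<open>The difference is of order n^(-Re s - 1), one power better than its terms. This is what makes the
series obtained by partial summation converge absolutely for all Re s > 0.\<close>

lemma norm_powr_diff_le:
  assumes "n > 0" "real n \<le> x" "x \<le> real n + 1" "Re s > 0"
  shows "norm (of_real x powr (-s) - of_nat n powr (-s)) \<le> norm s * real n powr (- Re s - 1)"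
proof -
  let ?S = "closed_segment (of_real (real n)) (of_real x) :: complex set"
  have S: "\<exists>t. z = of_real t \<and> real n \<le> t" if "z \<in> ?S" for z
    using that assms unfolding closed_segment_of_real by (auto simp: closed_segment_eq_real_ivl)
  have "norm (of_real x powr (-s) - of_real (real n) powr (-s)) \<le> (norm s * real n powr (- Re s - 1)) * norm (of_real x - of_real (real n) :: complex)"
  proof (rule field_differentiable_bound[where S = ?S and f = "\<lambda>z. z powr (-s)"
        and f' = "\<lambda>z. - s * z powr (- s - 1)" and x = "of_real x" and y = "of_real (real n)"])
    fix z assume "z \<in> ?S"
    then obtain t where t: "z = of_real t" "real n \<le> t" using S by blast
    have t0: "t > 0" using t assms by linarith
    then show "((\<lambda>z. z powr (-s)) has_field_derivative - s * z powr (- s - 1)) (at z within ?S)"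
      using t by (intro has_field_derivative_powr[THEN has_field_derivative_at_within])
        (auto simp: complex_nonpos_Reals_iff)
    have "norm (z powr (- s - 1)) = t powr (- Re s - 1)"
      using t t0 by (simp add: norm_powr_real_powr)
    also have "\<dots> \<le> real n powr (- Re s - 1)" using t assms by (intro powr_mono2') auto
    finally show "norm (- s * z powr (- s - 1)) \<le> norm s * real n powr (- Re s - 1)"
      by (simp add: norm_mult mult_left_mono)
  qed auto
  also have "norm (of_real x - of_real (real n) :: complex) = x - real n"
    using assms by (simp only: of_real_diff[symmetric] norm_of_real)
  also have "norm s * real n powr (- Re s - 1) * (x - real n) \<le> norm s * real n powr (- Re s - 1) * 1"
    using assms by (intro mult_left_mono) auto
  finally show ?thesis by simp
qed

text \<open>The left-hand side is (s - 1) times the error made in replacing the integral of x^(-s) over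
[n, n + 1] by its integrand at n, so it is bounded through the preceding lemma.\<close>

lemma norm_zeta_term_le:
  assumes "n > 0" "Re s > 0"
  shows "norm ((s - 1) * of_nat n powr (-s) + of_nat (Suc n) powr (1 - s) - of_nat n powr (1 - s))
    \<le> norm (s - 1) * norm s * real n powr (- Re s - 1)"
proof -
  let ?S = "closed_segment (of_real (real n)) (of_real (real n + 1)) :: complex set"
  let ?f = "\<lambda>z. (s - 1) * of_nat n powr (-s) * z + z powr (1 - s)"
  have S: "\<exists>t. z = of_real t \<and> real n \<le> t \<and> t \<le> real n + 1" if "z \<in> ?S" for z
    using that assms unfolding closed_segment_of_real by (auto simp: closed_segment_eq_real_ivl)
  have "norm (?f (of_real (real n + 1)) - ?f (of_real (real n)))
     \<le> (norm (s - 1) * norm s * real n powr (- Re s - 1)) * norm (of_real (real n + 1) - of_real (real n) :: complex)"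
  proof (rule field_differentiable_bound[where S = ?S and f = ?f and x = "of_real (real n + 1)" and y = "of_real (real n)"
        and f' = "\<lambda>z. (s - 1) * of_nat n powr (-s) + (1 - s) * z powr (- s)"])
    fix z assume "z \<in> ?S"
    then obtain t where t: "z = of_real t" "real n \<le> t" "t \<le> real n + 1" using S by blast
    have t0: "t > 0" using t assms by linarith
    then have "((\<lambda>z. z powr (1 - s)) has_field_derivative (1 - s) * z powr (1 - s - 1)) (at z within ?S)"
      using t by (intro has_field_derivative_powr[THEN has_field_derivative_at_within])
        (auto simp: complex_nonpos_Reals_iff)
    then show "(?f has_field_derivative (s - 1) * of_nat n powr (-s) + (1 - s) * z powr (- s)) (at z within ?S)"
      using DERIV_add[OF DERIV_cmult_Id] by fastforce
    have "(s - 1) * of_nat n powr (-s) + (1 - s) * z powr (- s) = - (s - 1) * (of_real t powr (-s) - of_nat n powr (-s))"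
      using t by (simp add: algebra_simps)
    also have "norm \<dots> \<le> norm (s - 1) * (norm s * real n powr (- Re s - 1))"
      unfolding norm_mult norm_minus_cancel using t assms by (intro mult_left_mono norm_powr_diff_le) auto
    finally show "norm ((s - 1) * of_nat n powr (-s) + (1 - s) * z powr (- s)) \<le> norm (s - 1) * norm s * real n powr (- Re s - 1)"
      by (simp only: mult.assoc)
  qed auto
  also have "?f (of_real (real n + 1)) - ?f (of_real (real n))
      = (s - 1) * of_nat n powr (-s) + of_nat (Suc n) powr (1 - s) - of_nat n powr (1 - s)"
    by (simp add: algebra_simps)
  finally show ?thesis by simp
qed

text \<open>Partial summation: if T denotes the bounded partial sums of w, then \<Sum> w(n) n^(-s) equals
\<Sum> T(n) (n^(-s) - (n+1)^(-s)), which converges locally uniformly for Re s > 0. In particular the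
Dirichlet series itself converges there, also at s = 1.\<close>

lemma dirichlet_abel:
  assumes B: "\<And>N. norm (\<Sum>n=1..N. w n) \<le> B"
  obtains D where "D holomorphic_on {s. Re s > 0}" "\<And>s. Re s > 0 \<Longrightarrow> dirichlet_term w s sums D s"
proof -
  define T where "T = (\<lambda>N. \<Sum>n=1..N. w n)"
  define u where "u = (\<lambda>n s. T n * (of_nat n powr (-s) - of_nat (Suc n) powr (-s)))"
  have B0: "B \<ge> 0" using B[of 0] norm_ge_zero order.trans by blast
  have u_le: "norm (u n s) \<le> B * (norm s * real n powr (- Re s - 1))" if "Re s > 0" for n s
  proof (cases "n = 0")
    case True
    then show ?thesis using B0 by (simp add: u_def T_def)
  next
    case False
    then have "norm (of_nat n powr (-s) - of_nat (Suc n) powr (-s)) \<le> norm s * real n powr (- Re s - 1)"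
      using norm_powr_diff_le[of n "real (Suc n)" s] that by (simp add: norm_minus_commute)
    then show ?thesis unfolding u_def norm_mult T_def by (intro mult_mono B B0) auto
  qed
  obtain D where D: "\<forall>s\<in>{s. Re s > 0}. ((\<lambda>n. u n s) sums D s) \<and> D field_differentiable (at s)"
  proof (rule series_differentiable_comparison_complex)
    show "open {s. Re s > 0}" by (rule open_halfspace_Re_gt)
    show "u n field_differentiable (at x)" if "x \<in> {s. Re s > 0}" for n x
    proof (cases "n = 0")
      case True
      then show ?thesis by (simp add: u_def T_def)
    next
      case False
      have "u n holomorphic_on UNIV"
        unfolding u_def using False by (intro holomorphic_intros) auto
      then show ?thesis by (simp add: holomorphic_on_imp_differentiable_at)
    qed
    fix x assume x: "x \<in> {s. Re s > 0}"
    define d where "d = Re x / 2"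
    have d: "d > 0" using x by (simp add: d_def)
    define h where "h = (\<lambda>n. complex_of_real (B * ((norm x + d) * real n powr (- d - 1))))"
    have h: "norm (h n) = B * ((norm x + d) * real n powr (- d - 1))" "h n \<in> \<real>\<^sub>\<ge>\<^sub>0" for n
      unfolding h_def norm_of_real using B0 d by (auto intro!: mult_nonneg_nonneg add_nonneg_nonneg abs_of_nonneg simp del: of_real_mult)
    have "summable h"
      unfolding h_def summable_complex_of_real using d by (intro summable_mult) (simp add: summable_real_powr_iff)
    moreover have "norm (u n y) \<le> norm (h n)"
      if "y \<in> ball x d" and n: "n > 0" for y n
    proof -
      have "\<bar>Re (x - y)\<bar> < d" using that abs_Re_le_cmod[of "x - y"] by (simp add: dist_norm)
      then have 1: "d \<le> Re y" unfolding d_def by (simp add: abs_if field_simps split: if_splits)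
      have 2: "norm y \<le> norm x + d"
        using that norm_triangle_ineq2[of y x] by (simp add: dist_norm norm_minus_commute)
      have "norm (u n y) \<le> B * (norm y * real n powr (- Re y - 1))" using 1 d by (intro u_le) auto
      also have "\<dots> \<le> B * ((norm x + d) * real n powr (- d - 1))"
        using 1 2 B0 n d by (intro mult_left_mono mult_mono powr_mono) auto
      finally show ?thesis unfolding h .
    qed
    moreover have "range h \<subseteq> \<real>\<^sub>\<ge>\<^sub>0" using h(2) by auto
    ultimately show "\<exists>d h. 0 < d \<and> summable h \<and> range h \<subseteq> \<real>\<^sub>\<ge>\<^sub>0 \<and>
          (\<forall>\<^sub>F n in sequentially. \<forall>y\<in>ball x d \<inter> {s. 0 < Re s}. cmod (u n y) \<le> cmod (h n))"
      using d by (intro exI[of _ d] exI[of _ h]) (auto intro!: eventually_mono[OF eventually_gt_at_top[of 0]])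
  qed
  show ?thesis
  proof
    show "D holomorphic_on {s. Re s > 0}"
      using D by (auto simp: holomorphic_on_def field_differentiable_at_within)
    fix s assume s: "Re s > 0"
    have parts: "(\<Sum>n<Suc N. dirichlet_term w s n) = T N * of_nat (Suc N) powr (-s) + (\<Sum>n<Suc N. u n s)" for N
    proof (induction N)
      case 0
      show ?case by (simp add: u_def T_def)
    next
      case (Suc N)
      have "T (Suc N) = T N + w (Suc N)" by (simp add: T_def)
      with Suc show ?case by (simp add: u_def dirichlet_term_def algebra_simps)
    qed
    have "(\<lambda>N. T N * of_nat (Suc N) powr (-s)) \<longlonglongrightarrow> 0"
    proof (rule Lim_null_comparison)
      show "\<forall>\<^sub>F N in sequentially. norm (T N * of_nat (Suc N) powr (-s)) \<le> B * real (Suc N) powr (- Re s)"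
        unfolding norm_mult norm_of_nat_powr T_def by (intro always_eventually allI mult_mono B B0) auto
      show "(\<lambda>N. B * real (Suc N) powr (- Re s)) \<longlonglongrightarrow> 0"
        using s by real_asymp
    qed
    moreover have "(\<lambda>N. \<Sum>n<Suc N. u n s) \<longlonglongrightarrow> D s"
      using D s unfolding sums_def by (intro LIMSEQ_Suc) auto
    ultimately have "(\<lambda>N. \<Sum>n<Suc N. dirichlet_term w s n) \<longlonglongrightarrow> 0 + D s"
      unfolding parts by (rule tendsto_add)
    then show "dirichlet_term w s sums D s" unfolding sums_def using LIMSEQ_imp_Suc[of "\<lambda>n. \<Sum>i<n. dirichlet_term w s i" "D s"]
      by (simp only: add_0_left)
  qed
qed

text \<open>Z(s) = (s - 1) \<zeta>(s). Subtracting the telescoping series of n^(1-s) - (n+1)^(1-s), whose sum is 1,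
from (s - 1) \<Sum> n^(-s) leaves a series that converges for Re s > 0 and vanishes at s = 1.\<close>

lemma zeta_continuation:
  obtains Z where "Z holomorphic_on {s. Re s > 0}" "Z 1 = 1"
    "\<And>s. Re s > 1 \<Longrightarrow> dirichlet_term (\<lambda>_. 1) s sums (Z s / (s - 1))"
proof -
  define u where "u = (\<lambda>n s. (s - 1) * of_nat (Suc n) powr (-s) + of_nat (Suc (Suc n)) powr (1 - s) - of_nat (Suc n) powr (1 - s :: complex))"
  obtain Y where Y: "\<forall>s\<in>{s. Re s > 0}. ((\<lambda>n. u n s) sums Y s) \<and> Y field_differentiable (at s)"
  proof (rule series_differentiable_comparison_complex)
    show "open {s. Re s > 0}" by (rule open_halfspace_Re_gt)
    show "u n field_differentiable (at x)" if "x \<in> {s. Re s > 0}" for n x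
    proof -
      have "u n holomorphic_on UNIV"
        unfolding u_def by (intro holomorphic_intros) (auto simp del: of_nat_Suc)
      then show ?thesis by (simp add: holomorphic_on_imp_differentiable_at)
    qed
    fix x assume x: "x \<in> {s. Re s > 0}"
    define d where "d = Re x / 2"
    have d: "d > 0" using x by (simp add: d_def)
    define h where "h = (\<lambda>n. complex_of_real ((norm x + d + 1) * (norm x + d) * real (Suc n) powr (- d - 1)))"
    have h: "norm (h n) = (norm x + d + 1) * (norm x + d) * real (Suc n) powr (- d - 1)" "h n \<in> \<real>\<^sub>\<ge>\<^sub>0" for n
      unfolding h_def norm_of_real using d by (auto intro!: mult_nonneg_nonneg add_nonneg_nonneg abs_of_nonneg simp del: of_real_mult of_real_add of_nat_Suc)
    have "summable (\<lambda>n. real n powr (- d - 1))" using d by (simp add: summable_real_powr_iff)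
    then have "summable h"
      unfolding h_def summable_complex_of_real by (intro summable_mult) (rule summable_Suc_iff[THEN iffD2])
    moreover have "norm (u n y) \<le> norm (h n)" if "y \<in> ball x d" for y n
    proof -
      have "\<bar>Re (x - y)\<bar> < d" using that abs_Re_le_cmod[of "x - y"] by (simp add: dist_norm)
      then have 1: "d \<le> Re y" unfolding d_def by (simp add: abs_if field_simps split: if_splits)
      have 2: "norm y \<le> norm x + d"
        using that norm_triangle_ineq2[of y x] by (simp add: dist_norm norm_minus_commute)
      have 3: "norm (y - 1) \<le> norm x + d + 1"
        using 2 norm_triangle_ineq4[of y 1] by simp
      have "norm (u n y) \<le> norm (y - 1) * norm y * real (Suc n) powr (- Re y - 1)"
        unfolding u_def using 1 d by (intro norm_zeta_term_le) auto
      also have "\<dots> \<le> norm (h n)"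
        unfolding h using 1 2 3 d by (intro mult_mono powr_mono) auto
      finally show ?thesis .
    qed
    moreover have "range h \<subseteq> \<real>\<^sub>\<ge>\<^sub>0" using h(2) by auto
    ultimately show "\<exists>d h. 0 < d \<and> summable h \<and> range h \<subseteq> \<real>\<^sub>\<ge>\<^sub>0 \<and>
          (\<forall>\<^sub>F n in sequentially. \<forall>y\<in>ball x d \<inter> {s. 0 < Re s}. cmod (u n y) \<le> cmod (h n))"
      using d by (intro exI[of _ d] exI[of _ h] conjI always_eventually) auto
  qed
  show ?thesis
  proof (rule that[of "\<lambda>s. 1 + Y s"])
    have "Y holomorphic_on {s. Re s > 0}"
      using Y by (auto simp: holomorphic_on_def field_differentiable_at_within)
    then show "(\<lambda>s. 1 + Y s) holomorphic_on {s. Re s > 0}" by (intro holomorphic_intros)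
    have u1: "u n 1 = 0" for n by (simp add: u_def del: of_nat_Suc)
    have "(\<lambda>n. u n 1) sums Y 1" using Y by simp
    then have "(\<lambda>n. 0) sums Y 1" by (simp only: u1)
    then show "1 + Y 1 = 1" using sums_unique2[OF sums_zero] by force
    fix s assume s: "Re s > 1"
    have "(\<lambda>n. of_nat (Suc n) powr (1 - s) :: complex) \<longlonglongrightarrow> 0"
    proof (rule Lim_null_comparison)
      show "\<forall>\<^sub>F N in sequentially. norm (of_nat (Suc N) powr (1 - s) :: complex) \<le> real (Suc N) powr (1 - Re s)"
        unfolding norm_of_nat_powr by (intro always_eventually allI) auto
      show "(\<lambda>N. real (Suc N) powr (1 - Re s)) \<longlonglongrightarrow> 0" using s by real_asymp
    qed
    from telescope_sums[OF this]
    have tele: "(\<lambda>n. of_nat (Suc (Suc n)) powr (1 - s) - of_nat (Suc n) powr (1 - s)) sums (0 - of_nat (Suc 0) powr (1 - s))" .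
    have "(\<lambda>n. u n s) sums Y s" using Y s by simp
    from sums_diff[OF this tele] have "(\<lambda>n. u n s - (of_nat (Suc (Suc n)) powr (1 - s) - of_nat (Suc n) powr (1 - s))) sums (Y s - (0 - of_nat (Suc 0) powr (1 - s)))" .
    then have "(\<lambda>n. (s - 1) * of_nat (Suc n) powr (-s)) sums (1 + Y s)"
      by (simp add: u_def add.commute)
    then have "(\<lambda>n. (1 / (s - 1)) * ((s - 1) * of_nat (Suc n) powr (-s))) sums (1 / (s - 1) * (1 + Y s))"
      by (rule sums_mult)
    moreover have "s \<noteq> 1" using s by auto
    ultimately have "(\<lambda>n. dirichlet_term (\<lambda>_. 1) s (Suc n)) sums ((1 + Y s) / (s - 1))"
      by (simp add: dirichlet_term_def)
    then show "dirichlet_term (\<lambda>_. 1) s sums ((1 + Y s) / (s - 1))"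
      by (simp add: sums_Suc_iff)
  qed
qed

section \<open>Residue characters\<close>

lemma periodic_mod:
  fixes w :: "nat \<Rightarrow> 'a"
  assumes "\<And>n. w (n + q) = w n"
  shows "w (n mod q) = w n"
proof -
  have "w (m + k * q) = w m" for m k
  proof (induction k)
    case (Suc k)
    have "w (m + Suc k * q) = w ((m + k * q) + q)" by (simp add: algebra_simps)
    then show ?case using Suc assms by simp
  qed simp
  from this[of "n mod q" "n div q"] show ?thesis by (simp add: mod_div_mult_eq)
qed

lemma periodic_zero_sum_bounded:
  fixes w :: "nat \<Rightarrow> complex"
  assumes per: "\<And>n. w (n + q) = w n" and q: "q > 0" and zero: "(\<Sum>n<q. w n) = 0"
  obtains B where "\<And>N. norm (\<Sum>n=1..N. w n) \<le> B"
proof -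
  have shift: "(\<Sum>n<N. w n) = (\<Sum>n<N mod q. w n)" for N
  proof (induction N rule: less_induct)
    case (less N)
    show ?case
    proof (cases "N < q")
      case False
      then have "(\<Sum>n<N. w n) = (\<Sum>n<q. w n) + (\<Sum>n=q..<N. w n)"
        using sum.atLeastLessThan_concat[of 0 q N w] by (simp add: lessThan_atLeast0)
      also have "(\<Sum>n=q..<N. w n) = (\<Sum>n<N - q. w n)"
        using False sum.shift_bounds_nat_ivl[of w 0 q "N - q"] by (simp add: per lessThan_atLeast0)
      also have "\<dots> = (\<Sum>n<(N - q) mod q. w n)" using less False q by auto
      finally show ?thesis using zero False by (simp add: le_mod_geq)
    qed simp
  qed
  have "norm (\<Sum>n=1..N. w n) \<le> (\<Sum>n<q. norm (w n)) + norm (w 0)" for N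
  proof -
    have "(\<Sum>n=1..N. w n) = (\<Sum>n<Suc N. w n) - w 0"
      by (subst sum.lessThan_Suc_shift) (simp add: sum.atLeast1_atMost_eq)
    also have "norm \<dots> \<le> norm (\<Sum>n<Suc N mod q. w n) + norm (w 0)"
      using norm_triangle_ineq4 unfolding shift[of "Suc N"] by blast
    also have "norm (\<Sum>n<Suc N mod q. w n) \<le> (\<Sum>n<Suc N mod q. norm (w n))" by (rule norm_sum)
    also have "\<dots> \<le> (\<Sum>n<q. norm (w n))"
      using q by (intro sum_mono2) (auto intro: less_trans mod_less_divisor)
    finally show ?thesis by simp
  qed
  then show ?thesis using that by blast
qed

text \<open>Dirichlet characters modulo q, as functions on the natural numbers.\<close>

locale residue_character =
  fixes q :: nat and chi :: "nat \<Rightarrow> complex"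
  assumes q_pos: "q > 0"
    and periodic: "chi (n + q) = chi n"
    and mult: "chi (m * n) = chi m * chi n"
    and nonzero_iff: "chi n \<noteq> 0 \<longleftrightarrow> coprime n q"
begin

lemma chi_mod: "chi (n mod q) = chi n"
  by (rule periodic_mod[of chi, OF periodic])

lemma chi_1 [simp]: "chi (Suc 0) = 1"
  using nonzero_iff[of 1] mult[of 1 1] by simp

lemma chi_power: "chi (n ^ k) = chi n ^ k"
  by (induction k) (auto simp: mult)

lemma norm_chi: "norm (chi n) = (if coprime n q then 1 else 0)"
proof (cases "coprime n q")
  case True
  then have "[n ^ totient q = 1] (mod q)" by (rule euler_theorem)
  then have "chi (n ^ totient q) = chi 1" using chi_mod by (metis cong_def)
  then have "chi n ^ totient q = 1" by (simp add: chi_power)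
  moreover have "totient q > 0" using q_pos by simp
  ultimately show ?thesis using True power_eq_1_iff by fastforce
next
  case False
  then show ?thesis using nonzero_iff[of n] by auto
qed

lemma norm_chi_le: "norm (chi n) \<le> 1"
  by (simp add: norm_chi)

definition principal :: bool where "principal \<longleftrightarrow> (\<forall>n. coprime n q \<longrightarrow> chi n = 1)"

definition mean :: complex where "mean = (\<Sum>n<q. chi n) / of_nat q"

text \<open>If chi a \<noteq> 1 for a unit a, then multiplication by a permutes the residues and multiplies the sum
over them by chi a.\<close>

lemma mean_nonprincipal:
  assumes "\<not> principal"
  shows "mean = 0"
proof -
  obtain a where a: "coprime a q" "chi a \<noteq> 1" using assms by (auto simp: principal_def)
  have inj: "inj_on (\<lambda>n. a * n mod q) {..<q}"
  proof (rule inj_onI)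
    fix x y assume "x \<in> {..<q}" "y \<in> {..<q}" "a * x mod q = a * y mod q"
    then have "[a * x = a * y] (mod q)" by (simp add: cong_def)
    then have "[x = y] (mod q)" using a cong_mult_lcancel_nat by blast
    then show "x = y" using \<open>x \<in> _\<close> \<open>y \<in> _\<close> by (simp add: cong_def)
  qed
  have "(\<lambda>n. a * n mod q) ` {..<q} = {..<q}"
    by (rule endo_inj_surj) (use inj q_pos in auto)
  then have "(\<Sum>n<q. chi n) = (\<Sum>n<q. chi (a * n mod q))"
    using sum.reindex[OF inj, of chi] by (simp add: o_def)
  also have "\<dots> = chi a * (\<Sum>n<q. chi n)" by (simp add: chi_mod mult sum_distrib_left)
  finally have "(1 - chi a) * (\<Sum>n<q. chi n) = 0" by (simp add: algebra_simps)
  then show ?thesis using a by (simp add: mean_def)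
qed

lemma mean_principal:
  assumes principal
  shows "mean \<noteq> 0"
proof -
  have "(\<Sum>n<q. chi n) = (\<Sum>n<q. if coprime n q then 1 else 0)"
    using assms nonzero_iff by (intro sum.cong) (auto simp: principal_def)
  also have "\<dots> = of_nat (card {n\<in>{..<q}. coprime n q})" by (simp add: sum.If_cases Int_def)
  also have "\<dots> \<noteq> 0"
  proof -
    have "1 mod q \<in> {n\<in>{..<q}. coprime n q}" using q_pos by simp
    then have "card {n\<in>{..<q}. coprime n q} \<noteq> 0" by (subst card_0_eq) auto
    then show ?thesis by (simp only: of_nat_eq_0_iff not_False_eq_True)
  qed
  finally show ?thesis using q_pos by (simp add: mean_def)
qed

lemma partial_sums_bounded:
  obtains B where "\<And>N. norm (\<Sum>n=1..N. chi n - mean) \<le> B"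
proof (rule periodic_zero_sum_bounded[of "\<lambda>n. chi n - mean" q])
  show "(\<Sum>n<q. chi n - mean) = 0" using q_pos by (simp add: sum_subtractf mean_def)
qed (use periodic q_pos that in auto)

text \<open>W(s) = (s - 1) L(s). The function chi is its mean plus a function with bounded partial sums; the mean
contributes a multiple of the zeta function, the rest is analytic for Re s > 0.\<close>

lemma L_continuation:
  obtains W where "W holomorphic_on {s. Re s > 0}" "W 1 = mean"
    "\<And>s. Re s > 1 \<Longrightarrow> dirichlet_term chi s sums (W s / (s - 1))"
proof -
  obtain B where B: "\<And>N. norm (\<Sum>n=1..N. chi n - mean) \<le> B" using partial_sums_bounded by blast
  obtain D where D: "D holomorphic_on {s. Re s > 0}" "\<And>s. Re s > 0 \<Longrightarrow> dirichlet_term (\<lambda>n. chi n - mean) s sums D s"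
    using dirichlet_abel[OF B] by blast
  obtain Z where Z: "Z holomorphic_on {s. Re s > 0}" "Z 1 = 1"
    "\<And>s. Re s > 1 \<Longrightarrow> dirichlet_term (\<lambda>_. 1) s sums (Z s / (s - 1))" using zeta_continuation by blast
  show ?thesis
  proof (rule that[of "\<lambda>s. mean * Z s + (s - 1) * D s"])
    show "(\<lambda>s. mean * Z s + (s - 1) * D s) holomorphic_on {s. Re s > 0}"
      by (intro holomorphic_intros D Z)
    fix s assume s: "Re s > 1"
    have "(\<lambda>n. mean * dirichlet_term (\<lambda>_. 1) s n + dirichlet_term (\<lambda>n. chi n - mean) s n) sums (mean * (Z s / (s - 1)) + D s)"
      using s by (intro sums_add sums_mult Z D) auto
    also have "(\<lambda>n. mean * dirichlet_term (\<lambda>_. 1) s n + dirichlet_term (\<lambda>n. chi n - mean) s n) = dirichlet_term chi s"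
      by (auto simp: dirichlet_term_def algebra_simps)
    also have "mean * (Z s / (s - 1)) + D s = (mean * Z s + (s - 1) * D s) / (s - 1)"
    proof -
      have "s - 1 \<noteq> 0" using s by auto
      then show ?thesis by (simp add: add_divide_distrib)
    qed
    finally show "dirichlet_term chi s sums ((mean * Z s + (s - 1) * D s) / (s - 1))" .
  qed (use Z in auto)
qed

lemma L_nonprincipal:
  assumes "\<not> principal"
  obtains D where "D holomorphic_on {s. Re s > 0}" "\<And>s. Re s > 0 \<Longrightarrow> dirichlet_term chi s sums D s"
proof -
  obtain B where B: "\<And>N. norm (\<Sum>n=1..N. chi n - mean) \<le> B" using partial_sums_bounded by blast
  have B': "norm (\<Sum>n=1..N. chi n) \<le> B" for N
    using B[of N] by (simp add: mean_nonprincipal[OF assms])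
  show ?thesis by (rule dirichlet_abel[OF B']) (rule that)
qed

text \<open>The L-function of the principal character has a pole at 1; no other character has a pole in Re s > 0.\<close>

definition pole_set :: "complex set" where "pole_set = (if principal then {1} else {})"

lemma L_extension:
  obtains L where "L holomorphic_on {s. Re s > 0} - pole_set"
    "\<And>s. Re s > 1 \<Longrightarrow> dirichlet_term chi s sums L s"
proof (cases principal)
  case True
  obtain W where W: "W holomorphic_on {s. Re s > 0}" "W 1 = mean"
    "\<And>s. Re s > 1 \<Longrightarrow> dirichlet_term chi s sums (W s / (s - 1))" using L_continuation by blast
  show ?thesis
    by (rule that[of "\<lambda>s. W s / (s - 1)"])
       (use W True in \<open>auto simp: pole_set_def intro!: holomorphic_intros intro: holomorphic_on_subset\<close>)
next
  case False
  then obtain D where "D holomorphic_on {s. Re s > 0}" "\<And>s. Re s > 0 \<Longrightarrow> dirichlet_term chi s sums D s"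
    using L_nonprincipal by blast
  then show ?thesis using False that[of D] by (simp add: pole_set_def)
qed

lemma summable_norm_chi_mult:
  assumes "\<And>n. n > 0 \<Longrightarrow> norm (a n) \<le> 1 + ln (real n)" "Re s > 1"
  shows "summable (\<lambda>n. norm (dirichlet_term (\<lambda>n. a n * chi n) s n))"
proof -
  have "summable (\<lambda>n. norm (dirichlet_term (\<lambda>n. if n = 0 then 0 else a n * chi n) s n))"
  proof (rule summable_norm_dirichlet[where C = 1])
    fix n show "norm (if n = 0 then 0 else a n * chi n) \<le> 1 * (1 + ln (real n))"
      using assms(1)[of n] norm_chi[of n] by (auto simp: norm_mult)
  qed fact
  also have "dirichlet_term (\<lambda>n. if n = 0 then 0 else a n * chi n) s = dirichlet_term (\<lambda>n. a n * chi n) s"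
    by (auto simp: dirichlet_term_def)
  finally show ?thesis .
qed

lemma summable_norm_chi: "Re s > 1 \<Longrightarrow> summable (\<lambda>n. norm (dirichlet_term chi s n))"
  using summable_norm_chi_mult[of "\<lambda>_. 1" s] by simp

text \<open>The Dirichlet convolution of \<mu> chi with chi is the unit.\<close>

lemma moebius_series_inverse:
  assumes s: "Re s > 1" and l: "dirichlet_term chi s sums l"
  shows "l \<noteq> 0" "dirichlet_term (\<lambda>n. of_int (moebius_mu n) * chi n) s sums (1 / l)"
proof -
  have sm: "summable (\<lambda>n. norm (dirichlet_term (\<lambda>n. of_int (moebius_mu n) * chi n) s n))"
  proof (rule summable_norm_chi_mult[OF _ s])
    fix n :: nat assume "n > 0"
    then have "ln (real n) \<ge> 0" by simp
    then show "norm (of_int (moebius_mu n) :: complex) \<le> 1 + ln (real n)"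
      using norm_moebius_mu_le[of n] by linarith
  qed
  then obtain m where m: "dirichlet_term (\<lambda>n. of_int (moebius_mu n) * chi n) s sums m"
    using summable_norm_cancel summable_sums by blast
  have "dirichlet_term (\<lambda>n. if n = 1 then 1 else 0) s sums (m * l)"
  proof (rule dirichlet_product[OF sm summable_norm_chi[OF s] m l])
    fix n :: nat assume n: "n > 0"
    have "(\<Sum>d | d dvd n. of_int (moebius_mu d) * chi d * chi (n div d)) = (\<Sum>d | d dvd n. of_int (moebius_mu d) * chi n)"
      by (intro sum.cong) (auto simp: mult[symmetric] mult.assoc)
    also have "\<dots> = of_int (\<Sum>d | d dvd n. moebius_mu d) * chi n" by (simp add: sum_distrib_right)
    finally show "(if n = 1 then 1 else 0) = (\<Sum>d | d dvd n. of_int (moebius_mu d) * chi d * chi (n div d))"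
      using n by (simp add: sum_moebius_mu_divisors)
  qed
  moreover have "dirichlet_term (\<lambda>n. if n = 1 then 1 else 0) s sums 1"
  proof -
    have "dirichlet_term (\<lambda>n. if n = 1 then 1 else 0) s = (\<lambda>r. if r = 1 then 1 else 0)"
      by (auto simp: dirichlet_term_def fun_eq_iff)
    then show ?thesis using sums_single[of 1 "\<lambda>_. 1::complex"] by simp
  qed
  ultimately have "m * l = 1" using sums_unique2 by blast
  then have "l \<noteq> 0" "m = 1 / l" by (auto simp: eq_divide_eq)
  then show "l \<noteq> 0" "dirichlet_term (\<lambda>n. of_int (moebius_mu n) * chi n) s sums (1 / l)"
    using m by simp_all
qed

lemma summable_norm_mangoldt:
  assumes "Re s > 1"
  shows "summable (\<lambda>n. norm (dirichlet_term (\<lambda>n. mangoldt n * chi n) s n))"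
  by (rule summable_norm_chi_mult[OF _ assms]) (use mangoldt_le in \<open>force simp: add_increasing\<close>)

text \<open>Since \<Lambda> * 1 = ln and chi is completely multiplicative, the convolution of \<Lambda> chi with chi is
chi ln, whose series is -L'. Using \<Lambda> instead of Euler products keeps everything within convolutions.\<close>

lemma mangoldt_series:
  assumes L: "L holomorphic_on X" "open X" "\<And>s. Re s > 1 \<Longrightarrow> dirichlet_term chi s sums L s"
    and s: "s \<in> X" "Re s > 1"
  shows "dirichlet_term (\<lambda>n. mangoldt n * chi n) s sums (- deriv L s / L s)"
proof -
  obtain A A' where A: "\<And>s. Re s > 1 \<Longrightarrow> dirichlet_term chi s sums A s"
    "\<And>s. Re s > 1 \<Longrightarrow> dirichlet_term (\<lambda>n. - of_real (ln (real n)) * chi n) s sums A' s"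
    "\<And>s. Re s > 1 \<Longrightarrow> (A has_field_derivative A' s) (at s)"
    using dirichlet_derivative[of chi 1, OF norm_chi_le] by blast
  have "(L has_field_derivative A' s) (at s)"
    by (rule has_field_derivative_transform_within_open[OF A(3)[OF s(2)] open_halfspace_Re_gt[of 1]])
       (use s sums_unique2[OF A(1) L(3)] in auto)
  then have dL: "deriv L s = A' s" by (rule DERIV_imp_deriv)
  have sP: "summable (\<lambda>n. norm (dirichlet_term (\<lambda>n. mangoldt n * chi n) s n))"
    by (rule summable_norm_mangoldt[OF s(2)])
  then obtain P where P: "dirichlet_term (\<lambda>n. mangoldt n * chi n) s sums P"
    using summable_norm_cancel summable_sums by blast
  have "dirichlet_term (\<lambda>n. of_real (ln (real n)) * chi n) s sums (P * L s)"
  proof (rule dirichlet_product[OF sP summable_norm_chi[OF s(2)] P L(3)[OF s(2)]])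
    fix n :: nat assume n: "n > 0"
    have "(\<Sum>d | d dvd n. mangoldt d * chi d * chi (n div d)) = (\<Sum>d | d dvd n. mangoldt d * chi n)"
      by (intro sum.cong) (auto simp: mult[symmetric] mult.assoc)
    also have "\<dots> = (\<Sum>d | d dvd n. mangoldt d) * chi n" by (simp add: sum_distrib_right)
    finally show "of_real (ln (real n)) * chi n = (\<Sum>d | d dvd n. mangoldt d * chi d * chi (n div d))"
      using n by (simp add: mangoldt_sum)
  qed
  moreover have "dirichlet_term (\<lambda>n. of_real (ln (real n)) * chi n) s sums (- A' s)"
    using sums_minus[OF A(2)[OF s(2)]] by (simp add: dirichlet_term_def[abs_def])
  ultimately have "P * L s = - A' s" using sums_unique2 by blast
  moreover have "L s \<noteq> 0" using moebius_series_inverse(1)[OF s(2) L(3)[OF s(2)]] .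
  ultimately have "P = - deriv L s / L s" by (simp add: dL field_simps)
  then show ?thesis using P by simp
qed

end

section \<open>Nonvanishing on the line Re s = 1\<close>

text \<open>m is the order of vanishing of L at s0: writing L = (w - s0)^m g with g zero-free, the logarithmic
derivative is m / (w - s0) + g'/g.\<close>

lemma log_deriv_limit:
  assumes L: "L holomorphic_on X" "open X" "s0 \<in> X"
    and nz: "\<And>s. s \<in> X \<Longrightarrow> Re s > Re s0 \<Longrightarrow> L s \<noteq> 0"
  obtains m :: nat where "((\<lambda>w. (w - s0) * (deriv L w / L w)) \<longlongrightarrow> of_nat m) (at s0)"
    "m = 0 \<longleftrightarrow> L s0 \<noteq> 0"
proof -
  have "\<exists>g r n. r > 0 \<and> g holomorphic_on ball s0 r \<and> (\<forall>w\<in>ball s0 r. L w = (w - s0) ^ n * g w \<and> g w \<noteq> 0)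
          \<and> (n = 0 \<longleftrightarrow> L s0 \<noteq> 0)"
  proof (cases "L s0 = 0")
    case True
    obtain r0 where r0: "r0 > 0" "ball s0 r0 \<subseteq> X" using L open_contains_ball by blast
    have "s0 + of_real (r0 / 2) \<in> ball s0 r0" using r0 by (simp add: dist_norm)
    moreover from this have "L (s0 + of_real (r0 / 2)) \<noteq> 0" using r0 by (intro nz) auto
    ultimately have nc: "\<not> L constant_on ball s0 r0"
      using True r0 unfolding constant_on_def by (metis centre_in_ball)
    have hol: "L holomorphic_on ball s0 r0" using L(1) r0(2) by (rule holomorphic_on_subset)
    have cen: "s0 \<in> ball s0 r0" using r0 by simp
    obtain g r n where "0 < n" "0 < r" "ball s0 r \<subseteq> ball s0 r0" "g holomorphic_on ball s0 r"
        "\<And>w. w \<in> ball s0 r \<Longrightarrow> L w = (w - s0) ^ n * g w" "\<And>w. w \<in> ball s0 r \<Longrightarrow> g w \<noteq> 0"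
      by (rule holomorphic_factor_zero_nonconstant[OF hol open_ball connected_ball cen True nc]) blast
    then show ?thesis using True by (intro exI[of _ g] exI[of _ r] exI[of _ n]) auto
  next
    case False
    have "open (X \<inter> L -` (- {0}))"
      using L by (intro continuous_open_preimage holomorphic_on_imp_continuous_on) auto
    moreover have "s0 \<in> X \<inter> L -` (- {0})" using False L by auto
    ultimately obtain r where "r > 0" "ball s0 r \<subseteq> X \<inter> L -` (- {0})"
      using open_contains_ball by blast
    then show ?thesis using False L
      by (intro exI[of _ L] exI[of _ r] exI[of _ 0]) (auto intro: holomorphic_on_subset)
  qed
  then obtain g r n where r: "r > 0" and g: "g holomorphic_on ball s0 r"
    and fac: "\<And>w. w \<in> ball s0 r \<Longrightarrow> L w = (w - s0) ^ n * g w" "\<And>w. w \<in> ball s0 r \<Longrightarrow> g w \<noteq> 0"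
    and n: "n = 0 \<longleftrightarrow> L s0 \<noteq> 0" by blast
  have eq: "of_nat n + (w - s0) * (deriv g w / g w) = (w - s0) * (deriv L w / L w)"
    if w: "w \<in> ball s0 r" "w \<noteq> s0" for w
  proof -
    define u where "u = w - s0"
    have u: "u \<noteq> 0" using w by (simp add: u_def)
    have dg: "(g has_field_derivative deriv g w) (at w)"
      using g w holomorphic_derivI open_ball by blast
    have "((\<lambda>w. (w - s0) ^ n * g w) has_field_derivative (of_nat n * u ^ (n - 1) * g w + u ^ n * deriv g w)) (at w)"
    proof -
      have "((\<lambda>w. (w - s0) ^ n) has_field_derivative of_nat n * u ^ (n - 1)) (at w)"
        by (auto intro!: derivative_eq_intros simp: u_def)
      from DERIV_mult[OF this dg] show ?thesis by (simp add: u_def mult.commute)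
    qed
    then have "(L has_field_derivative (of_nat n * u ^ (n - 1) * g w + u ^ n * deriv g w)) (at w)"
      by (rule has_field_derivative_transform_within_open[OF _ open_ball w(1)]) (simp add: fac)
    then have dL: "deriv L w = of_nat n * u ^ (n - 1) * g w + u ^ n * deriv g w" by (rule DERIV_imp_deriv)
    have "u * (of_nat n * u ^ (n - 1)) = of_nat n * u ^ n" by (cases n) auto
    then have "u * deriv L w = of_nat n * u ^ n * g w + u * (u ^ n * deriv g w)"
      unfolding dL distrib_left mult.assoc[symmetric] by simp
    also have "\<dots> = (of_nat n + u * (deriv g w / g w)) * (u ^ n * g w)"
      using fac(2)[OF w(1)] by (simp add: distrib_right)
    finally have "u * deriv L w / L w = of_nat n + u * (deriv g w / g w)"
      using fac[OF w(1)] u by (simp add: u_def)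
    then show ?thesis by (simp add: u_def)
  qed
  have "isCont (\<lambda>w. of_nat n + (w - s0) * (deriv g w / g w)) s0"
  proof -
    have "(\<lambda>w. of_nat n + (w - s0) * (deriv g w / g w)) holomorphic_on ball s0 r"
      using g fac by (intro holomorphic_intros holomorphic_deriv) auto
    then have "continuous_on (ball s0 r) (\<lambda>w. of_nat n + (w - s0) * (deriv g w / g w))"
      by (rule holomorphic_on_imp_continuous_on)
    then show ?thesis using r by (simp add: continuous_on_eq_continuous_at)
  qed
  then have "((\<lambda>w. of_nat n + (w - s0) * (deriv g w / g w)) \<longlongrightarrow> of_nat n) (at s0)"
    by (simp add: isCont_def)
  then have "((\<lambda>w. (w - s0) * (deriv L w / L w)) \<longlongrightarrow> of_nat n) (at s0)"
    by (rule Lim_transform_within_open[OF _ open_ball[of s0 r]]) (use r eq in auto)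
  then show ?thesis using n that by blast
qed

lemma log_deriv_limit_right:
  assumes L: "L holomorphic_on X" "open X" "s0 \<in> X"
    and nz: "\<And>s. s \<in> X \<Longrightarrow> Re s > Re s0 \<Longrightarrow> L s \<noteq> 0"
  obtains m :: nat where "((\<lambda>y. of_real y * (deriv L (s0 + of_real y) / L (s0 + of_real y))) \<longlongrightarrow> of_nat m) (at_right 0)"
    "m = 0 \<longleftrightarrow> L s0 \<noteq> 0"
proof -
  obtain m :: nat where m: "((\<lambda>w. (w - s0) * (deriv L w / L w)) \<longlongrightarrow> of_nat m) (at s0)"
    "m = 0 \<longleftrightarrow> L s0 \<noteq> 0" using log_deriv_limit[OF assms] by blast
  have "filterlim (\<lambda>y. s0 + of_real y) (at s0) (at_right (0::real))"
    unfolding filterlim_at by (auto intro!: tendsto_eq_intros simp: eventually_at_filter)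
  from filterlim_compose[OF m(1) this] m(2) show ?thesis using that by (simp add: o_def)
qed

context residue_character begin

lemma principal_character:
  "residue_character q (\<lambda>n. if coprime n q then 1 else 0)"
  "residue_character.principal q (\<lambda>n. if coprime n q then 1 else 0)"
proof -
  have per: "coprime (n + q) q \<longleftrightarrow> coprime n q" for n
    by (simp only: coprime_iff_gcd_eq_1 gcd_add1)
  interpret p: residue_character q "\<lambda>n. if coprime n q then 1 else 0"
    by unfold_locales (use q_pos in \<open>auto simp: per\<close>)
  show "residue_character q (\<lambda>n. if coprime n q then 1 else 0)" by unfold_locales
  show "residue_character.principal q (\<lambda>n. if coprime n q then 1 else 0)"
    by (simp add: p.principal_def)
qed

lemma square_character: "residue_character q (\<lambda>n. chi n ^ 2)"
  by unfold_locales (use q_pos periodic nonzero_iff in \<open>auto simp: mult power_mult_distrib\<close>)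

text \<open>Each term is \<Lambda>(n) n^(-1-y) times Re (3 + 4w + w^2) with |w| = 1, and this is 2 (1 + Re w)^2.\<close>

lemma mangoldt_three_four_one:
  fixes y t :: real
  assumes P: "dirichlet_term (\<lambda>n. mangoldt n * (if coprime n q then 1 else 0)) (1 + of_real y) sums P0"
    "dirichlet_term (\<lambda>n. mangoldt n * chi n) (1 + \<i> * of_real t + of_real y) sums P1"
    "dirichlet_term (\<lambda>n. mangoldt n * chi n ^ 2) (1 + \<i> * of_real (2 * t) + of_real y) sums P2"
  shows "Re (3 * P0 + 4 * P1 + P2) \<ge> 0"
proof -
  let ?d0 = "dirichlet_term (\<lambda>n. mangoldt n * (if coprime n q then 1 else 0)) (1 + of_real y)"
  let ?d1 = "dirichlet_term (\<lambda>n. mangoldt n * chi n) (1 + \<i> * of_real t + of_real y)"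
  let ?d2 = "dirichlet_term (\<lambda>n. mangoldt n * chi n ^ 2) (1 + \<i> * of_real (2 * t) + of_real y)"
  have "(\<lambda>n. 3 * ?d0 n + 4 * ?d1 n + ?d2 n) sums (3 * P0 + 4 * P1 + P2)"
    by (intro sums_add sums_mult P)
  then have sums: "(\<lambda>n. Re (3 * ?d0 n + 4 * ?d1 n + ?d2 n)) sums Re (3 * P0 + 4 * P1 + P2)"
    by (rule sums_Re)
  have nonneg: "0 \<le> Re (3 * ?d0 n + 4 * ?d1 n + ?d2 n)" for n
  proof (cases "n > 0 \<and> coprime n q")
    case False
    then have "n = 0 \<or> chi n = 0" using nonzero_iff[of n] by auto
    then show ?thesis using False by (auto simp: dirichlet_term_def)
  next
    case n: True
    define x where "x = real n powr - (1 + y)"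
    define v :: complex where "v = of_nat n powr - (\<i> * of_real t)"
    define w where "w = chi n * v"
    \<comment> \<open>The three terms differ only by powers of the unimodular factor v.\<close>
    have x: "(of_nat n :: complex) powr - (1 + of_real y) = of_real x"
      using powr_of_real[of "real n" "- (1 + y)"] by (simp add: x_def)
    have x1: "(of_nat n :: complex) powr - (1 + \<i> * of_real t + of_real y) = of_real x * v"
    proof -
      have "- (1 + \<i> * of_real t + of_real y) = - (1 + of_real y) + - (\<i> * of_real t)" by simp
      then show ?thesis by (simp only: powr_add x v_def)
    qed
    have x2: "(of_nat n :: complex) powr - (1 + \<i> * of_real (2 * t) + of_real y) = of_real x * v ^ 2"
    proof -
      have "- (1 + \<i> * of_real (2 * t) + of_real y) = - (1 + of_real y) + (- (\<i> * of_real t) + - (\<i> * of_real t))" by simp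
      then show ?thesis by (simp only: powr_add x v_def power2_eq_square)
    qed
    have "norm w = 1" using n by (simp add: w_def v_def norm_mult norm_of_nat_powr norm_chi)
    then have w: "(Re w)\<^sup>2 + (Im w)\<^sup>2 = 1" by (simp add: cmod_power2[symmetric])
    have "3 * ?d0 n + 4 * ?d1 n + ?d2 n = of_real (mangoldt n * x) * (3 + 4 * w + w ^ 2)"
      using n unfolding dirichlet_term_def x x1 x2
      by (simp add: w_def algebra_simps power_mult_distrib)
    also have "Re \<dots> = mangoldt n * x * (3 + 4 * Re w + ((Re w)\<^sup>2 - (Im w)\<^sup>2))"
      by (simp add: power2_eq_square)
    also have "3 + 4 * Re w + ((Re w)\<^sup>2 - (Im w)\<^sup>2) = 2 * (1 + Re w)\<^sup>2"
      using w by (simp add: power2_eq_square algebra_simps)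
    also have "mangoldt n * x * (2 * (1 + Re w)\<^sup>2) \<ge> 0"
      by (intro mult_nonneg_nonneg mangoldt_nonneg) (auto simp: x_def)
    finally show ?thesis .
  qed
  show ?thesis by (rule sums_le[OF nonneg sums_zero sums])
qed

lemma open_L_domain: "open ({s. Re s > 0} - pole_set)"
  by (cases principal) (simp_all add: pole_set_def open_Diff open_halfspace_Re_gt)

text \<open>A zero of L of order m makes \<Sum> \<Lambda>(n) chi(n) n^(-s) behave like -m / (s - s0).\<close>

lemma mangoldt_limit:
  assumes L: "L holomorphic_on X" "open X" "\<And>s. Re s > 1 \<Longrightarrow> dirichlet_term chi s sums L s"
    and s0: "s0 \<in> X" "Re s0 = 1"
  obtains m :: nat where
    "((\<lambda>y. of_real y * (\<Sum>n. dirichlet_term (\<lambda>n. mangoldt n * chi n) (s0 + of_real y) n)) \<longlongrightarrow> - of_nat m) (at_right 0)"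
    "m = 0 \<longleftrightarrow> L s0 \<noteq> 0"
proof -
  have nz: "L s \<noteq> 0" if "s \<in> X" "Re s > Re s0" for s
  proof -
    have 1: "Re s > 1" using that s0 by simp
    show ?thesis by (rule moebius_series_inverse(1)[OF 1 L(3)[OF 1]])
  qed
  obtain m :: nat where m: "((\<lambda>y. of_real y * (deriv L (s0 + of_real y) / L (s0 + of_real y))) \<longlongrightarrow> of_nat m) (at_right 0)"
    "m = 0 \<longleftrightarrow> L s0 \<noteq> 0" by (rule log_deriv_limit_right[OF L(1,2) s0(1) nz])
  obtain r where r: "r > 0" "ball s0 r \<subseteq> X"
    using L(2) s0(1) by (rule openE)
  have "\<forall>\<^sub>F y in at_right (0::real). y \<in> {0<..<r}" using r(1) by (rule eventually_at_right_real)
  then have "\<forall>\<^sub>F y in at_right (0::real). - (of_real y * (deriv L (s0 + of_real y) / L (s0 + of_real y)))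
     = of_real y * (\<Sum>n. dirichlet_term (\<lambda>n. mangoldt n * chi n) (s0 + of_real y) n)"
  proof eventually_elim
    case (elim y)
    then have "s0 + of_real y \<in> ball s0 r" by (simp add: dist_norm)
    then have sX: "s0 + of_real y \<in> X" using r(2) by blast
    have sR: "Re (s0 + of_real y) > 1" using elim s0(2) by simp
    have "dirichlet_term (\<lambda>n. mangoldt n * chi n) (s0 + of_real y) sums (- deriv L (s0 + of_real y) / L (s0 + of_real y))"
      by (rule mangoldt_series[OF L sX sR])
    from sums_unique[OF this, symmetric] show ?case by simp
  qed
  then have "((\<lambda>y. of_real y * (\<Sum>n. dirichlet_term (\<lambda>n. mangoldt n * chi n) (s0 + of_real y) n)) \<longlongrightarrow> - of_nat m) (at_right 0)"
    by (rule Lim_transform_eventually[rotated]) (intro tendsto_minus m(1))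
  then show ?thesis using m(2) that by blast
qed

text \<open>The simple pole of the principal L-function at 1 contributes +1, in contrast to the zeros in the
preceding lemma.\<close>

lemma mangoldt_limit_principal:
  assumes principal
  shows "((\<lambda>y. of_real y * (\<Sum>n. dirichlet_term (\<lambda>n. mangoldt n * chi n) (1 + of_real y) n)) \<longlongrightarrow> 1) (at_right 0)"
proof -
  obtain W where W: "W holomorphic_on {s. Re s > 0}" "W 1 = mean"
    "\<And>s. Re s > 1 \<Longrightarrow> dirichlet_term chi s sums (W s / (s - 1))" using L_continuation by blast
  let ?X = "{s. Re s > 0} - {1::complex}"
  have X: "open ?X" "open {s. Re s > 0}" by (auto intro!: open_Diff open_halfspace_Re_gt)
  have L: "(\<lambda>s. W s / (s - 1)) holomorphic_on ?X"
    using W(1) by (auto intro!: holomorphic_intros intro: holomorphic_on_subset)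
  have nz: "W s \<noteq> 0" if "Re s > 1" for s
    using moebius_series_inverse(1)[OF that W(3)[OF that]] by auto
  have nz': "W s \<noteq> 0" if "s \<in> {s. Re s > 0}" "Re s > Re 1" for s
    using nz that(2) by simp
  have one: "1 \<in> {s::complex. Re s > 0}" by simp
  obtain m :: nat where m: "((\<lambda>y. of_real y * (deriv W (1 + of_real y) / W (1 + of_real y))) \<longlongrightarrow> of_nat m) (at_right 0)"
    "m = 0 \<longleftrightarrow> W 1 \<noteq> 0" by (rule log_deriv_limit_right[OF W(1) X(2) one nz'])
  have "m = 0" using m(2) W(2) mean_principal[OF assms] by simp
  have "\<forall>\<^sub>F y in at_right (0::real). y \<in> {0<..<1}" by (rule eventually_at_right_real) simp
  then have "\<forall>\<^sub>F y in at_right (0::real). 1 - (of_real y * (deriv W (1 + of_real y) / W (1 + of_real y)))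
     = of_real y * (\<Sum>n. dirichlet_term (\<lambda>n. mangoldt n * chi n) (1 + of_real y) n)"
  proof eventually_elim
    case (elim y)
    define s where "s = complex_of_real (1 + y)"
    have s: "Re s > 1" "s \<in> ?X" "s - 1 = of_real y" "s - 1 \<noteq> 0" "1 + of_real y = s"
      using elim by (auto simp: s_def complex_eq_iff)
    have dW: "(W has_field_derivative deriv W s) (at s)"
    proof (rule holomorphic_derivI[OF W(1) X(2)])
      show "s \<in> {s. Re s > 0}" using s(1) by simp
    qed
    have "deriv (\<lambda>s. W s / (s - 1)) s = (deriv W s * (s - 1) - W s) / (s - 1) ^ 2"
    proof (rule DERIV_imp_deriv)
      have "((\<lambda>s. s - 1) has_field_derivative 1) (at s)" by (auto intro!: derivative_eq_intros)
      from DERIV_divide[OF dW this s(4)]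
      show "((\<lambda>s. W s / (s - 1)) has_field_derivative (deriv W s * (s - 1) - W s) / (s - 1) ^ 2) (at s)"
        by (simp only: power2_eq_square mult_1_right)
    qed
    moreover have "dirichlet_term (\<lambda>n. mangoldt n * chi n) s sums (- deriv (\<lambda>s. W s / (s - 1)) s / (W s / (s - 1)))"
      by (rule mangoldt_series[OF L X(1) W(3) s(2,1)])
    ultimately have "dirichlet_term (\<lambda>n. mangoldt n * chi n) s sums (- ((deriv W s * (s - 1) - W s) / (s - 1) ^ 2) / (W s / (s - 1)))"
      by simp
    then have "(\<Sum>n. dirichlet_term (\<lambda>n. mangoldt n * chi n) s n) = - ((deriv W s * (s - 1) - W s) / (s - 1) ^ 2) / (W s / (s - 1))"
      by (rule sums_unique[symmetric])
    then have "(s - 1) * (\<Sum>n. dirichlet_term (\<lambda>n. mangoldt n * chi n) s n) = 1 - (s - 1) * (deriv W s / W s)"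
    proof -
      have "u * (- ((d * u - w) / u ^ 2) / (w / u)) = 1 - u * (d / w)" if "u \<noteq> 0" "w \<noteq> 0" for u d w :: complex
        using that by (simp add: field_simps power2_eq_square)
      from this[OF s(4) nz[OF s(1)], of "deriv W s"] show ?thesis using \<open>_ = _ / (W s / (s - 1))\<close> by (simp only:)
    qed
    then show ?case by (simp only: s)
  qed
  then show ?thesis
    by (rule Lim_transform_eventually[rotated])
       (use tendsto_diff[OF tendsto_const[of 1] m(1)] \<open>m = 0\<close> in simp)
qed

text \<open>If L vanishes to order m at 1 + it and the L-function of the squared character to order m2 at 1 + 2it,
then multiplying the 3-4-1 inequality by y and letting y tend to 0 gives 3 - 4m - m2 \<ge> 0, whence m = 0.
The hypothesis on t and the square excludes a pole at 1 + 2it, which would contribute with the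
opposite sign.\<close>

lemma L_nonvanishing:
  assumes L: "L holomorphic_on X" "open X" "\<And>s. Re s > 1 \<Longrightarrow> dirichlet_term chi s sums L s"
    and s0: "1 + \<i> * of_real t \<in> X"
    and t: "t \<noteq> 0 \<or> \<not> residue_character.principal q (\<lambda>n. chi n ^ 2)"
  shows "L (1 + \<i> * of_real t) \<noteq> 0"
proof -
  interpret c0: residue_character q "\<lambda>n. if coprime n q then 1 else 0" by (rule principal_character)
  interpret c2: residue_character q "\<lambda>n. chi n ^ 2" by (rule square_character)
  obtain m where m: "((\<lambda>y. of_real y * (\<Sum>n. dirichlet_term (\<lambda>n. mangoldt n * chi n) (1 + \<i> * of_real t + of_real y) n)) \<longlongrightarrow> - of_nat m) (at_right 0)"
    "m = 0 \<longleftrightarrow> L (1 + \<i> * of_real t) \<noteq> 0"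
    by (rule mangoldt_limit[OF L s0]) auto
  obtain L2 where L2: "L2 holomorphic_on {s. Re s > 0} - c2.pole_set" "\<And>s. Re s > 1 \<Longrightarrow> dirichlet_term (\<lambda>n. chi n ^ 2) s sums L2 s"
    using c2.L_extension by blast
  have s2: "1 + \<i> * of_real (2 * t) \<in> {s. Re s > 0} - c2.pole_set"
    using t by (auto simp: c2.pole_set_def complex_eq_iff)
  obtain m2 where m2: "((\<lambda>y. of_real y * (\<Sum>n. dirichlet_term (\<lambda>n. mangoldt n * chi n ^ 2) (1 + \<i> * of_real (2 * t) + of_real y) n)) \<longlongrightarrow> - of_nat m2) (at_right 0)"
    by (rule c2.mangoldt_limit[OF L2(1) c2.open_L_domain L2(2) s2]) auto
  note m0 = c0.mangoldt_limit_principal[OF principal_character(2)]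
  have "0 \<le> Re (3 * 1 + 4 * (- of_nat m) + - of_nat m2)"
  proof (rule tendsto_lowerbound)
    show "((\<lambda>y. Re (3 * (of_real y * (\<Sum>n. dirichlet_term (\<lambda>n. mangoldt n * (if coprime n q then 1 else 0)) (1 + of_real y) n))
       + 4 * (of_real y * (\<Sum>n. dirichlet_term (\<lambda>n. mangoldt n * chi n) (1 + \<i> * of_real t + of_real y) n))
       + of_real y * (\<Sum>n. dirichlet_term (\<lambda>n. mangoldt n * chi n ^ 2) (1 + \<i> * of_real (2 * t) + of_real y) n)))
       \<longlongrightarrow> Re (3 * 1 + 4 * (- of_nat m) + - of_nat m2)) (at_right 0)"
      by (intro tendsto_intros m0 m(1) m2)
    have "\<forall>\<^sub>F y in at_right (0::real). y \<in> {0<..<1}" by (rule eventually_at_right_real) simp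
    then show "\<forall>\<^sub>F y in at_right 0. 0 \<le> Re (3 * (of_real y * (\<Sum>n. dirichlet_term (\<lambda>n. mangoldt n * (if coprime n q then 1 else 0)) (1 + of_real y) n))
       + 4 * (of_real y * (\<Sum>n. dirichlet_term (\<lambda>n. mangoldt n * chi n) (1 + \<i> * of_real t + of_real y) n))
       + of_real y * (\<Sum>n. dirichlet_term (\<lambda>n. mangoldt n * chi n ^ 2) (1 + \<i> * of_real (2 * t) + of_real y) n))"
    proof eventually_elim
      case (elim y)
      let ?P0 = "\<Sum>n. dirichlet_term (\<lambda>n. mangoldt n * (if coprime n q then 1 else 0)) (1 + of_real y) n"
      let ?P1 = "\<Sum>n. dirichlet_term (\<lambda>n. mangoldt n * chi n) (1 + \<i> * of_real t + of_real y) n"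
      let ?P2 = "\<Sum>n. dirichlet_term (\<lambda>n. mangoldt n * chi n ^ 2) (1 + \<i> * of_real (2 * t) + of_real y) n"
      have "Re (3 * ?P0 + 4 * ?P1 + ?P2) \<ge> 0"
        by (rule mangoldt_three_four_one)
           (use elim in \<open>auto intro!: summable_sums summable_norm_cancel c0.summable_norm_mangoldt summable_norm_mangoldt c2.summable_norm_mangoldt\<close>)
      then have "y * Re (3 * ?P0 + 4 * ?P1 + ?P2) \<ge> 0" using elim by simp
      also have "y * Re (3 * ?P0 + 4 * ?P1 + ?P2) = Re (of_real y * (3 * ?P0 + 4 * ?P1 + ?P2))" by simp
      also have "of_real y * (3 * ?P0 + 4 * ?P1 + ?P2) = 3 * (of_real y * ?P0) + 4 * (of_real y * ?P1) + of_real y * ?P2"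
        by (simp only: distrib_left mult.left_commute)
      finally show ?case .
    qed
  qed auto
  then have "m = 0" by simp
  then show ?thesis using m(2) by simp
qed

end

section \<open>Nonvanishing at 1 for real characters\<close>

lemma alternating_power_sum: "(\<Sum>j\<le>k. (-1::real) ^ j) = (if even k then 1 else 0)"
  by (induction k) auto

text \<open>The divisor sum is multiplicative, and at a prime power it is a geometric sum with ratio -1, 0 or 1:
never negative, and at least 1 for even exponents.\<close>

lemma sum_divisors_real_character:
  fixes f :: "nat \<Rightarrow> real"
  assumes mult: "\<And>m n. f (m * n) = f m * f n" and one: "f 1 = 1" and vals: "\<And>n. f n \<in> {-1, 0, 1}"
  assumes "n > 0"
  shows "(\<Sum>d | d dvd n. f d) \<ge> 0 \<and> (\<forall>m. n = m\<^sup>2 \<longrightarrow> (\<Sum>d | d dvd n. f d) \<ge> 1)"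
  using \<open>n > 0\<close>
proof (induction n rule: less_induct)
  case (less n)
  show ?case
  proof (cases "n = 1")
    case True
    have "{d. d dvd Suc 0} = {1}" by auto
    then have "(\<Sum>d | d dvd n. f d) = 1" using True one by simp
    then show ?thesis by (metis order_refl zero_le_one)
  next
    case False
    then obtain p where p: "prime p" "p dvd n" using prime_factor_nat by blast
    define k where "k = multiplicity p n"
    obtain m where m: "n = p ^ k * m" "\<not> p dvd m"
      unfolding k_def using multiplicity_decompose'[of n p] less.prems p by (metis not_prime_unit less_not_refl)
    have "k > 0" using p m by (cases k) auto
    have "m > 0" using m less.prems by (cases m) auto
    have "m < n"
    proof -
      have "p ^ k > 1" using p \<open>k > 0\<close> prime_gt_1_nat one_less_power by blast
      then show ?thesis using m(1) \<open>m > 0\<close> by simp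
    qed
    have fp: "f (p ^ j) = f p ^ j" for j by (induction j) (use one in \<open>auto simp: mult\<close>)
    have split: "(\<Sum>d | d dvd n. f d) = (\<Sum>j\<le>k. f p ^ j) * (\<Sum>e | e dvd m. f e)"
    proof -
      have "(\<Sum>d | d dvd n. f d) = (\<Sum>j\<le>k. \<Sum>e | e dvd m. f p ^ j * f e)"
        unfolding m(1) by (subst sum_divisors_prime_power_mult[OF p(1) m(2) \<open>m > 0\<close>]) (simp only: mult fp)
      then show ?thesis by (simp only: sum_product)
    qed
    have G0: "(\<Sum>j\<le>k. f p ^ j) \<ge> 0" and G1: "even k \<Longrightarrow> (\<Sum>j\<le>k. f p ^ j) \<ge> 1"
    proof -
      have "f p = -1 \<or> f p = 0 \<or> f p = 1" using vals[of p] by auto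
      moreover have "(\<Sum>j\<le>k. (0::real) ^ j) = 1"
        by (subst sum.remove[of _ 0]) (auto intro!: sum.neutral)
      ultimately show "(\<Sum>j\<le>k. f p ^ j) \<ge> 0" "even k \<Longrightarrow> (\<Sum>j\<le>k. f p ^ j) \<ge> 1"
        by (auto simp: alternating_power_sum)
    qed
    note IH = less.IH[OF \<open>m < n\<close> \<open>m > 0\<close>]
    have "(\<Sum>d | d dvd n. f d) \<ge> 1" if sq: "n = a\<^sup>2" for a
    proof -
      define j where "j = multiplicity p a"
      have "a > 0" using sq less.prems by (cases a) auto
      then obtain b where b: "a = p ^ j * b" "\<not> p dvd b"
        unfolding j_def using multiplicity_decompose'[of a p] p by (metis not_prime_unit less_not_refl)
      have "k = 2 * j" unfolding k_def j_def sq using p \<open>a > 0\<close>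
        by (simp add: prime_elem_multiplicity_power_distrib)
      then have "p ^ k * m = p ^ k * b\<^sup>2" using sq m(1) b(1) by (simp add: power_mult_distrib power_mult mult.commute)
      then have "m = b\<^sup>2" using p by (simp add: prime_gt_0_nat)
      then have "(\<Sum>e | e dvd m. f e) \<ge> 1" using IH by blast
      moreover have "(\<Sum>j\<le>k. f p ^ j) \<ge> 1" using G1 \<open>k = 2 * j\<close> by simp
      ultimately show ?thesis unfolding split using mult_mono[of 1 _ 1] by fastforce
    qed
    moreover have "(\<Sum>d | d dvd n. f d) \<ge> 0" unfolding split using IH G0 by simp
    ultimately show ?thesis by blast
  qed
qed

text \<open>The inequality of arithmetic and geometric means for the powers of u^2. The induction step is
Bernoulli's inequality.\<close>

lemma geometric_sum_ge:
  fixes u :: real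
  assumes "u \<ge> 0"
  shows "real (Suc n) * u ^ n \<le> (\<Sum>i<Suc n. (u\<^sup>2) ^ i)"
proof (induction n)
  case (Suc n)
  have "1 + real (Suc (Suc n)) * (u - 1) \<le> (1 + (u - 1)) ^ (Suc (Suc n))"
    using assms by (intro Bernoulli_inequality) auto
  then have "0 \<le> u ^ n * (real (Suc n) + u ^ (n + 2) - real (Suc (Suc n)) * u)"
    using assms by (intro mult_nonneg_nonneg) (auto simp: algebra_simps)
  also have "u ^ n * (real (Suc n) + u ^ (n + 2) - real (Suc (Suc n)) * u)
      = real (Suc n) * u ^ n + (u\<^sup>2) ^ Suc n - real (Suc (Suc n)) * u ^ Suc n"
    by (simp add: algebra_simps power_add power2_eq_square power_mult_distrib)
  finally show ?case using Suc by simp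
qed simp

text \<open>These are the weights by which (1 - t)^(-1) \<Sum> chi(n)/n differs from the Lambert series
\<Sum> chi(n) t^n / (1 - t^n).\<close>

definition lambert_weight :: "real \<Rightarrow> nat \<Rightarrow> real"
  where "lambert_weight t n = 1 / (real n * (1 - t)) - t ^ n / (1 - t ^ n)"

text \<open>Writing 1 - t^n = (1 - t) S(n), the monotonicity amounts to n (n+1) t^n \<le> S(n) S(n+1), which follows
from \<open>geometric_sum_ge\<close> with u^2 = t.\<close>

lemma lambert_weight_properties:
  assumes t: "0 < t" "t < 1"
  shows "lambert_weight t 1 = 1" "\<And>n. n > 0 \<Longrightarrow> lambert_weight t (Suc n) \<le> lambert_weight t n"
    "\<And>n. n > 0 \<Longrightarrow> lambert_weight t n \<ge> 0"
proof -
  define b where "b = lambert_weight t"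
  define S where "S = (\<lambda>n. \<Sum>i<n. t ^ i)"
  have S: "1 - t ^ n = (1 - t) * S n" for n unfolding S_def by (rule one_diff_power_eq)
  have S_pos: "S n > 0" if "n > 0" for n unfolding S_def using that t by (intro sum_pos) auto
  have b: "b n = (1 / real n - t ^ n / S n) / (1 - t)" for n
    unfolding b_def lambert_weight_def S by (simp add: diff_divide_distrib mult.commute)
  show "lambert_weight t 1 = 1" using t by (simp add: lambert_weight_def field_simps)
  have nonneg: "b n \<ge> 0" if n: "n > 0" for n
  proof -
    have "real n * t ^ n = (\<Sum>i<n. t ^ n)" by simp
    also have "\<dots> \<le> S n" unfolding S_def using t by (intro sum_mono power_decreasing) auto
    finally have "t ^ n / S n \<le> 1 / real n" using S_pos[OF n] n by (simp add: field_simps)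
    then show ?thesis unfolding b using t by simp
  qed
  have dec: "b (Suc n) \<le> b n" if n: "n > 0" for n
  proof -
    define u where "u = sqrt t"
    have u: "u \<ge> 0" "u\<^sup>2 = t" "u \<le> 1" using t by (auto simp: u_def)
    have 1: "real n * u ^ (n - 1) \<le> S n" using geometric_sum_ge[of u "n - 1"] u n by (simp add: S_def)
    have 2: "real (Suc n) * u ^ n \<le> S (Suc n)" using geometric_sum_ge[of u n] u by (simp add: S_def)
    have "real n * real (Suc n) * t ^ n = real n * real (Suc n) * u ^ (2 * n)" using u by (simp add: power_mult)
    also have "\<dots> \<le> real n * real (Suc n) * u ^ ((n - 1) + n)"
      using u by (intro mult_left_mono power_decreasing) auto
    also have "\<dots> = (real n * u ^ (n - 1)) * (real (Suc n) * u ^ n)" by (simp add: power_add)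
    also have "\<dots> \<le> S n * S (Suc n)" using u S_pos[OF n] by (intro mult_mono 1 2) auto
    finally have "real n * real (Suc n) * t ^ n \<le> S n * S (Suc n)" .
    moreover have "t ^ n / Y \<le> 1 / X" if "X * t ^ n \<le> Y" "X > 0" "Y > 0" for X Y
      using that by (simp add: field_simps)
    ultimately have *: "t ^ n / (S n * S (Suc n)) \<le> 1 / (real n * real (Suc n))"
      using S_pos[OF n] S_pos[of "Suc n"] n by simp
    have "t ^ n * S (Suc n) - t ^ Suc n * S n = t ^ n"
    proof -
      have "S (Suc n) = 1 + t * S n" unfolding S_def by (subst sum.lessThan_Suc_shift) (simp add: sum_distrib_left)
      then show ?thesis by (simp add: algebra_simps)
    qed
    then have "t ^ n / S n - t ^ Suc n / S (Suc n) = t ^ n / (S n * S (Suc n))"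
      using S_pos[OF n] S_pos[of "Suc n"] by (simp add: field_simps)
    moreover have "1 / real n - 1 / real (Suc n) = 1 / (real n * real (Suc n))"
      using n by (simp add: field_simps)
    ultimately have "1 / real (Suc n) - t ^ Suc n / S (Suc n) \<le> 1 / real n - t ^ n / S n" using * by linarith
    then show ?thesis unfolding b using t by (intro divide_right_mono) auto
  qed
  show "lambert_weight t (Suc n) \<le> lambert_weight t n" "lambert_weight t n \<ge> 0" if "n > 0" for n
    using nonneg[OF that] dec[OF that] by (simp_all add: b_def)
qed

text \<open>Abel's inequality.\<close>

lemma norm_sum_mult_decreasing_le:
  fixes c :: "nat \<Rightarrow> complex" and b :: "nat \<Rightarrow> real"
  assumes B: "\<And>N. norm (\<Sum>n=1..N. c n) \<le> B"
    and dec: "\<And>n. n > 0 \<Longrightarrow> b (Suc n) \<le> b n" and nonneg: "\<And>n. n > 0 \<Longrightarrow> b n \<ge> 0"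
  shows "norm (\<Sum>n=1..N. c n * of_real (b n)) \<le> B * b 1"
proof -
  define T where "T = (\<lambda>N. \<Sum>n=1..N. c n)"
  have parts: "(\<Sum>n=1..N. c n * of_real (b n)) = T N * of_real (b (Suc N)) + (\<Sum>n=1..N. T n * of_real (b n - b (Suc n)))" for N
    by (induction N) (auto simp: T_def algebra_simps)
  have tel: "(\<Sum>n=1..N. b n - b (Suc n)) = b 1 - b (Suc N)" for N
    by (induction N) auto
  have "norm (\<Sum>n=1..N. c n * of_real (b n))
      \<le> norm (T N * of_real (b (Suc N))) + norm (\<Sum>n=1..N. T n * of_real (b n - b (Suc n)))"
    unfolding parts by (rule norm_triangle_ineq)
  also have "norm (T N * of_real (b (Suc N))) \<le> B * b (Suc N)"
    unfolding norm_mult norm_of_real T_def using B[of N] nonneg[of "Suc N"] by (simp add: mult_right_mono)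
  also have "norm (\<Sum>n=1..N. T n * of_real (b n - b (Suc n))) \<le> (\<Sum>n=1..N. B * (b n - b (Suc n)))"
  proof (rule sum_norm_le)
    fix n assume "n \<in> {1..N}"
    then show "norm (T n * of_real (b n - b (Suc n))) \<le> B * (b n - b (Suc n))"
      unfolding norm_mult norm_of_real T_def using B[of n] dec[of n] by (simp add: mult_right_mono)
  qed
  also have "\<dots> = B * (b 1 - b (Suc N))" by (simp only: tel sum_distrib_left[symmetric])
  finally show ?thesis by (simp add: algebra_simps)
qed

text \<open>Expanding t^n / (1 - t^n) into a geometric series turns the Lambert series of c into the power series
of its divisor sums.\<close>

lemma has_sum_lambert:
  fixes c :: "nat \<Rightarrow> complex" and t :: real
  assumes c: "\<And>n. norm (c n) \<le> 1" and t: "0 < t" "t < 1"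
  obtains S where "((\<lambda>k. (\<Sum>d | d dvd k. c d) * of_real (t ^ k)) has_sum S) {1..}"
    "(\<lambda>N. \<Sum>n=1..N. c n * of_real (t ^ n / (1 - t ^ n))) \<longlonglongrightarrow> S"
proof -
  have tn: "norm (complex_of_real t ^ n) < 1" "t ^ n < 1" if "n \<ge> 1" for n
    using that t by (auto simp: norm_power power_less_one_iff)
  have inner: "((\<lambda>m. c d * of_real t ^ (d * m)) has_sum (c d * of_real (t ^ d / (1 - t ^ d)))) {1..}" if "d \<in> {1..}" for d
  proof -
    have "((\<lambda>m. (complex_of_real t ^ d) ^ m) has_sum (of_real t ^ d / (1 - of_real t ^ d))) {1..}"
      using that by (intro has_sum_geometric_from_1 tn) auto
    then show ?thesis by (intro has_sum_cmult_right) (simp add: power_mult)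
  qed
  have inner_norm: "((\<lambda>m. norm (c d * complex_of_real t ^ (d * m))) has_sum (norm (c d) * (t ^ d / (1 - t ^ d)))) {1..}" if "d \<in> {1..}" for d
  proof -
    have "((\<lambda>m. (t ^ d) ^ m) has_sum (t ^ d / (1 - t ^ d))) {1..}"
      using that t by (intro has_sum_geometric_from_1) (auto simp: power_less_one_iff)
    then show ?thesis using t unfolding norm_mult by (intro has_sum_cmult_right) (simp add: power_mult norm_power)
  qed
  have "(\<lambda>x. norm (case x of (d, m) \<Rightarrow> c d * complex_of_real t ^ (d * m))) summable_on {1..} \<times> {1..}"
  proof (rule Infinite_Sum.abs_summable_on_Sigma_iff[THEN iffD2], intro conjI ballI)
    show "(\<lambda>m. norm (case (d, m) of (d, m) \<Rightarrow> c d * complex_of_real t ^ (d * m))) summable_on {1..}" if "d \<in> {1..}" for d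
      using inner_norm[OF that] by (simp add: has_sum_imp_summable)
    have "(\<lambda>d. norm (norm (c d) * (t ^ d / (1 - t ^ d)))) summable_on {1..}"
    proof (rule Infinite_Sum.abs_summable_on_comparison_test)
      have "(\<lambda>d. t ^ d * (1 / (1 - t))) summable_on {1..}"
        by (intro summable_on_cmult_left has_sum_imp_summable[OF has_sum_geometric_from_1]) (use t in auto)
      then show "(\<lambda>d. norm (t ^ d * (1 / (1 - t)))) summable_on {1..}" using t by simp
      fix d :: nat assume d: "d \<in> {1..}"
      then have "t ^ d \<le> t" using t power_decreasing[of 1 d t] by simp
      then have "norm (c d) * (t ^ d / (1 - t ^ d)) \<le> 1 * (t ^ d / (1 - t))"
        using c[of d] t tn(2)[of d] d by (intro mult_mono frac_le) auto
      then show "norm (norm (c d) * (t ^ d / (1 - t ^ d))) \<le> norm (t ^ d * (1 / (1 - t)))"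
        using t tn(2)[of d] d by simp
    qed
    also have "?this \<longleftrightarrow> (\<lambda>d. norm (\<Sum>\<^sub>\<infinity>m\<in>{1..}. norm (case (d, m) of (d, m) \<Rightarrow> c d * complex_of_real t ^ (d * m)))) summable_on {1..}"
      by (rule summable_on_cong) (simp only: prod.case infsumI[OF inner_norm])
    finally show "(\<lambda>d. norm (\<Sum>\<^sub>\<infinity>m\<in>{1..}. norm (case (d, m) of (d, m) \<Rightarrow> c d * complex_of_real t ^ (d * m)))) summable_on {1..}" .
  qed
  then obtain S where S: "((\<lambda>(d, m). c d * complex_of_real t ^ (d * m)) has_sum S) ({1..} \<times> {1..})"
    using abs_summable_summable summable_on_def by blast
  show ?thesis
  proof
    have "((\<lambda>k. \<Sum>d | d dvd k. c d * complex_of_real t ^ (d * (k div d))) has_sum S) {1..}"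
      by (rule has_sum_divisors[OF S])
    then show "((\<lambda>k. (\<Sum>d | d dvd k. c d) * of_real (t ^ k)) has_sum S) {1..}"
      by (simp add: sum_distrib_right)
    have "((\<lambda>d. c d * of_real (t ^ d / (1 - t ^ d))) has_sum S) {1..}"
      by (rule has_sum_SigmaD[OF S]) (use inner in simp)
    then have "((\<lambda>d. if d = 0 then 0 else c d * of_real (t ^ d / (1 - t ^ d))) has_sum S) UNIV"
      by (subst has_sum_cong_neutral[where T = "{1..}"]) auto
    then have "(\<lambda>d. if d = 0 then 0 else c d * of_real (t ^ d / (1 - t ^ d))) sums S" by (rule has_sum_imp_sums)
    then have "(\<lambda>N. \<Sum>d<Suc N. if d = 0 then 0 else c d * of_real (t ^ d / (1 - t ^ d))) \<longlonglongrightarrow> S"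
      unfolding sums_def by (rule LIMSEQ_Suc)
    also have "(\<lambda>N. \<Sum>d<Suc N. if d = 0 then 0 else c d * of_real (t ^ d / (1 - t ^ d)))
       = (\<lambda>N. \<Sum>n=1..N. c n * of_real (t ^ n / (1 - t ^ n)))"
      by (rule ext, rule sum.mono_neutral_cong_right) (auto simp: less_Suc_eq_le)
    finally show "(\<lambda>N. \<Sum>n=1..N. c n * of_real (t ^ n / (1 - t ^ n))) \<longlonglongrightarrow> S" .
  qed
qed

context residue_character begin

text \<open>Monsky's argument. If L(1) = 0, then the Lambert series of chi equals - \<Sum> chi(n) b(n) with weights
b decreasing from 1, so it stays bounded as t tends to 1. But its power series coefficients, the
divisor sums of chi, are nonnegative and at least 1 at squares, so it is at least \<Sum> t^(j^2), which is
unbounded.\<close>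

lemma L_one_nonzero_if_real:
  assumes real: "\<And>n. chi n \<in> \<real>" and np: "\<not> principal" and l: "dirichlet_term chi 1 sums l"
  shows "l \<noteq> 0"
proof
  assume "l = 0"
  obtain B where B: "\<And>N. norm (\<Sum>n=1..N. chi n) \<le> B"
    using partial_sums_bounded mean_nonprincipal[OF np] by (metis (no_types, lifting) diff_zero sum.cong)
  define x where "x = (\<lambda>n. Re (chi n))"
  have chi: "chi n = of_real (x n)" for n using real by (simp add: x_def complex_is_Real_iff complex_eq_iff)
  have x_mult: "x (m * n) = x m * x n" for m n using mult[of m n] unfolding chi by (simp flip: of_real_mult)
  have x_1: "x 1 = 1" by (simp add: x_def)
  have x_vals: "x n \<in> {-1, 0, 1}" for n
  proof -
    have "\<bar>x n\<bar> = 0 \<or> \<bar>x n\<bar> = 1" using norm_chi[of n] unfolding chi by (auto split: if_splits)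
    then show ?thesis by auto
  qed
  note r = sum_divisors_real_character[of x, OF x_mult x_1 x_vals]
  have harm: "(\<lambda>N. \<Sum>n=1..N. chi n / of_nat n) \<longlonglongrightarrow> 0"
  proof -
    have "(\<lambda>N. \<Sum>n<Suc N. dirichlet_term chi 1 n) \<longlonglongrightarrow> 0"
      using l \<open>l = 0\<close> unfolding sums_def by (intro LIMSEQ_Suc) simp
    also have "(\<lambda>N. \<Sum>n<Suc N. dirichlet_term chi 1 n) = (\<lambda>N. \<Sum>n=1..N. chi n / of_nat n)"
      by (rule ext, rule sum.mono_neutral_cong_right) (auto simp: less_Suc_eq_le dirichlet_term_def powr_minus_divide)
    finally show ?thesis .
  qed
  have bound: "(\<Sum>j=1..K. t ^ (j\<^sup>2)) \<le> B" if t: "0 < t" "t < 1" for t :: real and K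
  proof -
    define b where "b = lambert_weight t"
    note b = lambert_weight_properties[OF t, folded b_def]
    obtain S where S: "((\<lambda>k. (\<Sum>d | d dvd k. chi d) * of_real (t ^ k)) has_sum S) {1..}"
      "(\<lambda>N. \<Sum>n=1..N. chi n * of_real (t ^ n / (1 - t ^ n))) \<longlonglongrightarrow> S"
      by (rule has_sum_lambert[OF norm_chi_le t])
    have G: "(\<Sum>n=1..N. chi n * of_real (t ^ n / (1 - t ^ n)))
       = of_real (1 / (1 - t)) * (\<Sum>n=1..N. chi n / of_nat n) - (\<Sum>n=1..N. chi n * of_real (b n))" for N
      unfolding sum_distrib_left sum_subtractf[symmetric]
    proof (rule sum.cong[OF refl])
      fix n
      have "t ^ n / (1 - t ^ n) = 1 / (1 - t) * (1 / real n) - b n"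
        by (simp add: b_def lambert_weight_def)
      then have "complex_of_real (t ^ n / (1 - t ^ n)) = of_real (1 / (1 - t) * (1 / real n) - b n)"
        by (simp only:)
      also have "\<dots> = of_real (1 / (1 - t)) * (1 / of_nat n) - of_real (b n)"
        by (simp only: of_real_diff of_real_mult of_real_divide of_real_of_nat_eq of_real_1)
      finally have e: "complex_of_real (t ^ n / (1 - t ^ n)) = of_real (1 / (1 - t)) * (1 / of_nat n) - of_real (b n)" .
      have "x * (c * (1 / y) - z) = c * (x / y) - x * z" for x c y z :: complex
        by (simp add: right_diff_distrib)
      then show "chi n * of_real (t ^ n / (1 - t ^ n)) = of_real (1 / (1 - t)) * (chi n / of_nat n) - chi n * of_real (b n)"
        unfolding e .
    qed
    have "norm S \<le> B"
    proof (rule tendsto_le[OF sequentially_bot])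
      show "(\<lambda>N. norm (\<Sum>n=1..N. chi n * of_real (t ^ n / (1 - t ^ n)))) \<longlonglongrightarrow> norm S"
        by (intro tendsto_norm S)
      show "(\<lambda>N. norm (of_real (1 / (1 - t)) * (\<Sum>n=1..N. chi n / of_nat n)) + B) \<longlonglongrightarrow> B"
        using tendsto_add[OF tendsto_norm[OF tendsto_mult[OF tendsto_const[of "complex_of_real (1 / (1 - t))"] harm]] tendsto_const[of B]]
        by simp
      have "norm (\<Sum>n=1..N. chi n * of_real (b n)) \<le> B" for N
        using norm_sum_mult_decreasing_le[of chi B b N, OF B b(2,3)] b(1) by simp
      then show "\<forall>\<^sub>F N in sequentially. norm (\<Sum>n=1..N. chi n * of_real (t ^ n / (1 - t ^ n)))
          \<le> norm (of_real (1 / (1 - t)) * (\<Sum>n=1..N. chi n / of_nat n)) + B"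
        unfolding G by (intro always_eventually allI norm_triangle_le_diff add_left_mono)
    qed
    have "((\<lambda>k. Re ((\<Sum>d | d dvd k. chi d) * of_real (t ^ k))) has_sum Re S) {1..}"
      using S(1) by (rule has_sum_Re)
    also have "(\<lambda>k. Re ((\<Sum>d | d dvd k. chi d) * of_real (t ^ k))) = (\<lambda>k. (\<Sum>d | d dvd k. x d) * t ^ k)"
      by (simp add: x_def del: of_real_power)
    finally have R: "((\<lambda>k. (\<Sum>d | d dvd k. x d) * t ^ k) has_sum Re S) {1..}" .
    have "(\<Sum>j=1..K. t ^ (j\<^sup>2)) \<le> (\<Sum>j=1..K. (\<Sum>d | d dvd j\<^sup>2. x d) * t ^ (j\<^sup>2))"
    proof (rule sum_mono)
      fix j assume "j \<in> {1..K}"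
      then have "(\<Sum>d | d dvd j\<^sup>2. x d) \<ge> 1" using r[of "j\<^sup>2"] by auto
      then show "t ^ (j\<^sup>2) \<le> (\<Sum>d | d dvd j\<^sup>2. x d) * t ^ (j\<^sup>2)"
        using t mult_right_mono[of 1 "\<Sum>d | d dvd j\<^sup>2. x d" "t ^ (j\<^sup>2)"] by simp
    qed
    also have "\<dots> = (\<Sum>k\<in>(\<lambda>j. j\<^sup>2) ` {1..K}. (\<Sum>d | d dvd k. x d) * t ^ k)"
      by (subst sum.reindex) (auto simp: inj_on_def)
    also have "\<dots> \<le> Re S"
    proof (rule finite_sum_le_has_sum[OF R])
      fix k :: nat assume "k \<in> {1..} - (\<lambda>j. j\<^sup>2) ` {1..K}"
      then show "0 \<le> (\<Sum>d | d dvd k. x d) * t ^ k" using r[of k] t by auto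
    qed (auto simp: Suc_le_eq)
    also have "\<dots> \<le> norm S" by (rule complex_Re_le_cmod)
    finally show ?thesis using \<open>norm S \<le> B\<close> by simp
  qed
  obtain K :: nat where K: "real K > B" using reals_Archimedean2 by blast
  have "real K \<le> B"
  proof (rule tendsto_upperbound)
    show "((\<lambda>t::real. \<Sum>j=1..K. t ^ (j\<^sup>2)) \<longlongrightarrow> real K) (at_left 1)"
      by (auto intro!: tendsto_eq_intros)
    have "\<forall>\<^sub>F t in at_left (1::real). t \<in> {0<..<1}" by (rule eventually_at_left_real) simp
    then show "\<forall>\<^sub>F t in at_left (1::real). (\<Sum>j=1..K. t ^ (j\<^sup>2)) \<le> B"
      by eventually_elim (use bound in auto)
  qed simp
  then show False using K by simp
qed

end

context residue_character begin

text \<open>The function is 1 / L(s). It is analytic where L has no zeros, and at the pole of L it has a removable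
singularity, which the formula (s - 1) / W(s) avoids.\<close>

lemma moebius_dirichlet_continuation:
  obtains G U where "open U" "{s. Re s \<ge> 1} \<subseteq> U" "G holomorphic_on U"
    "\<And>s. Re s > 1 \<Longrightarrow> dirichlet_term (\<lambda>n. of_int (moebius_mu n) * chi n) s sums G s"
proof -
  have nonzero_open: "open {s. Re s > 0 \<and> W s \<noteq> 0}" if "W holomorphic_on {s. Re s > 0}" for W :: "complex \<Rightarrow> complex"
  proof -
    have "open ({s. Re s > 0} \<inter> W -` (- {0}))"
      using that by (intro continuous_open_preimage holomorphic_on_imp_continuous_on open_halfspace_Re_gt) auto
    also have "{s. Re s > 0} \<inter> W -` (- {0}) = {s. Re s > 0 \<and> W s \<noteq> 0}" by auto
    finally show ?thesis .
  qed
  have line: "s = 1 + \<i> * of_real (Im s)" if "Re s = 1" for s using that by (simp add: complex_eq_iff)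
  show ?thesis
  proof (cases principal)
    case True
    obtain W where W: "W holomorphic_on {s. Re s > 0}" "W 1 = mean"
      "\<And>s. Re s > 1 \<Longrightarrow> dirichlet_term chi s sums (W s / (s - 1))" using L_continuation by blast
    have nz: "W s \<noteq> 0" if s: "Re s \<ge> 1" for s
    proof (cases "Re s = 1")
      case False
      then have 1: "Re s > 1" using s by simp
      show ?thesis using moebius_series_inverse(1)[OF 1 W(3)[OF 1]] by auto
    next
      case Re1: True
      show ?thesis
      proof (cases "Im s = 0")
        case True
        then have "s = 1" using Re1 by (simp add: complex_eq_iff)
        then show ?thesis using W(2) mean_principal[OF \<open>principal\<close>] by simp
      next
        case False
        have "(\<lambda>s. W s / (s - 1)) holomorphic_on {s. Re s > 0} - {1}"
          using W(1) by (auto intro!: holomorphic_intros intro: holomorphic_on_subset)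
        moreover have "open ({s. Re s > 0} - {1::complex})" by (intro open_Diff open_halfspace_Re_gt) auto
        moreover have "1 + \<i> * of_real (Im s) \<in> {s. Re s > 0} - {1}" using False by (auto simp: complex_eq_iff)
        ultimately have "W (1 + \<i> * of_real (Im s)) / (1 + \<i> * of_real (Im s) - 1) \<noteq> 0"
          using False by (intro L_nonvanishing[OF _ _ W(3)]) auto
        then show ?thesis using line[OF Re1] by auto
      qed
    qed
    show ?thesis
    proof (rule that[OF nonzero_open[OF W(1)]])
      show "{s. Re s \<ge> 1} \<subseteq> {s. Re s > 0 \<and> W s \<noteq> 0}" using nz by auto
      show "(\<lambda>s. (s - 1) / W s) holomorphic_on {s. Re s > 0 \<and> W s \<noteq> 0}"
        using W(1) by (auto intro!: holomorphic_intros intro: holomorphic_on_subset)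
      show "dirichlet_term (\<lambda>n. of_int (moebius_mu n) * chi n) s sums ((s - 1) / W s)" if "Re s > 1" for s
        using moebius_series_inverse(2)[OF that W(3)[OF that]] by simp
    qed
  next
    case False
    obtain D where D: "D holomorphic_on {s. Re s > 0}" "\<And>s. Re s > 0 \<Longrightarrow> dirichlet_term chi s sums D s"
      using L_nonprincipal[OF False] by blast
    have D': "dirichlet_term chi s sums D s" if "Re s > 1" for s using D(2)[of s] that by simp
    have nz: "D s \<noteq> 0" if s: "Re s \<ge> 1" for s
    proof (cases "Re s = 1")
      case False
      then have 1: "Re s > 1" using s by simp
      show ?thesis by (rule moebius_series_inverse(1)[OF 1 D'[OF 1]])
    next
      case Re1: True
      interpret c2: residue_character q "\<lambda>n. chi n ^ 2" by (rule square_character)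
      show ?thesis
      proof (cases "Im s \<noteq> 0 \<or> \<not> c2.principal")
        case True
        have "D (1 + \<i> * of_real (Im s)) \<noteq> 0"
          by (rule L_nonvanishing[OF D(1) open_halfspace_Re_gt D' _ True]) auto
        then show ?thesis using line[OF Re1] by simp
      next
        case sq: False
        have "chi n \<in> \<real>" for n
        proof (cases "coprime n q")
          case True
          then have "chi n ^ 2 = 1" using sq by (simp add: c2.principal_def)
          then have "chi n = 1 \<or> chi n = -1" by (simp add: power2_eq_1_iff)
          then show ?thesis by auto
        next
          case False
          then have "chi n = 0" using nonzero_iff[of n] by blast
          then show ?thesis by simp
        qed
        then have "D 1 \<noteq> 0" using L_one_nonzero_if_real[OF _ False] D(2)[of 1] by simp
        moreover have "s = 1" using sq Re1 by (simp add: complex_eq_iff)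
        ultimately show ?thesis by simp
      qed
    qed
    show ?thesis
    proof (rule that[OF nonzero_open[OF D(1)]])
      show "{s. Re s \<ge> 1} \<subseteq> {s. Re s > 0 \<and> D s \<noteq> 0}" using nz by auto
      show "(\<lambda>s. 1 / D s) holomorphic_on {s. Re s > 0 \<and> D s \<noteq> 0}"
        using D(1) by (auto intro!: holomorphic_intros intro: holomorphic_on_subset)
      show "dirichlet_term (\<lambda>n. of_int (moebius_mu n) * chi n) s sums (1 / D s)" if "Re s > 1" for s
        by (rule moebius_series_inverse(2)[OF that D'[OF that]])
    qed
  qed
qed

text \<open>For the principal character modulo 1 this is equivalent to the prime number theorem.\<close>

lemma sublinear_sum_moebius_chi: "sublinear (\<lambda>N. \<Sum>n=1..N. of_int (moebius_mu n) * chi n)"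
proof -
  obtain G U where U: "open U" "{s. Re s \<ge> 1} \<subseteq> U" and G: "G holomorphic_on U"
    "\<And>s. Re s > 1 \<Longrightarrow> dirichlet_term (\<lambda>n. of_int (moebius_mu n) * chi n) s sums G s"
    by (rule moebius_dirichlet_continuation) blast
  have "(\<lambda>N. \<Sum>n=1..N. of_int (moebius_mu n) * chi n / of_nat n) \<longlonglongrightarrow> G (1 + 0)"
  proof (rule newman_tauberian[where U = "(\<lambda>z. 1 + z) -` U" and F = "\<lambda>z. G (1 + z)"])
    show "norm (of_int (moebius_mu n) * chi n) \<le> 1" for n
      unfolding norm_mult using norm_moebius_mu_le norm_chi_le by (intro mult_le_one) auto
    show "open ((\<lambda>z. 1 + z) -` U)" using U(1) by (intro open_vimage continuous_intros)
    show "{z. 0 \<le> Re z} \<subseteq> (\<lambda>z. 1 + z) -` U" by (auto intro!: subsetD[OF U(2)])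
    show "(\<lambda>z. G (1 + z)) holomorphic_on (\<lambda>z. 1 + z) -` U"
      by (rule holomorphic_on_compose_gen[OF _ G(1), unfolded o_def]) (auto intro!: holomorphic_intros)
    fix s :: complex assume "Re s > 0"
    then have "dirichlet_term (\<lambda>n. of_int (moebius_mu n) * chi n) (1 + s) sums G (1 + s)" by (intro G) simp
    then show "(\<lambda>n. of_int (moebius_mu n) * chi n * of_nat n powr (- 1 - s)) sums G (1 + s)"
      by (simp add: dirichlet_term_def[abs_def])
  qed
  then show ?thesis by (rule sublinear_if_convergent_harmonic_sum)
qed

end

section \<open>Periodic weights\<close>

text \<open>The standard character e(x) = exp(2\<pi>ix) of the additive circle, written as a function on the reals.\<close>

definition ec :: "real \<Rightarrow> complex" where "ec x = cis (2 * pi * x)"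

lemma ec_add: "ec (x + y) = ec x * ec y"
  by (simp add: ec_def cis_mult distrib_left)

lemma ec_0 [simp]: "ec 0 = 1"
  by (simp add: ec_def)

lemma norm_ec [simp]: "norm (ec x) = 1"
  by (simp add: ec_def)

lemma ec_Ints: "x \<in> \<int> \<Longrightarrow> ec x = 1"
  by (auto simp: ec_def elim!: Ints_cases)

lemma ec_eq_1_iff: "ec x = 1 \<longleftrightarrow> x \<in> \<int>"
proof
  assume "ec x = 1"
  then have "cos (2 * pi * x) = 1" by (simp add: ec_def complex_eq_iff)
  then obtain n :: int where "2 * pi * x = of_int n * 2 * pi" using cos_one_2pi_int by blast
  then have "x = of_int n" by simp
  then show "x \<in> \<int>" by simp
qed (rule ec_Ints)

lemma ec_power: "ec x ^ n = ec (real n * x)"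
  by (simp add: ec_def Complex.DeMoivre mult_ac)

lemma cnj_ec: "cnj (ec x) = ec (- x)"
  by (simp add: ec_def cis_cnj)

text \<open>Orthogonality of the additive characters modulo k.\<close>

lemma sum_ec_div:
  fixes i :: int
  assumes "k > 0"
  shows "(\<Sum>j<k. ec (of_int i * real j / real k)) = (if int k dvd i then of_nat k else 0)"
proof (cases "int k dvd i")
  case True
  then obtain m where "i = int k * m" by (elim dvdE)
  then have "ec (of_int i * real j / real k) = 1" for j
    using assms by (intro ec_Ints) auto
  then show ?thesis using True by simp
next
  case False
  define z where "z = ec (of_int i / real k)"
  have "z \<noteq> 1"
  proof
    assume "z = 1"
    then obtain m where "of_int i / real k = of_int m" unfolding z_def ec_eq_1_iff by (elim Ints_cases)
    then have "real_of_int i = of_int (m * int k)" using assms by (simp add: field_simps)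
    then have "i = m * int k" by (simp only: of_int_eq_iff)
    with False show False by simp
  qed
  have "(\<Sum>j<k. ec (of_int i * real j / real k)) = (\<Sum>j<k. z ^ j)"
    by (simp add: z_def ec_power mult.commute)
  also have "\<dots> = (z ^ k - 1) / (z - 1)" using \<open>z \<noteq> 1\<close> by (simp add: geometric_sum)
  also have "z ^ k = 1" using assms by (simp add: z_def ec_power ec_Ints)
  finally show ?thesis using False by simp
qed

text \<open>Functions on the group of units modulo q, extended by 0 to a periodic function.\<close>

definition unit_weight :: "nat \<Rightarrow> (nat \<Rightarrow> complex) \<Rightarrow> bool"
  where "unit_weight q v \<longleftrightarrow> (\<forall>n. v (n + q) = v n) \<and> (\<forall>n. \<not> coprime n q \<longrightarrow> v n = 0)"

lemma unit_weight_cong: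
  assumes "unit_weight q v" "[m = n] (mod q)"
  shows "v m = v n"
proof -
  have "v (n mod q) = v n" for n by (rule periodic_mod) (use assms in \<open>auto simp: unit_weight_def\<close>)
  then show ?thesis using assms(2) unfolding cong_def by metis
qed

text \<open>A common eigenvector of all translations v \<mapsto> v(a \<cdot>) is v(1) times a character: its eigenvalue at a
can only be v(a) / v(1).\<close>

lemma sublinear_moebius_eigenweight:
  assumes q: "q > 0" and v: "unit_weight q v"
    and eig: "\<And>a. coprime a q \<Longrightarrow> \<exists>l. \<forall>n. v (a * n) = l * v n"
  shows "sublinear (\<lambda>N. \<Sum>n=1..N. of_int (moebius_mu n) * v n)"
proof -
  define chi where "chi = (\<lambda>n. v n / v 1)"
  have v0: "v n = 0" if "\<not> coprime n q" for n using v that by (simp add: unit_weight_def)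
  have v_chi: "v n = v 1 * chi n" for n
  proof (cases "v 1 = 0")
    case True
    have "v n = 0"
    proof (cases "coprime n q")
      case True
      then obtain l where "\<forall>m. v (n * m) = l * v m" using eig by blast
      then have "v (n * 1) = l * v 1" by blast
      then show ?thesis using \<open>v 1 = 0\<close> by simp
    qed (rule v0)
    then show ?thesis using True by simp
  qed (simp add: chi_def)
  show ?thesis
  proof (cases "v 1 = 0")
    case True
    then have "v n = 0" for n using v_chi[of n] by simp
    then show ?thesis by (intro sublinear_bounded[of _ 0]) simp
  next
    case False
    have mult: "chi (m * n) = chi m * chi n" for m n
    proof (cases "coprime m q")
      case True
      then obtain l where l: "\<forall>n. v (m * n) = l * v n" using eig by blast
      then have "v (m * n) = l * v n" "v (m * 1) = l * v 1" by blast+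
      then show ?thesis using False by (simp add: chi_def)
    next
      case nc: False
      then have "\<not> coprime (m * n) q" by simp
      then show ?thesis using nc v0 by (simp add: chi_def)
    qed
    have pow: "chi (a ^ k) = chi a ^ k" for a k
      by (induction k) (use False in \<open>auto simp: mult\<close>, auto simp: chi_def)
    interpret residue_character q chi
    proof
      show "chi (n + q) = chi n" for n using v by (simp add: chi_def unit_weight_def)
      show "chi n \<noteq> 0 \<longleftrightarrow> coprime n q" for n
      proof
        assume cop: "coprime n q"
        then have "[n ^ totient q = 1] (mod q)" by (rule euler_theorem)
        then have "v (n ^ totient q) = v 1" by (rule unit_weight_cong[OF v])
        then have "chi (n ^ totient q) = 1" using False by (simp add: chi_def)
        then have "chi n ^ totient q = 1" by (simp only: pow)
        moreover have "totient q > 0" using q by simp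
        ultimately show "chi n \<noteq> 0" by (auto simp: zero_power)
      qed (use v0 in \<open>auto simp: chi_def\<close>)
    qed (use q mult in auto)
    have "sublinear (\<lambda>N. v 1 * (\<Sum>n=1..N. of_int (moebius_mu n) * chi n))"
      by (intro sublinear_cmult sublinear_sum_moebius_chi)
    also have "(\<lambda>N. v 1 * (\<Sum>n=1..N. of_int (moebius_mu n) * chi n)) = (\<lambda>N. \<Sum>n=1..N. of_int (moebius_mu n) * v n)"
      by (simp only: sum_distrib_left mult.left_commute[of "v 1"] v_chi[symmetric])
    finally show ?thesis .
  qed
qed

text \<open>The projection of v to the eigenspace of the translation v \<mapsto> v(a \<cdot>) with eigenvalue e(j/k), where
k is a period of this translation.\<close>

definition eigen_part :: "nat \<Rightarrow> nat \<Rightarrow> (nat \<Rightarrow> complex) \<Rightarrow> nat \<Rightarrow> nat \<Rightarrow> complex"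
  where "eigen_part k a v j n = (\<Sum>i<k. ec (- (real i * real j / real k)) * v (a ^ i * n)) / of_nat k"

text \<open>As a^k is 1 modulo q, shifting the summation index in the projection is cyclic, which gives the
eigenvalue; that the projections add up to v is the orthogonality of the additive characters.\<close>

lemma unit_weight_projection:
  fixes a :: nat
  assumes q: "q > 0" and v: "unit_weight q v" and a: "coprime a q" and k_def: "k = totient q"
  shows "unit_weight q (eigen_part k a v j)" "v n = (\<Sum>j<k. eigen_part k a v j n)"
    "eigen_part k a v j (a * n) = ec (real j / real k) * eigen_part k a v j n"
proof -
  define P where "P = eigen_part k a v"
  note P_def = P_def eigen_part_def
  have k: "k > 0" using q by (simp add: k_def)
  have vk: "v (a ^ k * n) = v n" for n
  proof -
    have "[a ^ k * n = 1 * n] (mod q)" unfolding k_def by (intro cong_mult euler_theorem a cong_refl)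
    then show ?thesis using unit_weight_cong[OF v] by simp
  qed
  have unit: "unit_weight q (P j)"
    unfolding unit_weight_def
  proof (intro conjI allI impI)
    fix n
    have "v (a ^ i * (n + q)) = v (a ^ i * n)" for i
      by (rule unit_weight_cong[OF v]) (simp add: cong_def distrib_left)
    then show "P j (n + q) = P j n" by (simp add: P_def)
    assume "\<not> coprime n q"
    then have "v (a ^ i * n) = 0" for i using v by (simp add: unit_weight_def)
    then show "P j n = 0" by (simp add: P_def)
  qed
  have total: "v n = (\<Sum>j<k. P j n)"
  proof -
    have "(\<Sum>j<k. P j n) = (\<Sum>i<k. (\<Sum>j<k. ec (of_int (- int i) * real j / real k)) * v (a ^ i * n)) / of_nat k"
      unfolding P_def sum_divide_distrib[symmetric] by (subst sum.swap) (simp add: sum_distrib_right)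
    also have "(\<Sum>i<k. (\<Sum>j<k. ec (of_int (- int i) * real j / real k)) * v (a ^ i * n)) = (\<Sum>i\<in>{0}. of_nat k * v (a ^ i * n))"
    proof (rule sum.mono_neutral_cong_right)
      show "\<forall>i\<in>{..<k} - {0}. (\<Sum>j<k. ec (of_int (- int i) * real j / real k)) * v (a ^ i * n) = 0"
      proof
        fix i assume "i \<in> {..<k} - {0}"
        then have "\<not> int k dvd - int i" by (auto dest: zdvd_imp_le)
        then show "(\<Sum>j<k. ec (of_int (- int i) * real j / real k)) * v (a ^ i * n) = 0"
          using sum_ec_div[OF k, of "- int i"] by simp
      qed
    next
      fix i :: nat assume "i \<in> {0}"
      then show "(\<Sum>j<k. ec (of_int (- int i) * real j / real k)) * v (a ^ i * n) = of_nat k * v (a ^ i * n)"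
        using sum_ec_div[OF k, of "- int i"] by simp
    qed (use k in auto)
    finally show ?thesis using k by simp
  qed
  have eigen: "P j (a * n) = ec (real j / real k) * P j n"
  proof -
    define h where "h = (\<lambda>i. ec (- (real i * real j / real k)) * v (a ^ i * n))"
    have "h k = v n"
    proof -
      have "ec (- (real k * real j / real k)) = 1" using k by (intro ec_Ints) simp
      then show ?thesis by (simp add: h_def vk)
    qed
    then have hk: "h k = h 0" by (simp add: h_def)
    have "ec (- (real i * real j / real k)) * v (a ^ i * (a * n)) = ec (real j / real k) * h (Suc i)" for i
    proof -
      have "- (real i * real j / real k) = real j / real k + - (real (Suc i) * real j / real k)"
        using k by (simp add: field_simps)
      then have "ec (- (real i * real j / real k)) = ec (real j / real k) * ec (- (real (Suc i) * real j / real k))"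
        by (simp only: ec_add)
      then show ?thesis by (simp add: h_def mult.assoc mult.left_commute)
    qed
    then have "P j (a * n) = (\<Sum>i<k. ec (real j / real k) * h (Suc i)) / of_nat k" by (simp only: P_def)
    also have "(\<Sum>i<k. ec (real j / real k) * h (Suc i)) = ec (real j / real k) * (\<Sum>i<k. h (Suc i))"
      by (simp only: sum_distrib_left)
    also have "(\<Sum>i<k. h (Suc i)) = (\<Sum>i<k. h i)"
      using sum.lessThan_Suc_shift[of h k] sum.lessThan_Suc[of h k] hk by simp
    finally show ?thesis by (simp add: P_def h_def)
  qed
  show "unit_weight q (eigen_part k a v j)" "v n = (\<Sum>j<k. eigen_part k a v j n)"
    "eigen_part k a v j (a * n) = ec (real j / real k) * eigen_part k a v j n"
    using unit total eigen by (simp_all only: P_def(1))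
qed

lemma eigen_part_eigen:
  assumes "\<And>n. v (b * n) = l * v n"
  shows "eigen_part k a v j (b * n) = l * eigen_part k a v j n"
proof -
  have "v (a ^ i * (b * n)) = l * v (a ^ i * n)" for i
    using assms[of "a ^ i * n"] by (simp add: mult.left_commute)
  then show ?thesis
    by (simp add: eigen_part_def sum_distrib_left mult.left_commute)
qed

text \<open>The translations by units commute and have finite order, so they can be diagonalised one after another:
the induction enlarges the set of units that already act by scalars. This yields the decomposition
into characters without the structure theory of finite abelian groups.\<close>

lemma sublinear_moebius_unit_weight:
  assumes q: "q > 0" and v: "unit_weight q v"
  shows "sublinear (\<lambda>N. \<Sum>n=1..N. of_int (moebius_mu n) * v n)"
proof -
  define U where "U = {a. a < q \<and> coprime a q}"
  have main: "sublinear (\<lambda>N. \<Sum>n=1..N. of_int (moebius_mu n) * v n)"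
    if "finite A" "A \<subseteq> U" "unit_weight q v" "\<And>a. a \<in> U - A \<Longrightarrow> \<exists>l. \<forall>n. v (a * n) = l * v n" for A v
    using that
  proof (induction A arbitrary: v rule: finite_induct)
    case empty
    show ?case
    proof (rule sublinear_moebius_eigenweight[OF q empty(2)])
      fix a assume a: "coprime a q"
      then have "a mod q \<in> U" using q by (simp add: U_def)
      then obtain l where l: "\<forall>n. v (a mod q * n) = l * v n" using empty(3) by auto
      have "v (a * n) = v (a mod q * n)" for n
        by (rule unit_weight_cong[OF empty(2)]) (simp add: cong_def mod_mult_left_eq)
      then show "\<exists>l. \<forall>n. v (a * n) = l * v n" using l by auto
    qed
  next
    case (insert a A)
    define k where "k = totient q"
    define P where "P = eigen_part k a v"
    have a: "coprime a q" using insert.prems(1) by (simp add: U_def)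
    note proj = unit_weight_projection[OF q insert.prems(2) a k_def, folded P_def]
    have "sublinear (\<lambda>N. \<Sum>n=1..N. of_int (moebius_mu n) * P j n)" for j
    proof (rule insert.IH)
      show "\<exists>l. \<forall>n. P j (b * n) = l * P j n" if "b \<in> U - A" for b
      proof (cases "b = a")
        case True
        then show ?thesis using proj(3) by blast
      next
        case False
        then have "b \<in> U - insert a A" using that by simp
        then obtain l where "\<forall>n. v (b * n) = l * v n" using insert.prems(3) by blast
        then show ?thesis using eigen_part_eigen[of v b l] unfolding P_def by blast
      qed
    qed (use insert.prems proj(1) in auto)
    then have "sublinear (\<lambda>N. \<Sum>j<k. \<Sum>n=1..N. of_int (moebius_mu n) * P j n)" by (intro sublinear_sum)
    also have "(\<lambda>N. \<Sum>j<k. \<Sum>n=1..N. of_int (moebius_mu n) * P j n) = (\<lambda>N. \<Sum>n=1..N. of_int (moebius_mu n) * v n)"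
      by (rule ext, subst sum.swap) (simp only: sum_distrib_left[symmetric] proj(2)[symmetric])
    finally show ?case .
  qed
  have "finite U" by (simp add: U_def)
  then show ?thesis using main[of U v] v by simp
qed

text \<open>The n with gcd(n, q) = d are written as n = dm. Since \<mu>(dm) = 0 unless d and m are coprime, only the m
coprime to q matter, and there \<mu>(dm) = \<mu>(d) \<mu>(m). This leaves weights supported on units.\<close>

theorem sublinear_moebius_periodic:
  fixes v :: "nat \<Rightarrow> complex"
  assumes q: "q > 0" and per: "\<And>n. v (n + q) = v n"
  shows "sublinear (\<lambda>N. \<Sum>n=1..N. of_int (moebius_mu n) * v n)"
proof -
  let ?f = "\<lambda>n. of_int (moebius_mu n) * v n"
  define w where "w = (\<lambda>d m. if coprime m q then v (d * m) else 0)"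
  have vmod: "v (n mod q) = v n" for n by (rule periodic_mod[of v, OF per])
  have w: "unit_weight q (w d)" for d
    unfolding unit_weight_def
  proof (intro conjI allI impI)
    fix n
    have "coprime (n + q) q \<longleftrightarrow> coprime n q" by (simp only: coprime_iff_gcd_eq_1 gcd_add1)
    moreover have "v (d * (n + q)) = v (d * n)"
      using vmod[of "d * (n + q)"] vmod[of "d * n"] by (simp add: distrib_left)
    ultimately show "w d (n + q) = w d n" by (simp add: w_def)
  qed (simp add: w_def)
  have class_sum: "(\<Sum>n | n \<in> {1..N} \<and> gcd n q = d. ?f n)
      = of_int (moebius_mu d) * (\<Sum>m=1..N div d. of_int (moebius_mu m) * w d m)" if d: "d dvd q" for d N
  proof -
    have "d > 0" using d q by (auto intro: Nat.gr0I)
    let ?S = "{m \<in> {1..N div d}. coprime m q}"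
    have inj: "inj_on ((*) d) ?S" using \<open>d > 0\<close> by (auto simp: inj_on_def)
    have "of_int (moebius_mu d) * (\<Sum>m=1..N div d. of_int (moebius_mu m) * w d m)
       = (\<Sum>m\<in>?S. of_int (moebius_mu d) * (of_int (moebius_mu m) * v (d * m)))"
      unfolding sum_distrib_left by (rule sum.mono_neutral_cong_right) (auto simp: w_def)
    also have "\<dots> = (\<Sum>m\<in>?S. ?f (d * m))"
    proof (rule sum.cong[OF refl])
      fix m assume "m \<in> ?S"
      then have "coprime d m" using d by (metis (no_types, lifting) coprime_commute coprime_divisors dvd_refl mem_Collect_eq)
      then show "of_int (moebius_mu d) * (of_int (moebius_mu m) * v (d * m)) = ?f (d * m)"
        by (simp add: moebius_mu_mult)
    qed
    also have "\<dots> = (\<Sum>n\<in>(*) d ` ?S. ?f n)" by (subst sum.reindex[OF inj]) simp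
    also have "\<dots> = (\<Sum>n | n \<in> {1..N} \<and> gcd n q = d. ?f n)"
    proof (rule sum.mono_neutral_left)
      show "(*) d ` ?S \<subseteq> {n. n \<in> {1..N} \<and> gcd n q = d}"
      proof clarify
        fix m assume m: "m \<in> {1..N div d}" "coprime m q"
        have "gcd (d * m) q = gcd d q" using m(2) gcd_mult_right_right_cancel[of q m d]
          by (simp add: gcd.commute[of _ q] coprime_commute[of q])
        also have "\<dots> = d" using d by (simp add: gcd_nat.absorb1)
        finally have "gcd (d * m) q = d" .
        moreover have "d * m \<le> N" using m(1) \<open>d > 0\<close> by (metis atLeastAtMost_iff div_times_less_eq_dividend dual_order.trans mult.commute mult_le_mono2)
        ultimately show "d * m \<in> {1..N} \<and> gcd (d * m) q = d" using m(1) \<open>d > 0\<close> by simp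
      qed
      show "\<forall>n\<in>{n. n \<in> {1..N} \<and> gcd n q = d} - (*) d ` ?S. ?f n = 0"
      proof
        fix n assume n: "n \<in> {n. n \<in> {1..N} \<and> gcd n q = d} - (*) d ` ?S"
        then have "d dvd n" by auto
        then obtain m where m: "n = d * m" by (elim dvdE)
        obtain e where e: "q = d * e" using d by (elim dvdE)
        have "m \<in> {1..N div d}"
          using n m \<open>d > 0\<close> by (auto simp: less_eq_div_iff_mult_less_eq mult.commute Suc_le_eq intro: Nat.gr0I)
        then have "\<not> coprime m q" using n m by blast
        moreover have "coprime m e"
        proof -
          have "d * gcd m e = d" using n m e by (simp add: gcd_mult_distrib_nat)
          then have "gcd m e = 1" using \<open>d > 0\<close> by simp
          then show ?thesis by (simp only: coprime_iff_gcd_eq_1)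
        qed
        ultimately have "\<not> coprime d m" using e by (auto simp: coprime_commute)
        then show "?f n = 0" by (simp add: m moebius_mu_mult)
      qed
    qed simp
    finally show ?thesis by simp
  qed
  have "(\<Sum>n=1..N. ?f n) = (\<Sum>d | d dvd q. of_int (moebius_mu d) * (\<Sum>m=1..N div d. of_int (moebius_mu m) * w d m))" for N
  proof -
    have "(\<Sum>n=1..N. ?f n) = (\<Sum>d | d dvd q. \<Sum>n | n \<in> {1..N} \<and> gcd n q = d. ?f n)"
      by (rule sum.group[symmetric]) (use q in auto)
    also have "\<dots> = (\<Sum>d | d dvd q. of_int (moebius_mu d) * (\<Sum>m=1..N div d. of_int (moebius_mu m) * w d m))"
      by (rule sum.cong) (use class_sum in auto)
    finally show ?thesis .
  qed
  moreover have "sublinear (\<lambda>N. \<Sum>d | d dvd q. of_int (moebius_mu d) * (\<Sum>m=1..N div d. of_int (moebius_mu m) * w d m))"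
    by (intro sublinear_sum sublinear_cmult sublinear_div[of "\<lambda>M. \<Sum>m=1..M. of_int (moebius_mu m) * w _ m"]
        sublinear_moebius_unit_weight[OF q w])
  ultimately show ?thesis by simp
qed

section \<open>Katai's criterion\<close>

lemma sum_multiples:
  fixes f :: "nat \<Rightarrow> 'a::comm_monoid_add"
  assumes "d > 0"
  shows "(\<Sum>n | n \<in> {1..N} \<and> d dvd n. f n) = (\<Sum>m=1..N div d. f (d * m))"
proof -
  have "{n. n \<in> {1..N} \<and> d dvd n} = (*) d ` {1..N div d}"
  proof (intro equalityI subsetI)
    fix n assume n: "n \<in> {n. n \<in> {1..N} \<and> d dvd n}"
    then have "d dvd n" by simp
    then obtain m where m: "n = d * m" by (elim dvdE)
    then have "m \<in> {1..N div d}"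
      using n assms by (auto simp: less_eq_div_iff_mult_less_eq mult.commute Suc_le_eq intro: Nat.gr0I)
    then show "n \<in> (*) d ` {1..N div d}" using m by blast
  next
    fix n assume "n \<in> (*) d ` {1..N div d}"
    then show "n \<in> {n. n \<in> {1..N} \<and> d dvd n}"
      using assms by (auto simp: less_eq_div_iff_mult_less_eq mult.commute Suc_le_eq)
  qed
  moreover have "inj_on ((*) d) {1..N div d}" using assms by (auto simp: inj_on_def)
  ultimately show ?thesis by (simp add: sum.reindex)
qed

lemma card_multiples: "d > 0 \<Longrightarrow> card {n. n \<in> {1..N} \<and> d dvd n} = N div d"
  using sum_multiples[of d "\<lambda>_. 1::nat" N] by simp

lemma real_div_le: "real (N div d) \<le> real N / real d"
proof (cases "d = 0")
  case False
  have "real (N div d * d) \<le> real N" by (simp only: of_nat_le_iff div_times_less_eq_dividend)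
  then show ?thesis using False by (simp add: pos_le_divide_eq)
qed simp

lemma real_div_ge: "d > 0 \<Longrightarrow> real N / real d - 1 \<le> real (N div d)"
proof -
  assume d: "d > 0"
  have "real N \<le> real (d + N div d * d)"
    using dividend_less_div_times[OF d, of N] by (simp only: of_nat_le_iff)
  then show ?thesis using d by (simp add: field_simps)
qed

lemma squarefree_eq_prod_prime_factors:
  fixes n :: nat
  assumes "squarefree n"
  shows "n = \<Prod>(prime_factors n)"
proof -
  have n: "n > 0" using assms by (cases "n = 0") auto
  have "n = (\<Prod>p\<in>prime_factors n. p ^ multiplicity p n)" using n by (rule prime_factorization_nat)
  also have "\<dots> = \<Prod>(prime_factors n)"
  proof (rule prod.cong[OF refl])
    fix p assume p: "p \<in> prime_factors n"
    have "multiplicity p n \<le> 1" using assms n p by (auto simp: squarefree_factorial_semiring'')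
    moreover have "multiplicity p n > 0" using p by (simp add: prime_factors_multiplicity)
    ultimately show "p ^ multiplicity p n = p" by (simp add: le_Suc_eq)
  qed
  finally show ?thesis .
qed

text \<open>An integer is determined by its squarefree part, that is a set of primes in P, and the largest
square dividing it.\<close>

lemma card_smooth_le:
  fixes P :: "nat set"
  assumes P: "finite P"
  shows "card {n \<in> {1..M\<^sup>2}. prime_factors n \<subseteq> P} \<le> 2 ^ card P * M"
proof -
  let ?S = "{n \<in> {1..M\<^sup>2}. prime_factors n \<subseteq> P}"
  let ?h = "\<lambda>n::nat. (prime_factors (squarefree_part n), square_part n)"
  have "card ?S \<le> card (Pow P \<times> {1..M})"
  proof (rule card_inj_on_le)
    show "inj_on ?h ?S"
    proof (rule inj_onI)
      fix m n assume eq: "?h m = ?h n"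
      then have pf: "prime_factors (squarefree_part m) = prime_factors (squarefree_part n)"
        and sq: "square_part m = square_part n" by auto
      have "squarefree_part m = \<Prod>(prime_factors (squarefree_part m))"
        by (rule squarefree_eq_prod_prime_factors) simp
      also have "\<dots> = squarefree_part n"
        unfolding pf by (rule squarefree_eq_prod_prime_factors[symmetric]) simp
      finally show "m = n" by (rule squarefree_decomposition_unique[OF sq])
    qed
    show "?h ` ?S \<subseteq> Pow P \<times> {1..M}"
    proof
      fix x assume "x \<in> ?h ` ?S"
      then obtain n where n: "n \<in> {1..M\<^sup>2}" "prime_factors n \<subseteq> P" "x = ?h n" by auto
      have "squarefree_part n dvd n" using squarefree_decompose[of n] by (metis dvd_triv_left)
      then have "prime_factors (squarefree_part n) \<subseteq> P" using n dvd_prime_factors[of n "squarefree_part n"] by force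
      moreover have "square_part n \<le> M"
      proof -
        have "(square_part n)\<^sup>2 \<le> n" using n(1) by (intro dvd_imp_le square_part_square_dvd) auto
        moreover have "n \<le> M\<^sup>2" using n(1) by simp
        ultimately have "(square_part n)\<^sup>2 \<le> M\<^sup>2" by (rule order.trans)
        then show ?thesis by (rule power2_le_imp_le) simp
      qed
      moreover have "square_part n \<ge> 1" using n(1) by (cases "square_part n") auto
      ultimately show "x \<in> Pow P \<times> {1..M}" using n(3) by simp
    qed
  qed (use P in auto)
  then show ?thesis using P by (simp add: card_cartesian_product card_Pow)
qed

text \<open>Erdos' proof. Otherwise the primes outside some finite set P0 have reciprocals adding up to less than
1/2. For M = 2^(card P0 + 2) fewer than half of the integers up to M^2 are divisible by another
prime, and at most a quarter of them have all their prime factors in P0.\<close>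

lemma prime_reciprocals_unbounded:
  fixes X :: real
  obtains P :: "nat set" where "finite P" "\<And>p. p \<in> P \<Longrightarrow> prime p" "(\<Sum>p\<in>P. 1 / real p) \<ge> X"
proof (rule ccontr)
  assume not: "\<not> thesis"
  note unbounded = that
  have bd: "(\<Sum>p\<in>P. 1 / real p) < X" if "finite P" "\<And>p. p \<in> P \<Longrightarrow> prime p" for P :: "nat set"
    using unbounded[OF that] not by (meson not_less)
  define T where "T = (\<lambda>P. \<Sum>p\<in>P. 1 / real p) ` {P. finite P \<and> (\<forall>p\<in>P. prime (p::nat))}"
  have bdd: "bdd_above T" unfolding T_def using bd by (intro bdd_aboveI2[of _ _ X]) (auto intro: less_imp_le)
  have ne: "T \<noteq> {}" unfolding T_def by auto
  have "Sup T - 1 / 2 < Sup T" by simp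
  then obtain y where y: "y \<in> T" "Sup T - 1 / 2 < y" using less_cSup_iff[OF ne bdd] by blast
  then obtain P0 where P0: "finite P0" "\<And>p. p \<in> P0 \<Longrightarrow> prime p" "Sup T - 1 / 2 < (\<Sum>p\<in>P0. 1 / real p)"
    unfolding T_def by auto
  \<comment> \<open>Chosen such that 2 ^ card P0 * M is a quarter of M^2.\<close>
  define M :: nat where "M = 2 ^ (card P0 + 2)"
  define Q where "Q = {p. prime p \<and> p \<le> M\<^sup>2 \<and> p \<notin> P0}"
  have Q: "finite Q" unfolding Q_def by (rule finite_subset[of _ "{..M\<^sup>2}"]) auto
  have "(\<Sum>p\<in>P0 \<union> Q. 1 / real p) \<le> Sup T"
    by (rule cSup_upper[OF _ bdd]) (use P0 Q in \<open>auto simp: T_def Q_def\<close>)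
  moreover have "(\<Sum>p\<in>P0 \<union> Q. 1 / real p) = (\<Sum>p\<in>P0. 1 / real p) + (\<Sum>p\<in>Q. 1 / real p)"
    using P0 Q by (intro sum.union_disjoint) (auto simp: Q_def)
  ultimately have half: "(\<Sum>p\<in>Q. 1 / real p) < 1 / 2" using P0(3) by linarith
  let ?good = "{n \<in> {1..M\<^sup>2}. prime_factors n \<subseteq> P0}"
  have "{1..M\<^sup>2} \<subseteq> ?good \<union> (\<Union>p\<in>Q. {n. n \<in> {1..M\<^sup>2} \<and> p dvd n})"
  proof
    fix n assume n: "n \<in> {1..M\<^sup>2}"
    show "n \<in> ?good \<union> (\<Union>p\<in>Q. {n. n \<in> {1..M\<^sup>2} \<and> p dvd n})"
    proof (cases "prime_factors n \<subseteq> P0")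
      case False
      then obtain p where p: "p \<in> prime_factors n" "p \<notin> P0" by blast
      then have "prime p" "p dvd n" by auto
      moreover have "p \<le> n" using \<open>p dvd n\<close> n by (intro dvd_imp_le) auto
      ultimately show ?thesis using n p by (auto simp: Q_def)
    qed (use n in simp)
  qed
  then have "card {1..M\<^sup>2} \<le> card (?good \<union> (\<Union>p\<in>Q. {n. n \<in> {1..M\<^sup>2} \<and> p dvd n}))"
    using Q by (intro card_mono) auto
  also have "\<dots> \<le> card ?good + card (\<Union>p\<in>Q. {n. n \<in> {1..M\<^sup>2} \<and> p dvd n})" by (rule card_Un_le)
  also have "card (\<Union>p\<in>Q. {n. n \<in> {1..M\<^sup>2} \<and> p dvd n}) \<le> (\<Sum>p\<in>Q. card {n. n \<in> {1..M\<^sup>2} \<and> p dvd n})"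
    by (rule card_UN_le[OF Q])
  also have "\<dots> = (\<Sum>p\<in>Q. M\<^sup>2 div p)"
    by (intro sum.cong card_multiples) (auto simp: Q_def prime_gt_0_nat)
  finally have "M\<^sup>2 \<le> card ?good + (\<Sum>p\<in>Q. M\<^sup>2 div p)" by simp
  then have "real (M\<^sup>2) \<le> real (card ?good) + real (\<Sum>p\<in>Q. M\<^sup>2 div p)" by linarith
  also have "real (\<Sum>p\<in>Q. M\<^sup>2 div p) \<le> (\<Sum>p\<in>Q. real (M\<^sup>2) / real p)"
    unfolding of_nat_sum by (intro sum_mono real_div_le)
  also have "\<dots> = real (M\<^sup>2) * (\<Sum>p\<in>Q. 1 / real p)" by (simp add: sum_distrib_left)
  also have "\<dots> \<le> real (M\<^sup>2) * (1 / 2)" using half by (intro mult_left_mono) auto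
  also have "real (card ?good) \<le> real (2 ^ card P0 * M)"
    using card_smooth_le[OF P0(1), of M] by (simp only: of_nat_le_iff)
  also have "real (2 ^ card P0 * M) = real (M\<^sup>2) / 4" by (simp add: M_def power2_eq_square power_add)
  finally have "real (M\<^sup>2) \<le> real (M\<^sup>2) / 4 + real (M\<^sup>2) * (1 / 2)" by simp
  moreover have "real (M\<^sup>2) > 0" by (simp add: M_def)
  ultimately show False by linarith
qed

lemma sum_prime_reciprocal_squares_le:
  assumes "finite P" "\<And>p. p \<in> P \<Longrightarrow> prime (p::nat)"
  shows "(\<Sum>p\<in>P. 1 / (real p)\<^sup>2) \<le> 1"
proof -
  define M where "M = Max (insert 2 P)"
  have "P \<subseteq> {2..M}"
    using assms by (auto simp: M_def prime_ge_2_nat intro!: Max_ge)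
  then have "(\<Sum>p\<in>P. 1 / (real p)\<^sup>2) \<le> (\<Sum>n=2..M. 1 / (real n)\<^sup>2)"
    by (intro sum_mono2) auto
  also have "\<dots> \<le> 1 - 1 / real (max 1 M)"
  proof (induction M)
    case (Suc M)
    show ?case
    proof (cases "M = 0")
      case False
      have "1 / (real (Suc M))\<^sup>2 \<le> 1 / real M - 1 / real (Suc M)"
      proof -
        have "1 / (real (Suc M))\<^sup>2 \<le> 1 / (real M * real (Suc M))"
          unfolding power2_eq_square using False by (intro divide_left_mono mult_right_mono) auto
        also have "\<dots> = 1 / real M - 1 / real (Suc M)" using False by (simp add: field_simps)
        finally show ?thesis .
      qed
      then show ?thesis using Suc False by (simp add: max_def)
    qed simp
  qed simp
  finally show ?thesis by (simp add: order.trans)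
qed

text \<open>The number of prime divisors in P has mean about A and variance at most about A. The inequality
comes from expanding the square and counting the common multiples of two primes.\<close>

lemma turan_kubilius:
  fixes P :: "nat set"
  assumes P: "finite P" "\<And>p. p \<in> P \<Longrightarrow> prime p"
  defines "A \<equiv> \<Sum>p\<in>P. 1 / real p"
  shows "(\<Sum>n=1..N. ((\<Sum>p\<in>P. of_bool (p dvd n)) - A)\<^sup>2) \<le> A * real N + 2 * A * real (card P)"
proof -
  define w where "w = (\<lambda>n. \<Sum>p\<in>P. of_bool (p dvd n) :: real)"
  have A: "A \<ge> 0" unfolding A_def by (intro sum_nonneg) auto
  have count: "(\<Sum>n=1..N. of_bool (d dvd n)) = real (N div d)" if "d > 0" for d
    using card_multiples[OF that, of N] by (simp add: Int_def)
  have w1: "(\<Sum>n=1..N. w n) \<ge> A * real N - real (card P)"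
  proof -
    have "(\<Sum>n=1..N. w n) = (\<Sum>p\<in>P. real (N div p))"
      unfolding w_def by (subst sum.swap) (intro sum.cong refl count, use P prime_gt_0_nat in auto)
    also have "\<dots> \<ge> (\<Sum>p\<in>P. real N / real p - 1)"
      by (intro sum_mono real_div_ge) (use P prime_gt_0_nat in auto)
    also have "(\<Sum>p\<in>P. real N / real p - 1) = A * real N - real (card P)"
      by (simp add: A_def sum_subtractf sum_distrib_right)
    finally show ?thesis by simp
  qed
  have w2: "(\<Sum>n=1..N. (w n)\<^sup>2) \<le> A\<^sup>2 * real N + A * real N"
  proof -
    have "(\<Sum>n=1..N. (w n)\<^sup>2) = (\<Sum>p\<in>P. \<Sum>r\<in>P. \<Sum>n=1..N. of_bool (p dvd n) * of_bool (r dvd n))"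
      unfolding w_def power2_eq_square sum_product
      by (subst sum.swap) (rule sum.cong[OF refl], rule sum.swap)
    also have "\<dots> \<le> (\<Sum>p\<in>P. \<Sum>r\<in>P. real N * (1 / real p * (1 / real r)) + (if p = r then real N * (1 / real p) else 0))"
    proof (intro sum_mono)
      fix p r assume pr: "p \<in> P" "r \<in> P"
      then have pos: "p > 0" "r > 0" using P prime_gt_0_nat by auto
      show "(\<Sum>n=1..N. of_bool (p dvd n) * of_bool (r dvd n)) \<le> real N * (1 / real p * (1 / real r)) + (if p = r then real N * (1 / real p) else 0)"
      proof (cases "p = r")
        case True
        have "(\<Sum>n=1..N. of_bool (p dvd n) * of_bool (r dvd n)) = real (N div p)"
          using count[OF pos(1)] True by (simp flip: of_bool_conj)
        also have "\<dots> \<le> real N * (1 / real p)" using real_div_le[of N p] by simp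
        finally show ?thesis using True by (simp add: add_increasing)
      next
        case False
        have "coprime p r" using pr P False by (intro primes_coprime) auto
        then have "(p dvd n \<and> r dvd n) \<longleftrightarrow> p * r dvd n" for n
          using divides_mult by (metis dvd_mult_left dvd_mult_right)
        then have "(\<Sum>n=1..N. of_bool (p dvd n) * of_bool (r dvd n)) = real (N div (p * r))"
          using count[of "p * r"] pos by (simp flip: of_bool_conj)
        also have "\<dots> \<le> real N * (1 / real p * (1 / real r))" using real_div_le[of N "p * r"] by simp
        finally show ?thesis using False by simp
      qed
    qed
    also have "\<dots> = A\<^sup>2 * real N + A * real N"
      using P(1) by (simp add: sum.distrib A_def power2_eq_square sum_product sum_distrib_left sum_distrib_right mult_ac)
    finally show ?thesis .
  qed
  have "(\<Sum>n=1..N. (w n - A)\<^sup>2) = (\<Sum>n=1..N. (w n)\<^sup>2) - 2 * A * (\<Sum>n=1..N. w n) + A\<^sup>2 * real N"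
    by (simp add: power2_diff sum.distrib sum_subtractf sum_distrib_left mult_ac)
  also have "\<dots> \<le> (A\<^sup>2 * real N + A * real N) - 2 * A * (A * real N - real (card P)) + A\<^sup>2 * real N"
    using w1 w2 A by (intro add_mono diff_mono mult_left_mono) auto
  also have "\<dots> = A * real N + 2 * A * real (card P)" by (simp add: algebra_simps power2_eq_square)
  finally show ?thesis unfolding w_def .
qed

text \<open>Replaces the Cauchy-Schwarz inequality: it bounds sums of absolute values by sums of squares without
square roots, with a free parameter d.\<close>

lemma abs_le_square_plus:
  fixes x d :: real
  assumes "d > 0"
  shows "\<bar>x\<bar> \<le> d * x\<^sup>2 + 1 / (4 * d)"
proof -
  have "0 \<le> (2 * d * \<bar>x\<bar> - 1)\<^sup>2" by simp
  also have "\<dots> = 4 * d * (d * x\<^sup>2 + 1 / (4 * d) - \<bar>x\<bar>)"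
    using assms by (simp add: field_simps power2_eq_square)
  finally show ?thesis using assms by (simp add: zero_le_mult_iff)
qed

text \<open>Expanding the square gives the correlations of F(pm) and F(rm). The diagonal p = r contributes at most
N/p each; the finitely many others are o(N) by hypothesis.\<close>

lemma sum_sieve_square_le:
  fixes F :: "nat \<Rightarrow> complex"
  assumes P: "finite P" "\<And>p. p \<in> P \<Longrightarrow> prime p" and F: "\<And>n. norm (F n) \<le> 1"
    and corr: "\<And>p r. p \<in> P \<Longrightarrow> r \<in> P \<Longrightarrow> p \<noteq> r \<Longrightarrow> sublinear (\<lambda>M. \<Sum>m=1..M. F (p * m) * cnj (F (r * m)))"
    and h: "h > 0"
  obtains C where "\<And>N. (\<Sum>m=1..N. (norm (\<Sum>p\<in>P. if p * m \<le> N then F (p * m) else 0))\<^sup>2)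
    \<le> ((\<Sum>p\<in>P. 1 / real p) + h) * real N + C"
proof -
  \<comment> \<open>The error h is distributed over the pairs of primes; adding 1 avoids division by 0.\<close>
  define K where "K = (real (card P))\<^sup>2 + 1"
  have K: "K > 0" by (simp add: K_def add_nonneg_pos)
  let ?c = "\<lambda>p r M. \<Sum>m=1..M. F (p * m) * cnj (F (r * m))"
  have "\<exists>C\<ge>0. \<forall>M. norm (?c p r M) \<le> (if p = r then real M else C + h / K * real M)" if pr: "p \<in> P" "r \<in> P" for p r
  proof (cases "p = r")
    case True
    have "norm (?c p r M) \<le> (\<Sum>m=1..M. 1)" for M
      using True F by (intro sum_norm_le) (auto simp: norm_mult mult_le_one)
    then show ?thesis using True by (intro exI[of _ 0]) simp
  next
    case False
    have "h / K > 0" using h K by simp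
    then obtain C where C: "\<And>M. norm (?c p r M) \<le> C + h / K * real M"
      using corr[OF pr False] unfolding sublinear_def by blast
    have "C \<ge> 0" using C[of 0] by simp
    then show ?thesis using False C by auto
  qed
  then obtain C where C: "\<And>p r. p \<in> P \<Longrightarrow> r \<in> P \<Longrightarrow> C p r \<ge> 0"
      "\<And>p r M. p \<in> P \<Longrightarrow> r \<in> P \<Longrightarrow> norm (?c p r M) \<le> (if p = r then real M else C p r + h / K * real M)"
    by metis
  show ?thesis
  proof
    fix N
    define G where "G = (\<lambda>m. \<Sum>p\<in>P. if p * m \<le> N then F (p * m) else 0)"
    define M where "M = (\<lambda>p r. min (N div p) (N div r))"
    have "complex_of_real (\<Sum>m=1..N. (norm (G m))\<^sup>2) = (\<Sum>m=1..N. G m * cnj (G m))"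
      by (simp add: complex_norm_square del: of_real_power)
    also have "\<dots> = (\<Sum>m=1..N. \<Sum>p\<in>P. \<Sum>r\<in>P. (if p * m \<le> N then F (p * m) else 0) * cnj (if r * m \<le> N then F (r * m) else 0))"
      by (simp only: G_def cnj_sum sum_product)
    also have "\<dots> = (\<Sum>p\<in>P. \<Sum>r\<in>P. \<Sum>m=1..N. (if p * m \<le> N then F (p * m) else 0) * cnj (if r * m \<le> N then F (r * m) else 0))"
      by (subst sum.swap) (rule sum.cong[OF refl], rule sum.swap)
    also have "\<dots> = (\<Sum>p\<in>P. \<Sum>r\<in>P. ?c p r (M p r))"
    proof (rule sum.cong[OF refl], rule sum.cong[OF refl])
      fix p r assume "p \<in> P" "r \<in> P"
      then have pos: "p > 0" "r > 0" using P prime_gt_0_nat by auto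
      have iff: "p * m \<le> N \<and> r * m \<le> N \<longleftrightarrow> m \<le> M p r" for m
        using pos by (simp add: M_def less_eq_div_iff_mult_less_eq mult.commute)
      have "M p r \<le> N" by (simp add: M_def min.coboundedI1)
      then have sub: "{1..M p r} \<subseteq> {1..N}" by simp
      show "(\<Sum>m=1..N. (if p * m \<le> N then F (p * m) else 0) * cnj (if r * m \<le> N then F (r * m) else 0)) = ?c p r (M p r)"
      proof (intro sum.mono_neutral_cong_right ballI)
        fix m assume "m \<in> {1..N} - {1..M p r}"
        then have "\<not> (p * m \<le> N \<and> r * m \<le> N)" unfolding iff by auto
        then show "(if p * m \<le> N then F (p * m) else 0) * cnj (if r * m \<le> N then F (r * m) else 0) = 0" by auto
      next
        fix m assume "m \<in> {1..M p r}"
        then have "p * m \<le> N \<and> r * m \<le> N" unfolding iff by auto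
        then show "(if p * m \<le> N then F (p * m) else 0) * cnj (if r * m \<le> N then F (r * m) else 0) = F (p * m) * cnj (F (r * m))"
          by simp
      qed (use sub in auto)
    qed
    finally have "complex_of_real (\<Sum>m=1..N. (norm (G m))\<^sup>2) = (\<Sum>p\<in>P. \<Sum>r\<in>P. ?c p r (M p r))" .
    then have "(\<Sum>m=1..N. (norm (G m))\<^sup>2) \<le> norm (\<Sum>p\<in>P. \<Sum>r\<in>P. ?c p r (M p r))"
      by (metis abs_ge_self norm_of_real)
    also have "\<dots> \<le> (\<Sum>p\<in>P. \<Sum>r\<in>P. (if p = r then real N * (1 / real p) else 0) + (C p r + h / K * real N))"
    proof (intro sum_norm_le)
      fix p r assume pr: "p \<in> P" "r \<in> P"
      have "norm (?c p r (M p r)) \<le> (if p = r then real (M p r) else C p r + h / K * real (M p r))" by (rule C(2)[OF pr])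
      also have "\<dots> \<le> (if p = r then real N * (1 / real p) else 0) + (C p r + h / K * real N)"
      proof -
        have "real (M p r) \<le> real N" by (simp add: M_def min.coboundedI1)
        then have "h / K * real (M p r) \<le> h / K * real N" using h K by (intro mult_left_mono) auto
        moreover have "real (M p r) \<le> real N * (1 / real p)" if "p = r" using that real_div_le[of N p] by (simp add: M_def)
        moreover have "h / K * real N \<ge> 0" using h K by simp
        ultimately show ?thesis using C(1)[OF pr] by auto
      qed
      finally show "norm (?c p r (M p r)) \<le> (if p = r then real N * (1 / real p) else 0) + (C p r + h / K * real N)" .
    qed
    also have "\<dots> = real N * (\<Sum>p\<in>P. 1 / real p) + (\<Sum>p\<in>P. \<Sum>r\<in>P. C p r) + (h * ((real (card P))\<^sup>2 / K)) * real N"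
      using P(1) by (simp add: sum.distrib sum_distrib_left power2_eq_square)
    also have "(h * ((real (card P))\<^sup>2 / K)) * real N \<le> (h * 1) * real N"
      using h K by (intro mult_right_mono mult_left_mono) (auto simp: K_def)
    finally show "(\<Sum>m=1..N. (norm (\<Sum>p\<in>P. if p * m \<le> N then F (p * m) else 0))\<^sup>2)
        \<le> ((\<Sum>p\<in>P. 1 / real p) + h) * real N + (\<Sum>p\<in>P. \<Sum>r\<in>P. C p r)"
      unfolding G_def by (simp add: algebra_simps)
  qed
qed

text \<open>\<mu>(pm) = -\<mu>(m) unless p divides m.\<close>

lemma moebius_prime_mult_bound:
  assumes "prime p"
  shows "\<bar>moebius_mu (p * m) + moebius_mu m\<bar> \<le> of_bool (p dvd m)"
proof (cases "p dvd m")
  case True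
  then have "\<not> coprime p m" using assms by (metis coprime_absorb_left not_prime_unit)
  then show ?thesis using True abs_moebius_mu_le[of m] by (simp add: moebius_mu_mult)
next
  case False
  then have "coprime p m" using assms by (simp add: prime_imp_coprime)
  moreover have "moebius_mu p = -1"
    using assms by (simp add: moebius_mu_def squarefree_prime prime_prime_factors)
  ultimately show ?thesis using False by (simp add: moebius_mu_mult)
qed

text \<open>Let w(n) be the number of primes in P that divide n and A the sum of their reciprocals. As w is close to
A on average, A \<Sum> \<mu>(n) F(n) is nearly \<Sum> w(n) \<mu>(n) F(n) = \<Sum> \<mu>(pm) F(pm), and hence, up to sign, nearly
\<Sum> \<mu>(m) G(m) with G(m) the sum of F(pm) over the p in P with pm \<le> N. The mean square of G is O(A) by
the hypothesis on correlations. So the whole is O(N sqrt A), and division by A, which can be made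
arbitrarily large, gives the claim.\<close>

theorem katai_criterion_moebius:
  fixes F :: "nat \<Rightarrow> complex"
  assumes F: "\<And>n. norm (F n) \<le> 1"
    and corr: "\<And>p r. prime p \<Longrightarrow> prime r \<Longrightarrow> p \<noteq> r \<Longrightarrow> sublinear (\<lambda>M. \<Sum>m=1..M. F (p * m) * cnj (F (r * m)))"
  shows "sublinear (\<lambda>N. \<Sum>n=1..N. of_int (moebius_mu n) * F n)"
proof (rule sublinearI)
  fix e :: real assume e: "e > 0"
  obtain P where P: "finite P" "\<And>p. p \<in> P \<Longrightarrow> prime p" and big: "(\<Sum>p\<in>P. 1 / real p) \<ge> 1 + 27 / (2 * e\<^sup>2) + 3 / e"
    by (rule prime_reciprocals_unbounded[of "1 + 27 / (2 * e\<^sup>2) + 3 / e"]) blast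
  define A where "A = (\<Sum>p\<in>P. 1 / real p)"
  have "27 / (2 * e\<^sup>2) \<ge> 0" "3 / e \<ge> 0" using e by auto
  then have A: "A > 0" "A \<ge> 27 / (2 * e\<^sup>2)" "A \<ge> 3 / e" using big unfolding A_def by linarith+
  \<comment> \<open>With this d each of the three contributions 3d, 1 / (2dA) and 1 / A is at most e / 3.\<close>
  define d where "d = e / 9"
  have d: "d > 0" using e by (simp add: d_def)
  have corrP: "sublinear (\<lambda>M. \<Sum>m=1..M. F (p * m) * cnj (F (r * m)))" if "p \<in> P" "r \<in> P" "p \<noteq> r" for p r
    using that P corr by blast
  obtain C where C: "\<And>N. (\<Sum>m=1..N. (norm (\<Sum>p\<in>P. if p * m \<le> N then F (p * m) else 0))\<^sup>2) \<le> (A + A) * real N + C"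
    using sum_sieve_square_le[OF P F corrP A(1)] unfolding A_def by blast
  define C' where "C' = d * (2 * A * real (card P)) + d * C"
  have main: "A * norm (\<Sum>n=1..N. of_int (moebius_mu n) * F n) \<le> (3 * d * A + 1 / (2 * d) + 1) * real N + C'" for N
  proof -
    define mu where "mu = (\<lambda>n. of_int (moebius_mu n) :: complex)"
    have mu: "norm (mu n) \<le> 1" for n unfolding mu_def by (rule norm_moebius_mu_le)
    define w where "w = (\<lambda>n. \<Sum>p\<in>P. of_bool (p dvd n) :: real)"
    define G where "G = (\<lambda>m. \<Sum>p\<in>P. if p * m \<le> N then F (p * m) else 0)"
    have pos: "p > 0" if "p \<in> P" for p using that P prime_gt_0_nat by blast
    have bound1: "norm (\<Sum>n=1..N. of_real (A - w n) * (mu n * F n)) \<le> d * (A * real N + 2 * A * real (card P)) + real N / (4 * d)"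
    proof -
      have "norm (\<Sum>n=1..N. of_real (A - w n) * (mu n * F n)) \<le> (\<Sum>n=1..N. d * (w n - A)\<^sup>2 + 1 / (4 * d))"
      proof (rule sum_norm_le)
        fix n
        have "norm (of_real (A - w n) * (mu n * F n)) = \<bar>w n - A\<bar> * norm (mu n * F n)"
          by (simp only: norm_mult norm_of_real abs_minus_commute)
        also have "\<dots> \<le> \<bar>w n - A\<bar> * 1"
          using mu[of n] F[of n] by (intro mult_left_mono) (auto simp: norm_mult mult_le_one)
        also have "\<dots> \<le> d * (w n - A)\<^sup>2 + 1 / (4 * d)" using abs_le_square_plus[OF d] by simp
        finally show "norm (of_real (A - w n) * (mu n * F n)) \<le> d * (w n - A)\<^sup>2 + 1 / (4 * d)" .
      qed
      also have "\<dots> = d * (\<Sum>n=1..N. (w n - A)\<^sup>2) + real N / (4 * d)" by (simp add: sum.distrib sum_distrib_left)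
      also have "(\<Sum>n=1..N. (w n - A)\<^sup>2) \<le> A * real N + 2 * A * real (card P)"
        unfolding w_def A_def by (rule turan_kubilius[OF P])
      finally show ?thesis using d by (simp add: mult_left_mono)
    qed
    have split: "(\<Sum>n=1..N. of_real (w n) * (mu n * F n))
       = (\<Sum>p\<in>P. \<Sum>m=1..N div p. (mu (p * m) + mu m) * F (p * m)) - (\<Sum>m=1..N. mu m * G m)"
    proof -
      have "(\<Sum>n=1..N. of_real (w n) * (mu n * F n)) = (\<Sum>p\<in>P. \<Sum>n=1..N. of_bool (p dvd n) * (mu n * F n))"
      proof -
        have "complex_of_real (of_bool b) = of_bool b" for b by (cases b) auto
        then show ?thesis by (subst sum.swap) (simp add: w_def sum_distrib_right)
      qed
      also have "\<dots> = (\<Sum>p\<in>P. \<Sum>m=1..N div p. mu (p * m) * F (p * m))"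
      proof (rule sum.cong[OF refl])
        fix p assume "p \<in> P"
        have "(\<Sum>n=1..N. of_bool (p dvd n) * (mu n * F n)) = (\<Sum>n | n \<in> {1..N} \<and> p dvd n. mu n * F n)"
          by (rule sum.mono_neutral_cong_right) auto
        then show "(\<Sum>n=1..N. of_bool (p dvd n) * (mu n * F n)) = (\<Sum>m=1..N div p. mu (p * m) * F (p * m))"
          by (simp only: sum_multiples[OF pos[OF \<open>p \<in> P\<close>]])
      qed
      also have "\<dots> = (\<Sum>p\<in>P. \<Sum>m=1..N div p. (mu (p * m) + mu m) * F (p * m)) - (\<Sum>p\<in>P. \<Sum>m=1..N div p. mu m * F (p * m))"
        by (simp add: sum_subtractf[symmetric] distrib_right)
      also have "(\<Sum>p\<in>P. \<Sum>m=1..N div p. mu m * F (p * m)) = (\<Sum>p\<in>P. \<Sum>m=1..N. mu m * (if p * m \<le> N then F (p * m) else 0))"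
      proof (rule sum.cong[OF refl])
        fix p assume "p \<in> P"
        have iff: "m \<le> N div p \<longleftrightarrow> p * m \<le> N" for m
          using pos[OF \<open>p \<in> P\<close>] by (simp add: less_eq_div_iff_mult_less_eq mult.commute)
        show "(\<Sum>m=1..N div p. mu m * F (p * m)) = (\<Sum>m=1..N. mu m * (if p * m \<le> N then F (p * m) else 0))"
        proof (rule sum.mono_neutral_cong_left)
          have "N div p \<le> N" by simp
          then show "{1..N div p} \<subseteq> {1..N}" by simp
          show "\<forall>m\<in>{1..N} - {1..N div p}. mu m * (if p * m \<le> N then F (p * m) else 0) = 0"
            by (auto simp: iff[symmetric])
          show "mu m * F (p * m) = mu m * (if p * m \<le> N then F (p * m) else 0)" if "m \<in> {1..N div p}" for m
            using that by (auto simp: iff)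
        qed simp
      qed
      also have "\<dots> = (\<Sum>m=1..N. mu m * G m)" by (subst sum.swap) (simp add: G_def sum_distrib_left)
      finally show ?thesis .
    qed
    have bound2: "norm (\<Sum>p\<in>P. \<Sum>m=1..N div p. (mu (p * m) + mu m) * F (p * m)) \<le> real N"
    proof -
      have "norm (\<Sum>p\<in>P. \<Sum>m=1..N div p. (mu (p * m) + mu m) * F (p * m)) \<le> (\<Sum>p\<in>P. real N * (1 / (real p)\<^sup>2))"
      proof (rule sum_norm_le)
        fix p assume p: "p \<in> P"
        have "norm (\<Sum>m=1..N div p. (mu (p * m) + mu m) * F (p * m)) \<le> (\<Sum>m=1..N div p. of_bool (p dvd m))"
        proof (rule sum_norm_le)
          fix m
          have "real_of_int \<bar>moebius_mu (p * m) + moebius_mu m\<bar> \<le> of_int (of_bool (p dvd m))"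
            using moebius_prime_mult_bound[OF P(2)[OF p], of m] by (simp only: of_int_le_iff)
          then have "norm (mu (p * m) + mu m) \<le> of_bool (p dvd m)"
            unfolding mu_def of_int_add[symmetric] norm_of_int by simp
          then show "norm ((mu (p * m) + mu m) * F (p * m)) \<le> of_bool (p dvd m)"
            using F[of "p * m"] mult_mono[of "norm (mu (p * m) + mu m)" "of_bool (p dvd m)" "norm (F (p * m))" 1]
            by (simp add: norm_mult)
        qed
        also have "\<dots> = real (N div p div p)"
          using card_multiples[OF pos[OF p], of "N div p"] by (simp add: Int_def)
        also have "\<dots> = real (N div (p * p))" by (simp add: div_mult2_eq)
        also have "\<dots> \<le> real N * (1 / (real p)\<^sup>2)" using real_div_le[of N "p * p"] by (simp add: power2_eq_square)
        finally show "norm (\<Sum>m=1..N div p. (mu (p * m) + mu m) * F (p * m)) \<le> real N * (1 / (real p)\<^sup>2)" .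
      qed
      also have "\<dots> = real N * (\<Sum>p\<in>P. 1 / (real p)\<^sup>2)" by (simp only: sum_distrib_left)
      also have "\<dots> \<le> real N * 1" by (intro mult_left_mono sum_prime_reciprocal_squares_le P) auto
      finally show ?thesis by simp
    qed
    have bound3: "norm (\<Sum>m=1..N. mu m * G m) \<le> d * ((A + A) * real N + C) + real N / (4 * d)"
    proof -
      have "norm (\<Sum>m=1..N. mu m * G m) \<le> (\<Sum>m=1..N. d * (norm (G m))\<^sup>2 + 1 / (4 * d))"
      proof (rule sum_norm_le)
        fix m
        have "norm (mu m * G m) \<le> 1 * norm (G m)" unfolding norm_mult by (intro mult_right_mono mu) auto
        also have "\<dots> \<le> d * (norm (G m))\<^sup>2 + 1 / (4 * d)" using abs_le_square_plus[OF d, of "norm (G m)"] by simp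
        finally show "norm (mu m * G m) \<le> d * (norm (G m))\<^sup>2 + 1 / (4 * d)" .
      qed
      also have "\<dots> = d * (\<Sum>m=1..N. (norm (G m))\<^sup>2) + real N / (4 * d)" by (simp add: sum.distrib sum_distrib_left)
      also have "(\<Sum>m=1..N. (norm (G m))\<^sup>2) \<le> (A + A) * real N + C" unfolding G_def by (rule C)
      finally show ?thesis using d by (simp add: mult_left_mono)
    qed
    have "of_real A * (\<Sum>n=1..N. mu n * F n)
       = (\<Sum>n=1..N. of_real (A - w n) * (mu n * F n)) + (\<Sum>n=1..N. of_real (w n) * (mu n * F n))"
      by (simp add: sum_distrib_left sum.distrib[symmetric] left_diff_distrib)
    then have "norm (of_real A * (\<Sum>n=1..N. mu n * F n))
       \<le> norm (\<Sum>n=1..N. of_real (A - w n) * (mu n * F n)) + (norm (\<Sum>p\<in>P. \<Sum>m=1..N div p. (mu (p * m) + mu m) * F (p * m))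
         + norm (\<Sum>m=1..N. mu m * G m))"
      unfolding split by (simp only:) (intro norm_triangle_le add_left_mono norm_triangle_ineq4)
    also have "\<dots> \<le> (d * (A * real N + 2 * A * real (card P)) + real N / (4 * d)) + (real N + (d * ((A + A) * real N + C) + real N / (4 * d)))"
      by (intro add_mono bound1 bound2 bound3)
    also have "\<dots> = (3 * d * A + 1 / (2 * d) + 1) * real N + C'"
      using d by (simp add: C'_def field_simps)
    finally show ?thesis using A(1) by (simp add: norm_mult mu_def)
  qed
  have "norm (\<Sum>n=1..N. of_int (moebius_mu n) * F n) \<le> C' / A + e * real N" for N
  proof -
    have "3 * d * A + 1 / (2 * d) + 1 \<le> e * A"
    proof -
      have "3 * d * A = e / 3 * A" by (simp add: d_def)
      moreover have "1 / (2 * d) \<le> e / 3 * A"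
      proof -
        have "e / 3 * (27 / (2 * e\<^sup>2)) \<le> e / 3 * A" using A(2) e by (intro mult_left_mono) auto
        moreover have "e / 3 * (27 / (2 * e\<^sup>2)) = 1 / (2 * d)" using e by (simp add: d_def field_simps power2_eq_square)
        ultimately show ?thesis by simp
      qed
      moreover have "1 \<le> e / 3 * A" using A(3) e by (simp add: field_simps)
      moreover have "e * A = e / 3 * A + e / 3 * A + e / 3 * A" by simp
      ultimately show ?thesis by linarith
    qed
    then have "(3 * d * A + 1 / (2 * d) + 1) * real N \<le> e * A * real N" by (rule mult_right_mono) simp
    then have "A * norm (\<Sum>n=1..N. of_int (moebius_mu n) * F n) \<le> e * A * real N + C'"
      using main[of N] by linarith
    then show ?thesis using A(1) by (simp add: field_simps)
  qed
  then show "\<exists>C. \<forall>N. norm (\<Sum>n=1..N. of_int (moebius_mu n) * F n) \<le> C + e * real N" by blast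
qed

section \<open>Davenport's theorem\<close>

lemma sublinear_ec_nonint:
  assumes "b \<notin> \<int>"
  shows "sublinear (\<lambda>M. \<Sum>m=1..M. ec (real m * b))"
proof (rule sublinear_bounded)
  fix M
  have z: "ec b \<noteq> 1" using assms by (simp add: ec_eq_1_iff)
  have "(\<Sum>m=1..M. ec (real m * b)) = (\<Sum>m<M. ec b ^ Suc m)"
    by (simp add: ec_power sum.atLeast1_atMost_eq del: power_Suc)
  also have "\<dots> = ec b * ((ec b ^ M - 1) / (ec b - 1))"
    using z by (simp add: sum_distrib_left[symmetric] geometric_sum)
  also have "norm \<dots> \<le> 1 * (2 / norm (ec b - 1))"
    unfolding norm_mult norm_divide norm_ec
    using norm_triangle_ineq4[of "ec b ^ M" 1] by (intro mult_left_mono divide_right_mono) (auto simp: norm_power)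
  finally show "norm (\<Sum>m=1..M. ec (real m * b)) \<le> 2 / norm (ec b - 1)" by simp
qed

text \<open>Rational a make the exponential periodic. For irrational a the products of the values at pm and rm form a
geometric progression with ratio different from 1.\<close>

theorem davenport:
  "sublinear (\<lambda>N. \<Sum>n=1..N. of_int (moebius_mu n) * ec (real n * a))"
proof (cases "a \<in> \<rat>")
  case True
  then obtain k l where l: "l > 0" and a: "a = of_int k / of_int l" by (rule Rats_cases')
  show ?thesis
  proof (rule sublinear_moebius_periodic[of "nat l"])
    fix n
    have "real (n + nat l) * a = real n * a + of_int k" using l by (simp add: a field_simps)
    then show "ec (real (n + nat l) * a) = ec (real n * a)" by (simp add: ec_add ec_Ints)
  qed (use l in auto)
next
  case False
  show ?thesis
  proof (rule katai_criterion_moebius)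
    fix p r :: nat assume "p \<noteq> r"
    define b where "b = (real p - real r) * a"
    have "b \<notin> \<int>"
    proof
      assume "b \<in> \<int>"
      then have "b / (real p - real r) \<in> \<rat>" using Ints_subset_Rats by (intro Rats_divide) auto
      then show False using False \<open>p \<noteq> r\<close> by (simp add: b_def)
    qed
    then have "sublinear (\<lambda>M. \<Sum>m=1..M. ec (real m * b))" by (rule sublinear_ec_nonint)
    also have "(\<lambda>M. \<Sum>m=1..M. ec (real m * b)) = (\<lambda>M. \<Sum>m=1..M. ec (real (p * m) * a) * cnj (ec (real (r * m) * a)))"
      by (intro ext sum.cong refl) (simp add: cnj_ec ec_add[symmetric] b_def algebra_simps)
    finally show "sublinear (\<lambda>M. \<Sum>m=1..M. ec (real (p * m) * a) * cnj (ec (real (r * m) * a)))" .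
  qed simp
qed

text \<open>The indicator of a residue class is an average of additive characters, which only shift a.\<close>

lemma davenport_progression:
  assumes q: "q > 0" and r: "r < q"
  shows "sublinear (\<lambda>N. \<Sum>n=1..N. of_int (moebius_mu n) * (if n mod q = r then ec (real n * a) else 0))"
proof -
  have ind: "(if n mod q = r then ec (real n * a) else 0)
      = (\<Sum>j<q. (ec (- (real r * real j / real q)) / of_nat q) * ec (real n * (a + real j / real q)))" for n
  proof -
    have "int q dvd int n - int r \<longleftrightarrow> n mod q = r"
    proof -
      have "int q dvd int n - int r \<longleftrightarrow> int n mod int q = int r mod int q" by (simp add: mod_eq_dvd_iff)
      also have "\<dots> \<longleftrightarrow> n mod q = r mod q" by (simp flip: zmod_int)
      finally show ?thesis using r by simp
    qed
    then have "(if n mod q = r then ec (real n * a) else 0)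
       = ec (real n * a) * (\<Sum>j<q. ec (of_int (int n - int r) * real j / real q)) / of_nat q"
      using sum_ec_div[OF q, of "int n - int r"] q by simp
    also have "\<dots> = (\<Sum>j<q. ec (real n * a) * ec (of_int (int n - int r) * real j / real q) / of_nat q)"
      by (simp only: sum_distrib_left sum_divide_distrib)
    also have "\<dots> = (\<Sum>j<q. (ec (- (real r * real j / real q)) / of_nat q) * ec (real n * (a + real j / real q)))"
    proof (rule sum.cong[OF refl])
      fix j
      have "real n * a + of_int (int n - int r) * real j / real q
          = - (real r * real j / real q) + real n * (a + real j / real q)"
        using q by (simp add: field_simps)
      then show "ec (real n * a) * ec (of_int (int n - int r) * real j / real q) / of_nat q
          = (ec (- (real r * real j / real q)) / of_nat q) * ec (real n * (a + real j / real q))"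
        by (metis ec_add times_divide_eq_left)
    qed
    finally show ?thesis .
  qed
  have "sublinear (\<lambda>N. \<Sum>j<q. (ec (- (real r * real j / real q)) / of_nat q)
      * (\<Sum>n=1..N. of_int (moebius_mu n) * ec (real n * (a + real j / real q))))"
    by (intro sublinear_sum sublinear_cmult davenport)
  also have "(\<lambda>N. \<Sum>j<q. (ec (- (real r * real j / real q)) / of_nat q)
      * (\<Sum>n=1..N. of_int (moebius_mu n) * ec (real n * (a + real j / real q))))
    = (\<lambda>N. \<Sum>n=1..N. of_int (moebius_mu n) * (if n mod q = r then ec (real n * a) else 0))"
  proof
    fix N
    show "(\<Sum>j<q. (ec (- (real r * real j / real q)) / of_nat q)
      * (\<Sum>n=1..N. of_int (moebius_mu n) * ec (real n * (a + real j / real q))))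
      = (\<Sum>n=1..N. of_int (moebius_mu n) * (if n mod q = r then ec (real n * a) else 0))"
      unfolding ind sum_distrib_left by (subst sum.swap) (simp only: mult.left_commute)
  qed
  finally show ?thesis .
qed

section \<open>Trigonometric approximation\<close>

inductive trig_poly :: "(real \<Rightarrow> complex) \<Rightarrow> bool" where
  monomial: "trig_poly (\<lambda>x. c * ec (of_int k * x))"
| add: "trig_poly f \<Longrightarrow> trig_poly g \<Longrightarrow> trig_poly (\<lambda>x. f x + g x)"

lemma trig_poly_mult_monomial:
  assumes "trig_poly g"
  shows "trig_poly (\<lambda>x. (c * ec (of_int k * x)) * g x)"
  using assms
proof (induction rule: trig_poly.induct)
  case (monomial d l)
  have "(c * ec (of_int k * x)) * (d * ec (of_int l * x)) = (c * d) * ec (of_int (k + l) * x)" for x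
  proof -
    have "ec (of_int (k + l) * x) = ec (of_int k * x) * ec (of_int l * x)"
      by (simp only: of_int_add distrib_right ec_add)
    then show ?thesis by (simp only: mult_ac)
  qed
  then show ?case using trig_poly.monomial[of "c * d" "k + l"] by (simp only:)
next
  case (add f g)
  then show ?case using trig_poly.add[OF add.IH] by (simp add: distrib_left)
qed

lemma trig_poly_mult: "trig_poly f \<Longrightarrow> trig_poly g \<Longrightarrow> trig_poly (\<lambda>x. f x * g x)"
proof (induction rule: trig_poly.induct)
  case (monomial c k)
  then show ?case by (rule trig_poly_mult_monomial)
next
  case (add f1 f2)
  then show ?case using trig_poly.add[OF add.IH(1) add.IH(2)] by (simp add: distrib_right)
qed

lemma trig_poly_const: "trig_poly (\<lambda>x. c)"
  using trig_poly.monomial[of c 0] by simp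

lemma trig_poly_Re_Im: "trig_poly (\<lambda>x. of_real (Re (ec x)))" "trig_poly (\<lambda>x. of_real (Im (ec x)))"
proof -
  have "of_real (Re (ec x)) = (1/2) * ec (of_int 1 * x) + (1/2) * ec (of_int (-1) * x)" for x
    by (simp add: complex_eq_iff cnj_ec[symmetric])
  then show "trig_poly (\<lambda>x. of_real (Re (ec x)))"
    using trig_poly.add[OF trig_poly.monomial[of "1/2" 1] trig_poly.monomial[of "1/2" "-1"]] by (simp only:)
  have "of_real (Im (ec x)) = (-\<i>/2) * ec (of_int 1 * x) + (\<i>/2) * ec (of_int (-1) * x)" for x
    by (simp add: complex_eq_iff cnj_ec[symmetric])
  then show "trig_poly (\<lambda>x. of_real (Im (ec x)))"
    using trig_poly.add[OF trig_poly.monomial[of "-\<i>/2" 1] trig_poly.monomial[of "\<i>/2" "-1"]] by (simp only:)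
qed

text \<open>On the unit circle the real and imaginary part are trigonometric polynomials, and these form an algebra.\<close>

lemma trig_poly_real_polynomial:
  fixes p :: "complex \<Rightarrow> real"
  assumes "real_polynomial_function p"
  shows "trig_poly (\<lambda>x. of_real (p (ec x)))"
  using assms
proof (induction rule: real_polynomial_function.induct)
  case (linear f)
  have f: "f z = Re z * f 1 + Im z * f \<i>" for z
  proof -
    have "z = Re z *\<^sub>R 1 + Im z *\<^sub>R \<i>" by (simp add: complex_eq_iff)
    from arg_cong[OF this, of f] have "f z = f (Re z *\<^sub>R 1 + Im z *\<^sub>R \<i>)" .
    also have "\<dots> = Re z * f 1 + Im z * f \<i>"
      using bounded_linear.linear[OF linear] by (simp add: linear_add linear_scale)
    finally show ?thesis .
  qed
  have eq: "(of_real (f (ec x)) :: complex) = of_real (Re (ec x)) * of_real (f 1) + of_real (Im (ec x)) * of_real (f \<i>)" for x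
    by (subst f) simp
  show ?case unfolding eq
    by (intro trig_poly.add trig_poly_mult trig_poly_const trig_poly_Re_Im)
next
  case (const c)
  then show ?case by (rule trig_poly_const)
next
  case (add f g)
  then show ?case using trig_poly.add[OF add.IH] by simp
next
  case (mult f g)
  then show ?case using trig_poly_mult[OF mult.IH] by simp
qed

lemma ec_Arg: "z \<noteq> 0 \<Longrightarrow> ec (Arg z / (2 * pi)) = z / of_real (norm z)"
proof -
  assume z: "z \<noteq> 0"
  have "z / of_real (norm z) = of_real (norm z) * exp (\<i> * of_real (Arg z)) / of_real (norm z)"
    using arg_cong[OF Arg_eq[OF z], of "\<lambda>w. w / of_real (norm z)"] .
  also have "\<dots> = exp (\<i> * of_real (Arg z))" using z by simp
  finally show ?thesis by (simp add: ec_def cis_conv_exp)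
qed

text \<open>H induces a function k on the punctured plane, constant on rays. The argument function is discontinuous
on the negative real axis, so continuity of k is checked there in a second chart, rotated by a half
turn. The Weierstrass theorem on the unit circle does the rest.\<close>

lemma trig_poly_approximation:
  fixes H :: "real \<Rightarrow> complex"
  assumes cont: "continuous_on UNIV H" and per: "\<And>x y. x - y \<in> \<int> \<Longrightarrow> H x = H y" and e: "e > 0"
  obtains f where "trig_poly f" "\<And>x. norm (H x - f x) < e"
proof -
  define k where "k = (\<lambda>z. H (Arg z / (2 * pi)))"
  have ec_eq: "x - y \<in> \<int>" if "ec x = ec y" for x y
  proof -
    have "ec (x - y) = ec x * cnj (ec y)" by (simp add: cnj_ec ec_add[symmetric])
    also have "\<dots> = 1" unfolding that by (simp add: cnj_ec ec_add[symmetric])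
    finally show ?thesis by (simp add: ec_eq_1_iff)
  qed
  have k_ec: "k (ec x) = H x" for x
    unfolding k_def
  proof (rule per, rule ec_eq)
    have "ec x \<noteq> 0" using norm_ec[of x] by (metis norm_zero zero_neq_one)
    then show "ec (Arg (ec x) / (2 * pi)) = ec x" by (simp add: ec_Arg)
  qed
  have k_alt: "k z = H (Arg (- z) / (2 * pi) + 1 / 2)" if "z \<noteq> 0" for z
    unfolding k_def
  proof (rule per, rule ec_eq)
    \<comment> \<open>Passing from z to -z changes the argument by half a turn.\<close>
    have "ec (1 / 2) = -1" by (simp add: ec_def)
    then show "ec (Arg z / (2 * pi)) = ec (Arg (- z) / (2 * pi) + 1 / 2)"
      using that by (simp add: ec_add ec_Arg)
  qed
  have contH: "isCont H x" for x using cont by (simp add: continuous_on_eq_continuous_at)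
  have isC: "isCont k z" if z: "z \<noteq> 0" for z
  proof (cases "z \<in> \<real>\<^sub>\<le>\<^sub>0")
    case False
    have "isCont (\<lambda>z. H (Arg z / (2 * pi))) z"
      by (rule isCont_o2[OF _ contH]) (use False in \<open>auto intro!: continuous_intros continuous_at_Arg\<close>)
    then show ?thesis by (simp add: k_def)
  next
    case True
    then have "- z \<notin> \<real>\<^sub>\<le>\<^sub>0" using z by (auto simp: complex_nonpos_Reals_iff complex_eq_iff)
    then have "isCont Arg (- z)" by (rule continuous_at_Arg)
    then have "isCont (\<lambda>z. Arg (- z)) z" by (rule isCont_o2[rotated]) (auto intro!: continuous_intros)
    then have "isCont (\<lambda>z. H (Arg (- z) / (2 * pi) + 1 / 2)) z"
      by (intro isCont_o2[OF _ contH] continuous_intros) auto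
    moreover have ev: "\<forall>\<^sub>F w in nhds z. k w = H (Arg (- w) / (2 * pi) + 1 / 2)"
      using t1_space_nhds[OF z] by (rule eventually_mono) (rule k_alt)
    ultimately show ?thesis by (simp only: isCont_cong[OF ev])
  qed
  have "continuous_on (sphere 0 1) k"
  proof (rule continuous_at_imp_continuous_on, rule ballI)
    fix z :: complex assume "z \<in> sphere 0 1"
    then have "norm z = 1" by simp
    then have "z \<noteq> 0" by (metis norm_zero zero_neq_one)
    then show "isCont k z" by (rule isC)
  qed
  then obtain g where g: "polynomial_function g" "\<And>z. z \<in> sphere 0 1 \<Longrightarrow> norm (k z - g z) < e"
    using Stone_Weierstrass_polynomial_function[of "sphere 0 1" k e] e by auto
  have "real_polynomial_function (Re \<circ> g)" "real_polynomial_function (Im \<circ> g)"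
    using g(1)[unfolded polynomial_function_def, rule_format] bounded_linear_Re bounded_linear_Im by simp_all
  then have "trig_poly (\<lambda>x. of_real (Re (g (ec x))))" "trig_poly (\<lambda>x. of_real (Im (g (ec x))))"
    using trig_poly_real_polynomial[of "Re \<circ> g"] trig_poly_real_polynomial[of "Im \<circ> g"] by simp_all
  then have "trig_poly (\<lambda>x. of_real (Re (g (ec x))) + \<i> * of_real (Im (g (ec x))))"
    by (intro trig_poly.add trig_poly_mult trig_poly_const)
  then have "trig_poly (\<lambda>x. g (ec x))" by (simp only: complex_eq[symmetric])
  moreover have "norm (H x - g (ec x)) < e" for x using g(2)[of "ec x"] by (simp add: k_ec)
  ultimately show ?thesis by (rule that)
qed

lemma sublinear_trig_poly:
  assumes "trig_poly f" and q: "q > 0" "r < q"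
  shows "sublinear (\<lambda>N. \<Sum>n=1..N. of_int (moebius_mu n) * (if n mod q = r then f (y + real n * b) else 0))"
  using assms(1)
proof (induction rule: trig_poly.induct)
  case (monomial c k)
  have "sublinear (\<lambda>N. (c * ec (of_int k * y)) * (\<Sum>n=1..N. of_int (moebius_mu n) * (if n mod q = r then ec (real n * (of_int k * b)) else 0)))"
    by (intro sublinear_cmult davenport_progression q)
  also have "(\<lambda>N. (c * ec (of_int k * y)) * (\<Sum>n=1..N. of_int (moebius_mu n) * (if n mod q = r then ec (real n * (of_int k * b)) else 0)))
     = (\<lambda>N. \<Sum>n=1..N. of_int (moebius_mu n) * (if n mod q = r then c * ec (of_int k * (y + real n * b)) else 0))"
    unfolding sum_distrib_left by (intro ext sum.cong refl) (simp add: ec_add distrib_left mult_ac)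
  finally show ?case .
next
  case (add f g)
  have "(\<lambda>N. \<Sum>n=1..N. of_int (moebius_mu n) * (if n mod q = r then f (y + real n * b) + g (y + real n * b) else 0))
    = (\<lambda>N. (\<Sum>n=1..N. of_int (moebius_mu n) * (if n mod q = r then f (y + real n * b) else 0))
       + (\<Sum>n=1..N. of_int (moebius_mu n) * (if n mod q = r then g (y + real n * b) else 0)))"
    unfolding sum.distrib[symmetric] by (intro ext sum.cong refl) (simp add: distrib_left)
  then show ?case using sublinear_add[OF add.IH] by simp
qed

lemma sublinear_periodic_continuous:
  fixes H :: "real \<Rightarrow> complex"
  assumes cont: "continuous_on UNIV H" and per: "\<And>x y. x - y \<in> \<int> \<Longrightarrow> H x = H y"
    and q: "q > 0" "r < q"
  shows "sublinear (\<lambda>N. \<Sum>n=1..N. of_int (moebius_mu n) * (if n mod q = r then H (y + real n * b) else 0))"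
proof (rule sublinearI)
  fix e :: real assume e: "e > 0"
  obtain f where f: "trig_poly f" "\<And>x. norm (H x - f x) < e / 2"
    by (rule trig_poly_approximation[OF cont per, of "e / 2"]) (use e in auto)
  let ?S = "\<lambda>H N. \<Sum>n=1..N. of_int (moebius_mu n) * (if n mod q = r then H (y + real n * b) else (0::complex))"
  obtain C where C: "\<And>N. norm (?S f N) \<le> C + e / 2 * real N"
    using sublinear_trig_poly[OF f(1) q, of y b] e unfolding sublinear_def by (meson half_gt_zero)
  have "norm (?S H N) \<le> C + e * real N" for N
  proof -
    have "?S H N = ?S f N + ?S (\<lambda>x. H x - f x) N"
      unfolding sum.distrib[symmetric] by (intro sum.cong refl) (simp add: right_diff_distrib)
    then have "norm (?S H N) \<le> norm (?S f N) + norm (?S (\<lambda>x. H x - f x) N)"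
      by (simp only: norm_triangle_ineq)
    moreover have "norm (?S (\<lambda>x. H x - f x) N) \<le> (\<Sum>n=1..N. e / 2)"
    proof (rule sum_norm_le)
      fix n
      have "norm (if n mod q = r then H (y + real n * b) - f (y + real n * b) else 0) \<le> e / 2"
        using f(2)[of "y + real n * b"] e by simp
      from mult_mono[OF norm_moebius_mu_le[of n] this]
      show "norm (of_int (moebius_mu n) * (if n mod q = r then H (y + real n * b) - f (y + real n * b) else 0)) \<le> e / 2"
        by (simp add: norm_mult)
    qed
    moreover have "(\<Sum>n=1..N. e / 2) = e / 2 * real N" by simp
    moreover have "e * real N = e / 2 * real N + e / 2 * real N" by simp
    ultimately show ?thesis using C[of N] by linarith
  qed
  then show "\<exists>C. \<forall>N. norm (?S H N) \<le> C + e * real N" by blast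
qed

section \<open>Orbits of the skew product\<close>

lemma to_circle_add: "to_circle (x + y) = to_circle x + to_circle y"
  by (simp add: plus_circle.abs_eq)

lemma to_circle_Ints: "x \<in> \<int> \<Longrightarrow> to_circle x = 0"
  by (simp add: zero_circle_def to_circle_eq_iff)

context
  fixes f :: "circle \<Rightarrow> circle" and a :: circle and R :: "circle \<times> circle \<Rightarrow> circle \<times> circle"
  assumes R: "R = (\<lambda>(x, y). (x + a, f x + y))"
begin

text \<open>R commutes with the translations of the second coordinate.\<close>

lemma skew_fiber_translation: "(R ^^ n) (x, y + t) = (fst ((R ^^ n) (x, y)), snd ((R ^^ n) (x, y)) + t)"
  by (induction n) (auto simp: R case_prod_unfold add.assoc)

text \<open>If R^q returns to the fibre over x, it acts on that fibre as a translation, by some s.\<close>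

lemma skew_periodic_base:
  assumes q: "q > 0" and fixed: "\<And>y. fst ((R ^^ q) (x, y)) = x"
  obtains s :: real where
    "\<And>m r. (R ^^ (q * m + r)) (x, y) = (fst ((R ^^ r) (x, y)), snd ((R ^^ r) (x, y)) + to_circle (real m * s))"
proof -
  define s where "s = rep_circle (snd ((R ^^ q) (x, y)) - y)"
  have 1: "(R ^^ q) (x, y) = (x, y + to_circle s)"
    using fixed by (simp add: s_def prod_eq_iff)
  have iter: "(R ^^ (q * m)) (x, y) = (x, y + to_circle (real m * s))" for m
  proof (induction m)
    case 0
    have "to_circle 0 = 0" by (simp add: zero_circle_def)
    then show ?case by simp
  next
    case (Suc m)
    have "(R ^^ (q * Suc m)) (x, y) = (R ^^ q) ((R ^^ (q * m)) (x, y))" by (simp add: funpow_add)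
    also have "\<dots> = (x, y + to_circle s + to_circle (real m * s))"
      unfolding Suc skew_fiber_translation 1 by simp
    also have "to_circle (real (Suc m) * s) = to_circle s + to_circle (real m * s)"
      by (simp add: to_circle_add[symmetric] distrib_right)
    ultimately show ?case by (simp add: add.assoc)
  qed
  have "(R ^^ (q * m + r)) (x, y) = (fst ((R ^^ r) (x, y)), snd ((R ^^ r) (x, y)) + to_circle (real m * s))" for m r
    by (subst add.commute) (simp only: funpow_add o_apply iter skew_fiber_translation)
  then show ?thesis by (rule that)
qed

end

theorem proposition2p3p3:
  fixes p q :: int
    and f :: "circle \<Rightarrow> circle"
    and R :: "circle \<times> circle \<Rightarrow> circle \<times> circle"
    and z :: "circle \<times> circle"
    and g :: "circle \<times> circle \<Rightarrow> complex"
  assumes "q \<noteq> 0"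
    and "continuous_on UNIV f"
    and "R = (\<lambda>(x, y). (x + to_circle (of_int p / of_int q), f x + y))"
    and "continuous_on UNIV g"
  shows "(\<lambda>N :: nat. \<Sum>n = 1..N. g ((R ^^ n) z) * of_int (moebius_mu n)) \<in> o(\<lambda>N. of_nat N)"
proof -
  obtain x y where z: "z = (x, y)" by fastforce
  define Q where "Q = nat \<bar>q\<bar>"
  have Q: "Q > 0" using assms(1) by (simp add: Q_def)
  have base: "fst ((R ^^ n) (x, y)) = x + to_circle (real n * (of_int p / of_int q))" for n y
  proof (induction n)
    case 0
    have "to_circle 0 = 0" by (simp add: zero_circle_def)
    then show ?case by simp
  next
    case (Suc n)
    have "real (Suc n) * t = real n * t + t" for t by (simp add: algebra_simps)
    from this[of "of_int p / of_int q"]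
    have "real (Suc n) * (of_int p / of_int q) = real n * (of_int p / of_int q) + of_int p / of_int q" .
    then show ?case using Suc by (simp add: assms(3) case_prod_unfold to_circle_add add.assoc del: of_nat_Suc)
  qed
  have "real Q * (of_int p / of_int q) = of_int (sgn q * p)"
    using assms(1) by (simp add: Q_def sgn_if abs_if)
  then have fixed: "fst ((R ^^ Q) (x, y)) = x" for y
    unfolding base by (simp add: to_circle_Ints)
  obtain s :: real where s:
    "\<And>m r. (R ^^ (Q * m + r)) (x, y) = (fst ((R ^^ r) (x, y)), snd ((R ^^ r) (x, y)) + to_circle (real m * s))"
    by (rule skew_periodic_base[OF assms(3) Q fixed]) blast
  define X where "X = (\<lambda>r. fst ((R ^^ r) (x, y)))"
  \<comment> \<open>The orbit makes one step s per q iterations. Extending this motion linearly to all n, as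
      n * (s / Q), requires the correction r * s / Q on the class of r.\<close>
  define Y where "Y = (\<lambda>r. rep_circle (snd ((R ^^ r) (x, y))) - real r * s / real Q)"
  define H where "H = (\<lambda>r t. g (X r, to_circle t))"
  have orbit: "g ((R ^^ n) z) = H (n mod Q) (Y (n mod Q) + real n * (s / real Q))" for n
  proof -
    have n: "n = Q * (n div Q) + n mod Q" by simp
    have "(R ^^ n) z = (X (n mod Q), snd ((R ^^ (n mod Q)) (x, y)) + to_circle (real (n div Q) * s))"
      unfolding z X_def by (subst (1) n) (rule s)
    also have "snd ((R ^^ (n mod Q)) (x, y)) + to_circle (real (n div Q) * s)
        = to_circle (rep_circle (snd ((R ^^ (n mod Q)) (x, y))) + real (n div Q) * s)"
      by (simp add: to_circle_add)
    also have "rep_circle (snd ((R ^^ (n mod Q)) (x, y))) + real (n div Q) * s = Y (n mod Q) + real n * (s / real Q)"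
    proof -
      have "real n = real Q * real (n div Q) + real (n mod Q)" by (metis n of_nat_add of_nat_mult)
      then have "real n * (s / real Q) = real (n div Q) * s + real (n mod Q) * s / real Q"
        using Q by (simp add: field_simps)
      then show ?thesis by (simp add: Y_def)
    qed
    finally show ?thesis by (simp add: H_def)
  qed
  have H_cont: "continuous_on UNIV (H r)" for r
    unfolding H_def
    by (rule continuous_on_compose2[OF assms(4)]) (auto intro!: continuous_intros continuous_to_circle)
  have H_per: "H r t = H r u" if "t - u \<in> \<int>" for r t u
    using that by (simp add: H_def to_circle_eq_iff[symmetric])
  have "sublinear (\<lambda>N. \<Sum>r<Q. \<Sum>n=1..N. of_int (moebius_mu n) * (if n mod Q = r then H r (Y r + real n * (s / real Q)) else 0))"
    by (intro sublinear_sum sublinear_periodic_continuous H_cont H_per Q) auto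
  also have "(\<lambda>N. \<Sum>r<Q. \<Sum>n=1..N. of_int (moebius_mu n) * (if n mod Q = r then H r (Y r + real n * (s / real Q)) else 0))
      = (\<lambda>N. \<Sum>n=1..N. g ((R ^^ n) z) * of_int (moebius_mu n))"
  proof
    fix N
    have "(\<Sum>r<Q. of_int (moebius_mu n) * (if n mod Q = r then H r (Y r + real n * (s / real Q)) else 0))
        = g ((R ^^ n) z) * of_int (moebius_mu n)" for n
      unfolding orbit sum_distrib_left[symmetric] using Q by (simp add: mult.commute)
    then show "(\<Sum>r<Q. \<Sum>n=1..N. of_int (moebius_mu n) * (if n mod Q = r then H r (Y r + real n * (s / real Q)) else 0))
      = (\<Sum>n=1..N. g ((R ^^ n) z) * of_int (moebius_mu n))"
      by (subst sum.swap) (simp only:)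
  qed
  finally have "(\<lambda>N. (\<Sum>n=1..N. g ((R ^^ n) z) * of_int (moebius_mu n)) / of_nat N) \<longlonglongrightarrow> 0"
    by (rule sublinear_imp_tendsto)
  then show ?thesis
    by (rule smalloI_tendsto) (use eventually_gt_at_top[of 0] in \<open>auto elim!: eventually_mono\<close>)
qed

end
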